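(* Let $k,m\geq 0$ and $n\geq 1$ be integers and let $q=(q_1,\ldots,q_m)$ be an $m$-tuple of integers $q_i>1$. The group $\pi_1^{orb}(PB_n(\mathbb{C}(k,m;q)))$ is generated by the braids $$X_{ij}\ (1\leq i\leq n,\ 1\leq j\leq m),\qquad P_{ij}\ (1\leq i\leq n,\ 1\leq j\leq k),\qquad B_{ij}\ (1\leq i<j\leq n).$$
   Context: $\mathbb{C}(k,m;q)$ is the $2$-dimensional orbifold with underlying space $\mathbb{C}-\{p_1,\ldots,p_k\}$ ($k$ distinct punctures) and $m$ distinct cone points $x_1,\ldots,x_m$, $x_i$ of order $q_i$. $PB_n(\mathbb{C}(k,m;q))$ is the configuration orbifold of $n$ pairwise distinct points (the open suborbifold of $\mathbb{C}(k,m;q)^n$ of $n$-tuples with pairwise distinct coordinates); for a space $X$, $PB_n(X)\subset X^n$ is the space of $n$-tuples of pairwise distinct points. The positions of punctures and cone points do not affect the group, so take them and the base point $(z_1,\ldots,z_n)$ on the real line with $z_1<\cdots<z_n<p_1<\cdots<p_k<x_1<\cdots<x_m$. Put $N=n+k+m$, and number these $N$ points $1,\ldots,N$ from left to right. Let $\sigma_1,\ldots,\sigma_{N-1}$ be the standard Artin generators of the classical braid group $\pi_1(B_N(\mathbb{C}))$ on $N$ strings based at these points, and for $i<j$ let $$B^{(N)}_{ij}=\sigma_{j-1}\sigma_{j-2}\cdots\sigma_{i+1}\sigma_i^2\sigma_{i+1}^{-1}\cdots\sigma_{j-2}^{-1}\sigma_{j-1}^{-1}\in\pi_1(PB_N(\mathbb{C})).$$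 The map $(y_1,\ldots,y_n)\mapsto(y_1,\ldots,y_n,p_1,\ldots,p_k,x_1,\ldots,x_m)$ induces an injection of $\pi_1(PB_n(\mathbb{C}-\{p_1,\ldots,p_k,x_1,\ldots,x_m\}))$ into $\pi_1(PB_N(\mathbb{C}))$ (pure braids whose last $k+m$ strings are vertically straight), whose image contains $B^{(N)}_{ij}$ whenever $i\leq n$. Let $\mathcal{O}_n:\pi_1(PB_n(\mathbb{C}-\{p_1,\ldots,p_k,x_1,\ldots,x_m\}))\to\pi_1^{orb}(PB_n(\mathbb{C}(k,m;q)))$ be induced by the inclusion of the open suborbifold (filling the last $m$ punctures by the cone points). Identifying $B^{(N)}_{ij}$, $i\leq n$, with its preimage, define $$B_{ij}=\mathcal{O}_n(B^{(N)}_{ij})\ (1\leq i<j\leq n),\quad P_{ij}=\mathcal{O}_n(B^{(N)}_{i,n+j})\ (1\leq j\leq k),\quad X_{ij}=\mathcal{O}_n(B^{(N)}_{i,n+k+j})\ (1\leq j\leq m).$$ So $X_{ij}$ is the braid in which string $i$ wraps once around the line of the cone point $x_j$, $P_{ij}$ the one in which string $i$ wraps once around the line of the puncture $p_j$, and $B_{ij}$ the classical pure braid generator on strings $i,j$. *)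

theory Defs
  imports "HOL-Analysis.Analysis" "HOL-Algebra.Generated_Groups"
begin

section \<open>Fundamental groups of abstract topologies\<close>

text \<open>The library's \<^const>\<open>joinpaths\<close> and \<^const>\<open>homotopic_paths\<close> need a type of class
  \<^class>\<open>topological_space\<close>, which is not available for the points of an unordered configuration
  space (sets of complex numbers).\<close>

definition path_join :: "(real \<Rightarrow> 'a) \<Rightarrow> (real \<Rightarrow> 'a) \<Rightarrow> real \<Rightarrow> 'a" where
  "path_join \<gamma> \<delta> = (\<lambda>t. if t \<le> 1/2 then \<gamma> (2 * t) else \<delta> (2 * t - 1))"

definition path_homotopic :: "'a topology \<Rightarrow> (real \<Rightarrow> 'a) \<Rightarrow> (real \<Rightarrow> 'a) \<Rightarrow> bool" where
  "path_homotopic X \<gamma> \<delta> \<longleftrightarrow>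
     homotopic_with (\<lambda>\<eta>. \<eta> 0 = \<gamma> 0 \<and> \<eta> 1 = \<gamma> 1) (top_of_set {0..1}) X \<gamma> \<delta>"

definition loops :: "'a topology \<Rightarrow> 'a \<Rightarrow> (real \<Rightarrow> 'a) set" where
  "loops X b = {\<gamma>. pathin X \<gamma> \<and> \<gamma> 0 = b \<and> \<gamma> 1 = b}"

definition loop_rel :: "'a topology \<Rightarrow> 'a \<Rightarrow> ((real \<Rightarrow> 'a) \<times> (real \<Rightarrow> 'a)) set" where
  "loop_rel X b = {(\<gamma>, \<delta>). \<gamma> \<in> loops X b \<and> \<delta> \<in> loops X b \<and> path_homotopic X \<gamma> \<delta>}"

definition fundamental_group :: "'a topology \<Rightarrow> 'a \<Rightarrow> (real \<Rightarrow> 'a) set monoid" where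
  "fundamental_group X b =
     \<lparr>carrier = loops X b // loop_rel X b,
      mult = (\<lambda>A B. \<Union>\<gamma>\<in>A. \<Union>\<delta>\<in>B. loop_rel X b `` {path_join \<gamma> \<delta>}),
      one = loop_rel X b `` {\<lambda>_. b}\<rparr>"

text \<open>The homomorphism induced by a continuous map \<open>f\<close> into \<open>Y\<close>; \<open>c\<close> is the base point of \<open>Y\<close>.\<close>

definition induced_hom :: "'b topology \<Rightarrow> 'b \<Rightarrow> ('a \<Rightarrow> 'b) \<Rightarrow> (real \<Rightarrow> 'a) set \<Rightarrow> (real \<Rightarrow> 'b) set" where
  "induced_hom Y c f A = (\<Union>\<gamma>\<in>A. loop_rel Y c `` {f \<circ> \<gamma>})"


section \<open>Topological groupoids and their fundamental groups\<close>

text \<open>Composition \<open>Cmp G g h\<close> is in diagrammatic order: it is meant for \<open>Tgt G g = Src G h\<close>.\<close>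

record ('o, 'a) top_groupoid =
  Obj :: "'o topology"
  Arr :: "'a topology"
  Src :: "'a \<Rightarrow> 'o"
  Tgt :: "'a \<Rightarrow> 'o"
  Idt :: "'o \<Rightarrow> 'a"
  Cmp :: "'a \<Rightarrow> 'a \<Rightarrow> 'a"

text \<open>Haefliger's \<open>G\<close>-paths: finite sequences of paths in the space of objects and of arrows, each
  starting where the previous one ends. Every path piece is parametrised by \<open>[0, 1]\<close>, and
  the pieces need not alternate with the arrows; since unit arrows and constant paths may be
  inserted, this gives the same homotopy classes.\<close>

datatype ('o, 'a) piece = Along "real \<Rightarrow> 'o" | Jump 'a

inductive gpath :: "('o, 'a) top_groupoid \<Rightarrow> 'o \<Rightarrow> ('o, 'a) piece list \<Rightarrow> 'o \<Rightarrow> bool"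
  for G where
  Nil: "x \<in> topspace (Obj G) \<Longrightarrow> gpath G x [] x"
| Along: "pathin (Obj G) c \<Longrightarrow> gpath G (c 1) w y \<Longrightarrow> gpath G (c 0) (Along c # w) y"
| Jump: "g \<in> topspace (Arr G) \<Longrightarrow> gpath G (Tgt G g) w y \<Longrightarrow> gpath G (Src G g) (Jump g # w) y"

text \<open>The elementary moves between \<open>G\<close>-paths: homotopy and subdivision of the path pieces,
  composition of arrows, and (\<open>slide\<close>) replacement of a path piece \<open>Tgt \<circ> h\<close> by \<open>Src \<circ> h\<close> along a
  path \<open>h\<close> of arrows.\<close>

inductive gmove :: "('o, 'a) top_groupoid \<Rightarrow> ('o, 'a) piece list \<Rightarrow> ('o, 'a) piece list \<Rightarrow> bool"
  for G where
  homotopy: "path_homotopic (Obj G) c d \<Longrightarrow> gmove G [Along c] [Along d]"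
| const: "x \<in> topspace (Obj G) \<Longrightarrow> gmove G [Along (\<lambda>_. x)] []"
| join: "pathin (Obj G) c \<Longrightarrow> pathin (Obj G) d \<Longrightarrow> c 1 = d 0 \<Longrightarrow>
     gmove G [Along c, Along d] [Along (path_join c d)]"
| unit: "x \<in> topspace (Obj G) \<Longrightarrow> gmove G [Jump (Idt G x)] []"
| comp: "g \<in> topspace (Arr G) \<Longrightarrow> h \<in> topspace (Arr G) \<Longrightarrow> Tgt G g = Src G h \<Longrightarrow>
     gmove G [Jump g, Jump h] [Jump (Cmp G g h)]"
| slide: "pathin (Arr G) h \<Longrightarrow>
     gmove G [Jump (h 0), Along (Tgt G \<circ> h)] [Along (Src G \<circ> h), Jump (h 1)]"

inductive gpath_homotopic ::
    "('o, 'a) top_groupoid \<Rightarrow> 'o \<Rightarrow> 'o \<Rightarrow> ('o, 'a) piece list \<Rightarrow> ('o, 'a) piece list \<Rightarrow> bool"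
  for G x y where
  refl: "gpath G x w y \<Longrightarrow> gpath_homotopic G x y w w"
| sym: "gpath_homotopic G x y u v \<Longrightarrow> gpath_homotopic G x y v u"
| trans: "gpath_homotopic G x y u v \<Longrightarrow> gpath_homotopic G x y v w \<Longrightarrow> gpath_homotopic G x y u w"
| move: "gmove G l r \<Longrightarrow> gpath G x (u @ l @ v) y \<Longrightarrow> gpath G x (u @ r @ v) y \<Longrightarrow>
     gpath_homotopic G x y (u @ l @ v) (u @ r @ v)"

definition gloop_rel :: "('o, 'a) top_groupoid \<Rightarrow> 'o \<Rightarrow> (('o, 'a) piece list \<times> ('o, 'a) piece list) set" where
  "gloop_rel G b = {(u, v). gpath_homotopic G b b u v}"

definition orb_fundamental_group ::
    "('o, 'a) top_groupoid \<Rightarrow> 'o \<Rightarrow> ('o, 'a) piece list set monoid" where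
  "orb_fundamental_group G b =
     \<lparr>carrier = {w. gpath G b w b} // gloop_rel G b,
      mult = (\<lambda>A B. \<Union>u\<in>A. \<Union>v\<in>B. gloop_rel G b `` {u @ v}),
      one = gloop_rel G b `` {[]}\<rparr>"


section \<open>Configuration spaces and configuration groupoids\<close>

definition pconf :: "nat \<Rightarrow> 'a topology \<Rightarrow> (nat \<Rightarrow> 'a) topology" where
  "pconf n X = subtopology (product_topology (\<lambda>_. X) {1..n}) {c. inj_on c {1..n}}"

definition quotient_topology :: "'a topology \<Rightarrow> ('a \<Rightarrow> 'b) \<Rightarrow> 'b topology" where
  "quotient_topology X f =
     topology (\<lambda>U. U \<subseteq> f ` topspace X \<and> openin X {x \<in> topspace X. f x \<in> U})"

lemma openin_quotient_topology:
  "openin (quotient_topology X f) U \<longleftrightarrow>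
     U \<subseteq> f ` topspace X \<and> openin X {x \<in> topspace X. f x \<in> U}"
proof -
  have "istopology (\<lambda>U. U \<subseteq> f ` topspace X \<and> openin X {x \<in> topspace X. f x \<in> U})"
    unfolding istopology_def
  proof (intro conjI allI impI, goal_cases)
    case (2 S T)
    then have "openin X ({x \<in> topspace X. f x \<in> S} \<inter> {x \<in> topspace X. f x \<in> T})"
      by blast
    moreover have "{x \<in> topspace X. f x \<in> S} \<inter> {x \<in> topspace X. f x \<in> T}
        = {x \<in> topspace X. f x \<in> S \<inter> T}"
      by blast
    ultimately show ?case by simp
  next
    case (4 \<K>)
    then have "openin X (\<Union>U\<in>\<K>. {x \<in> topspace X. f x \<in> U})"
      by blast
    moreover have "(\<Union>U\<in>\<K>. {x \<in> topspace X. f x \<in> U}) = {x \<in> topspace X. f x \<in> \<Union>\<K>}"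
      by blast
    ultimately show ?case by simp
  qed blast+
  then show ?thesis
    by (simp add: quotient_topology_def topology_inverse')
qed

text \<open>The unordered configuration space is the quotient of \<^term>\<open>pconf n X\<close> by the symmetric
  group: the orbit of a tuple of distinct points is represented by its set of entries.\<close>

definition uconf :: "nat \<Rightarrow> 'a topology \<Rightarrow> 'a set topology" where
  "uconf n X = quotient_topology (pconf n X) (\<lambda>c. c ` {1..n})"

text \<open>The configuration groupoid: the restriction of the \<open>n\<close>-th power of \<open>G\<close> to the tuples of
  objects lying in pairwise distinct orbits. For \<open>G\<close> presenting an orbifold it presents the
  suborbifold of the \<open>n\<close>-th power formed by the tuples of pairwise distinct points.\<close>

definition conf_objects :: "nat \<Rightarrow> ('o, 'a) top_groupoid \<Rightarrow> (nat \<Rightarrow> 'o) set" where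
  "conf_objects n G = {c. \<forall>i\<in>{1..n}. \<forall>j\<in>{1..n}. i \<noteq> j \<longrightarrow>
     \<not> (\<exists>g\<in>topspace (Arr G). Src G g = c i \<and> Tgt G g = c j)}"

definition conf_groupoid ::
    "nat \<Rightarrow> ('o, 'a) top_groupoid \<Rightarrow> (nat \<Rightarrow> 'o, nat \<Rightarrow> 'a) top_groupoid" where
  "conf_groupoid n G =
     \<lparr>Obj = subtopology (product_topology (\<lambda>_. Obj G) {1..n}) (conf_objects n G),
      Arr = subtopology (product_topology (\<lambda>_. Arr G) {1..n})
              {g. (\<lambda>i\<in>{1..n}. Src G (g i)) \<in> conf_objects n G},
      Src = (\<lambda>g. \<lambda>i\<in>{1..n}. Src G (g i)),
      Tgt = (\<lambda>g. \<lambda>i\<in>{1..n}. Tgt G (g i)),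
      Idt = (\<lambda>c. \<lambda>i\<in>{1..n}. Idt G (c i)),
      Cmp = (\<lambda>g h. \<lambda>i\<in>{1..n}. Cmp G (g i) (h i))\<rparr>"


section \<open>The punctured plane with cone points\<close>

text \<open>An orbifold atlas with punctures \<open>p 1, \<dots>, p k\<close> and cone points \<open>x 1, \<dots>, x m\<close>, \<open>x j\<close> of order
  \<open>q j\<close>. A point \<open>(j, w)\<close> is the point \<open>w\<close> of chart \<open>j\<close>. Chart \<open>0\<close> is the plane without
  all punctures and cone points; chart \<open>j \<ge> 1\<close> is the branched cover \<open>w \<mapsto> x j + w ^ q j\<close> of the
  plane without the punctures and the other cone points, with group the \<open>q j\<close>-th roots of unity.\<close>

definition cone_proj :: "(nat \<Rightarrow> complex) \<Rightarrow> (nat \<Rightarrow> nat) \<Rightarrow> nat \<times> complex \<Rightarrow> complex" where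
  "cone_proj x q = (\<lambda>(j, w). if j = 0 then w else x j + w ^ q j)"

definition cone_objects ::
    "nat \<Rightarrow> nat \<Rightarrow> (nat \<Rightarrow> nat) \<Rightarrow> (nat \<Rightarrow> complex) \<Rightarrow> (nat \<Rightarrow> complex) \<Rightarrow> (nat \<times> complex) set" where
  "cone_objects k m q p x =
     {(j, w). j \<le> m \<and> cone_proj x q (j, w) \<notin> p ` {1..k} \<union> x ` ({1..m} - {j})}"

text \<open>The arrows are the germs of changes of charts. An arrow \<open>((i, v), (j, w), \<zeta>)\<close> goes from
  \<open>(i, v)\<close> to \<open>(j, w)\<close>. For \<open>i = j\<close> it is the germ at \<open>v\<close> of the multiplication by \<open>\<zeta>\<close>, an
  element of the chart group. For \<open>i \<noteq> j\<close> the point lies over no cone point, the germ is determined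
  by its source and target, and \<open>\<zeta> = 1\<close> carries no information.\<close>

type_synonym cone_arrow = "(nat \<times> complex) \<times> (nat \<times> complex) \<times> complex"

definition cone_arrows ::
    "nat \<Rightarrow> nat \<Rightarrow> (nat \<Rightarrow> nat) \<Rightarrow> (nat \<Rightarrow> complex) \<Rightarrow> (nat \<Rightarrow> complex) \<Rightarrow> cone_arrow set" where
  "cone_arrows k m q p x =
     {((i, v), (j, w), \<zeta>).
        (i, v) \<in> cone_objects k m q p x \<and> (j, w) \<in> cone_objects k m q p x \<and>
        cone_proj x q (i, v) = cone_proj x q (j, w) \<and>
        (if i = j then w = \<zeta> * v \<and> \<zeta> ^ (if i = 0 then 1 else q i) = 1 else \<zeta> = 1)}"

text \<open>In the second case of the composition \<open>v\<close> is not zero, and the composite is the germ of the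
  element of the chart group taking \<open>v\<close> to \<open>w\<close>.\<close>

definition cone_comp :: "cone_arrow \<Rightarrow> cone_arrow \<Rightarrow> cone_arrow" where
  "cone_comp = (\<lambda>((i, v), (j, u), \<zeta>) (_, (l, w), \<xi>).
     ((i, v), (l, w), if i = j \<and> j = l then \<zeta> * \<xi> else if i = l \<and> i \<noteq> 0 then w / v else 1))"

definition cone_plane ::
    "nat \<Rightarrow> nat \<Rightarrow> (nat \<Rightarrow> nat) \<Rightarrow> (nat \<Rightarrow> complex) \<Rightarrow> (nat \<Rightarrow> complex) \<Rightarrow>
      (nat \<times> complex, cone_arrow) top_groupoid" where
  "cone_plane k m q p x =
     \<lparr>Obj = top_of_set (cone_objects k m q p x),
      Arr = top_of_set (cone_arrows k m q p x),
      Src = (\<lambda>(a, b, \<zeta>). a),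
      Tgt = (\<lambda>(a, b, \<zeta>). b),
      Idt = (\<lambda>a. (a, a, 1)),
      Cmp = cone_comp\<rparr>"


section \<open>Braids\<close>

text \<open>Throughout, \<open>a 1 < \<dots> < a N\<close> are the positions on the real line; with \<open>N = n + k + m\<close> the first
  \<open>n\<close> of them form the base point, the next \<open>k\<close> are the punctures, the last \<open>m\<close> the cone points.\<close>

definition base_conf :: "nat \<Rightarrow> (nat \<Rightarrow> real) \<Rightarrow> nat \<Rightarrow> complex" where
  "base_conf n a = (\<lambda>i\<in>{1..n}. complex_of_real (a i))"

abbreviation braid_group :: "nat \<Rightarrow> (nat \<Rightarrow> real) \<Rightarrow> (real \<Rightarrow> complex set) set monoid" where
  "braid_group N a \<equiv> fundamental_group (uconf N euclidean) (base_conf N a ` {1..N})"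

text \<open>The generator \<open>\<sigma>\<^sub>i\<close> exchanges the points \<open>i\<close> and \<open>i + 1\<close> by an anticlockwise half turn about
  their midpoint.\<close>

definition artin_path :: "nat \<Rightarrow> (nat \<Rightarrow> real) \<Rightarrow> nat \<Rightarrow> real \<Rightarrow> nat \<Rightarrow> complex" where
  "artin_path N a i t = (\<lambda>l\<in>{1..N}.
     if l = i \<or> l = i + 1
     then of_real ((a i + a (i + 1)) / 2)
            + exp (\<i> * of_real (pi * t)) * of_real (a l - (a i + a (i + 1)) / 2)
     else of_real (a l))"

definition artin :: "nat \<Rightarrow> (nat \<Rightarrow> real) \<Rightarrow> nat \<Rightarrow> (real \<Rightarrow> complex set) set" where
  "artin N a i =
     loop_rel (uconf N euclidean) (base_conf N a ` {1..N}) `` {\<lambda>t. artin_path N a i t ` {1..N}}"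

definition pure_word :: "nat \<Rightarrow> (nat \<Rightarrow> real) \<Rightarrow> nat \<Rightarrow> nat \<Rightarrow> (real \<Rightarrow> complex set) set" where
  "pure_word N a i j = (let G = braid_group N a; prod = (\<lambda>gs. foldr (\<otimes>\<^bsub>G\<^esub>) gs \<one>\<^bsub>G\<^esub>) in
     prod (map (artin N a) (rev [i+1..<j])) \<otimes>\<^bsub>G\<^esub> (artin N a i [^]\<^bsub>G\<^esub> (2::nat))
       \<otimes>\<^bsub>G\<^esub> prod (map (\<lambda>l. inv\<^bsub>G\<^esub> (artin N a l)) [i+1..<j]))"

definition punctured_conf :: "nat \<Rightarrow> nat \<Rightarrow> (nat \<Rightarrow> real) \<Rightarrow> (nat \<Rightarrow> complex) topology" where
  "punctured_conf n r a = pconf n (top_of_set (- (complex_of_real \<circ> a) ` {n+1..n+r}))"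

definition add_straight :: "nat \<Rightarrow> nat \<Rightarrow> (nat \<Rightarrow> real) \<Rightarrow> (nat \<Rightarrow> complex) \<Rightarrow> nat \<Rightarrow> complex" where
  "add_straight n r a y = (\<lambda>l\<in>{1..n+r}. if l \<le> n then y l else of_real (a l))"

text \<open>The elements of the fundamental group of \<^term>\<open>punctured_conf n r a\<close> which represent the word
  \<open>\<sigma>\<^sub>j\<^sub>-\<^sub>1 \<dots> \<sigma>\<^sub>i\<^sub>+\<^sub>1 \<sigma>\<^sub>i\<^sup>2 \<sigma>\<^sub>i\<^sub>+\<^sub>1\<^sup>-\<^sup>1 \<dots> \<sigma>\<^sub>j\<^sub>-\<^sub>1\<^sup>-\<^sup>1\<close>, that is, the inverse image of this word under the
  composite of the homomorphism into the pure braid group on \<open>n + r\<close> strings, which adds \<open>r\<close> straight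
  strings, and the homomorphism of the latter into the braid group. As both are
  injective, there is just one such element for \<open>i \<le> n\<close> and \<open>i < j \<le> n + r\<close>.\<close>

definition pure_braid ::
    "nat \<Rightarrow> nat \<Rightarrow> (nat \<Rightarrow> real) \<Rightarrow> nat \<Rightarrow> nat \<Rightarrow> (real \<Rightarrow> nat \<Rightarrow> complex) set set" where
  "pure_braid n r a i j =
     {\<beta> \<in> carrier (fundamental_group (punctured_conf n r a) (base_conf n a)).
        induced_hom (uconf (n + r) euclidean) (base_conf (n + r) a ` {1..n + r}) (\<lambda>c. c ` {1..n + r})
          (induced_hom (pconf (n + r) euclidean) (base_conf (n + r) a) (add_straight n r a) \<beta>)
        = pure_word (n + r) a i j}"


section \<open>The orbifold pure braid group\<close>

definition conf_orbifold :: "nat \<Rightarrow> nat \<Rightarrow> nat \<Rightarrow> (nat \<Rightarrow> nat) \<Rightarrow> (nat \<Rightarrow> real) \<Rightarrow>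
    (nat \<Rightarrow> nat \<times> complex, nat \<Rightarrow> cone_arrow) top_groupoid" where
  "conf_orbifold n k m q a = conf_groupoid n
     (cone_plane k m q (\<lambda>j. of_real (a (n + j))) (\<lambda>j. of_real (a (n + k + j))))"

text \<open>The inclusion of the complement of the cone points, as chart \<open>0\<close> in each coordinate.\<close>

definition regular_incl :: "nat \<Rightarrow> (nat \<Rightarrow> complex) \<Rightarrow> nat \<Rightarrow> nat \<times> complex" where
  "regular_incl n c = (\<lambda>i\<in>{1..n}. (0, c i))"

definition orb_pure_braid_group :: "nat \<Rightarrow> nat \<Rightarrow> nat \<Rightarrow> (nat \<Rightarrow> nat) \<Rightarrow> (nat \<Rightarrow> real) \<Rightarrow>
    (nat \<Rightarrow> nat \<times> complex, nat \<Rightarrow> cone_arrow) piece list set monoid" where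
  "orb_pure_braid_group n k m q a =
     orb_fundamental_group (conf_orbifold n k m q a) (regular_incl n (base_conf n a))"

definition orb_hom :: "nat \<Rightarrow> nat \<Rightarrow> nat \<Rightarrow> (nat \<Rightarrow> nat) \<Rightarrow> (nat \<Rightarrow> real) \<Rightarrow>
    (real \<Rightarrow> nat \<Rightarrow> complex) set \<Rightarrow> (nat \<Rightarrow> nat \<times> complex, nat \<Rightarrow> cone_arrow) piece list set" where
  "orb_hom n k m q a \<beta> =
     (\<Union>\<gamma>\<in>\<beta>. gloop_rel (conf_orbifold n k m q a) (regular_incl n (base_conf n a))
        `` {[Along (regular_incl n \<circ> \<gamma>)]})"

text \<open>The braids \<open>B\<^sub>i\<^sub>j\<close>, \<open>P\<^sub>i\<^sub>j\<close> and \<open>X\<^sub>i\<^sub>j\<close>, each as the set having it as its only element.\<close>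

definition B_braid :: "nat \<Rightarrow> nat \<Rightarrow> nat \<Rightarrow> (nat \<Rightarrow> nat) \<Rightarrow> (nat \<Rightarrow> real) \<Rightarrow> nat \<Rightarrow> nat \<Rightarrow>
    (nat \<Rightarrow> nat \<times> complex, nat \<Rightarrow> cone_arrow) piece list set set" where
  "B_braid n k m q a i j = orb_hom n k m q a ` pure_braid n (k + m) a i j"

definition P_braid :: "nat \<Rightarrow> nat \<Rightarrow> nat \<Rightarrow> (nat \<Rightarrow> nat) \<Rightarrow> (nat \<Rightarrow> real) \<Rightarrow> nat \<Rightarrow> nat \<Rightarrow>
    (nat \<Rightarrow> nat \<times> complex, nat \<Rightarrow> cone_arrow) piece list set set" where
  "P_braid n k m q a i j = orb_hom n k m q a ` pure_braid n (k + m) a i (n + j)"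

definition X_braid :: "nat \<Rightarrow> nat \<Rightarrow> nat \<Rightarrow> (nat \<Rightarrow> nat) \<Rightarrow> (nat \<Rightarrow> real) \<Rightarrow> nat \<Rightarrow> nat \<Rightarrow>
    (nat \<Rightarrow> nat \<times> complex, nat \<Rightarrow> cone_arrow) piece list set set" where
  "X_braid n k m q a i j = orb_hom n k m q a ` pure_braid n (k + m) a i (n + k + j)"

end

(* Rank the strings and let a configuration be "stacked" if, whenever two points have the same real
   part, the one of higher rank is above. The stacked configurations form an open set that is
   simply connected: move the points vertically to prescribed heights, then change the real parts
   linearly. So a configuration with distinct real parts has for each ranking a canonical path from
   the base point. Use the rankings "smaller indices are higher, except that j is just above l".
   Two consecutive ones, for l = i and l = i + 1, differ only in the order of i and j, and the canonical
   paths of both from the base point to a configuration in which i and j have changed sides form the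
   loop B_ij; that it equals the word in the Artin generators follows because the word also lifts to
   a path of the first kind followed by one of the second kind.

   A path on which at most two points at a time have the same real part runs through the stacked
   sets of these rankings, so relative to the canonical paths of one fixed ranking it is a product of
   these loops. In general, a path is locally replaced by one that moves one point at a time.

   Finally every loop of the orbifold comes from the complement of the cone points: locally a path is
   pushed off the centres of the charts, an arrow at a cone point slides to an arrow at a regular
   point, and over regular points all charts can be changed to chart 0. *)

theory Submission
  imports Defs
begin

section \<open>Path classes in abstract topologies\<close>

text \<open>Two rankings give the same canonical class between two configurations as soon as every
  pair on which they disagree is in the same left-right order at both ends. Hence the difference
  between a ranking with \<open>j\<close> displaced to just above \<open>l\<close> and the natural
  one can be worked off by lowering \<open>j\<close> one place at a time: each step disagrees on a
  single pair, whose contribution is trivial or a \<open>twist\<close>. Two fixed points are never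
  out of order and contribute nothing; this is why the first string of a generator is a moving one.

  The obstacle is that a path meets coincidences of real parts that cannot be controlled, and that
  its subdivision points need not have distinct real parts. The principle
  \<open>path_class_local_global\<close> takes care of this: a property of classes between points of
  a set \<open>R\<close> that is reachable locally everywhere need only be checked inside the
  members of an open cover. It is applied to stacked regions, to polydiscs and to chart boxes, with
  \<open>R\<close> the generic or the regular configurations.\<close>

lemma path_homotopic_imp_pathin:
  assumes "path_homotopic X c d"
  shows "pathin X c" "pathin X d"
  using homotopic_with_imp_continuous_maps[OF assms[unfolded path_homotopic_def]]
  by (auto simp: pathin_def)

lemma path_homotopic_ends:
  assumes "path_homotopic X c d"
  shows "d 0 = c 0" "d 1 = c 1"
  using homotopic_with_imp_property[OF assms[unfolded path_homotopic_def]] by auto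

lemma path_homotopic_refl [simp]: "path_homotopic X c c \<longleftrightarrow> pathin X c"
  by (simp add: path_homotopic_def pathin_def)

lemma path_homotopic_sym: "path_homotopic X c d \<Longrightarrow> path_homotopic X d c"
  using path_homotopic_ends[of X c d] homotopic_with_symD[of _ "top_of_set {0..1}" X c d]
  by (simp add: path_homotopic_def)

lemma path_homotopic_trans:
  assumes "path_homotopic X c d" "path_homotopic X d e"
  shows "path_homotopic X c e"
  using homotopic_with_trans[of _ "top_of_set {0..1}" X c d e] path_homotopic_ends[OF assms(1)] assms
  by (simp add: path_homotopic_def)

lemma path_homotopicI:
  assumes "continuous_map (prod_topology (top_of_set {0..1::real}) (top_of_set {0..1::real})) X h"
    and "\<And>t. t \<in> {0..1} \<Longrightarrow> h (0, t) = c t" "\<And>t. t \<in> {0..1} \<Longrightarrow> h (1, t) = d t"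
    and "\<And>s. s \<in> {0..1} \<Longrightarrow> h (s, 0) = c 0" "\<And>s. s \<in> {0..1} \<Longrightarrow> h (s, 1) = c 1"
  shows "path_homotopic X c d"
  unfolding path_homotopic_def
proof (subst homotopic_with)
  show "(h 0 = c 0 \<and> h 1 = c 1) = (k 0 = c 0 \<and> k 1 = c 1)"
    if "\<And>x. x \<in> topspace (top_of_set {0..1::real}) \<Longrightarrow> h x = k x" for h k
    using that[of 0] that[of 1] by simp
  show "\<exists>h. continuous_map (prod_topology (top_of_set {0..1::real}) (top_of_set {0..1})) X h \<and>
      (\<forall>x\<in>topspace (top_of_set {0..1}). h (0, x) = c x) \<and>
      (\<forall>x\<in>topspace (top_of_set {0..1}). h (1, x) = d x) \<and>
      (\<forall>t\<in>{0..1}. h (t, 0) = c 0 \<and> h (t, 1) = c 1)"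
    using assms by (intro exI[of _ h]) auto
qed

text \<open>Paths are functions on all of \<open>real\<close>, but a homotopy sees them only on the
  unit interval; constructions that agree there may differ outside.\<close>

lemma path_homotopic_eq:
  assumes "pathin X c" "\<And>t. t \<in> {0..1} \<Longrightarrow> c t = d t"
  shows "path_homotopic X c d"
  unfolding path_homotopic_def
  using assms by (intro homotopic_with_equal) (auto simp: pathin_def)

lemma path_homotopic_compose:
  assumes "path_homotopic X c d" "continuous_map X Y f"
  shows "path_homotopic Y (f \<circ> c) (f \<circ> d)"
  using assms unfolding path_homotopic_def
  by (elim homotopic_with_compose_continuous_map_left) auto

text \<open>The straight-line homotopy in \<open>S\<close>, pushed forward along \<open>f\<close>.
  With \<open>S\<close> the unit interval it gives reparametrisation, with \<open>S\<close> the unit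
  square the equality of its two boundary routes.\<close>

lemma path_homotopic_convex:
  fixes S :: "'b::real_normed_vector set"
  assumes "convex S" "continuous_map (top_of_set S) X f" "pathin (top_of_set S) g" "pathin (top_of_set S) h"
    and "g 0 = h 0" "g 1 = h 1"
  shows "path_homotopic X (f \<circ> g) (f \<circ> h)"
proof -
  have gh: "path g" "path h" "g \<in> {0..1} \<rightarrow> S" "h \<in> {0..1} \<rightarrow> S"
    using assms(3,4) by (auto simp: pathin_def path_def)
  have "homotopic_paths S g h"
  proof (rule homotopic_paths_linear)
    show "closed_segment (g t) (h t) \<subseteq> S" if "t \<in> {0..1}" for t
      using that gh assms(1) by (intro closed_segment_subset) auto
  qed (use gh assms in \<open>auto simp: pathstart_def pathfinish_def\<close>)
  then have "path_homotopic (top_of_set S) g h"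
    by (simp add: homotopic_paths_def path_homotopic_def pathstart_def pathfinish_def)
  then show ?thesis
    using assms(2) by (rule path_homotopic_compose)
qed

section \<open>Concatenation, reversal and reparametrisation\<close>

lemma path_join_ends [simp]: "path_join c d 0 = c 0" "path_join c d 1 = d 1"
  by (auto simp: path_join_def)

lemma comp_path_join: "f \<circ> path_join c d = path_join (f \<circ> c) (f \<circ> d)"
  by (auto simp: path_join_def fun_eq_iff)

lemma path_join_image:
  assumes "c ` {0..1} \<subseteq> S" "d ` {0..1} \<subseteq> S"
  shows "path_join c d ` {0..1} \<subseteq> S"
  using assms by (auto simp: path_join_def image_subset_iff)

lemma path_homotopic_join:
  assumes "path_homotopic X c c'" "path_homotopic X d d'" "c 1 = d 0"
  shows "path_homotopic X (path_join c d) (path_join c' d')"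
proof -
  let ?I = "top_of_set {0..1::real}"
  obtain h where h: "continuous_map (prod_topology ?I ?I) X h"
    "\<And>t. h (0, t) = c t" "\<And>t. h (1, t) = c' t" "\<And>s. s \<in> {0..1} \<Longrightarrow> h (s, 0) = c 0 \<and> h (s, 1) = c 1"
    using assms(1) unfolding path_homotopic_def homotopic_with_def by auto
  obtain k where k: "continuous_map (prod_topology ?I ?I) X k"
    "\<And>t. k (0, t) = d t" "\<And>t. k (1, t) = d' t" "\<And>s. s \<in> {0..1} \<Longrightarrow> k (s, 0) = d 0 \<and> k (s, 1) = d 1"
    using assms(2) unfolding path_homotopic_def homotopic_with_def by auto
  let ?H = "\<lambda>x::real \<times> real. if snd x \<le> 1/2 then (h \<circ> (\<lambda>x. (fst x, 2 * snd x))) x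
      else (k \<circ> (\<lambda>x. (fst x, 2 * snd x - 1))) x"
  have "continuous_map (prod_topology ?I ?I) X ?H"
  proof (rule continuous_map_cases_le)
    show "continuous_map (prod_topology ?I ?I) euclideanreal snd"
      by (simp add: continuous_on_snd)
    show "continuous_map (subtopology (prod_topology ?I ?I)
        {x \<in> topspace (prod_topology ?I ?I). snd x \<le> 1/2}) X (h \<circ> (\<lambda>x. (fst x, 2 * snd x)))"
      by (rule continuous_map_compose[OF _ h(1)])
        (auto simp: Times_Int_Times subtopology_subtopology intro!: continuous_intros)
    show "continuous_map (subtopology (prod_topology ?I ?I)
        {x \<in> topspace (prod_topology ?I ?I). 1/2 \<le> snd x}) X (k \<circ> (\<lambda>x. (fst x, 2 * snd x - 1)))"
      by (rule continuous_map_compose[OF _ k(1)])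
        (auto simp: Times_Int_Times subtopology_subtopology intro!: continuous_intros)
    show "(h \<circ> (\<lambda>x. (fst x, 2 * snd x))) x = (k \<circ> (\<lambda>x. (fst x, 2 * snd x - 1))) x"
      if "x \<in> topspace (prod_topology ?I ?I)" "snd x = 1/2" for x
    proof -
      have "x = (fst x, 1/2)" using that(2) by (metis prod.collapse)
      then show ?thesis
        using that(1) h(4)[of "fst x"] k(4)[of "fst x"] assms(3)
        by (metis (no_types, lifting) comp_apply fst_conv snd_conv SigmaD1 topspace_prod_topology
          topspace_euclidean_subtopology mult.commute nonzero_eq_divide_eq zero_neq_numeral diff_self)
    qed
  qed auto
  then show ?thesis
    by (rule path_homotopicI) (use h k in \<open>auto simp: path_join_def\<close>)
qed

lemma pathin_path_join:
  assumes "pathin X c" "pathin X d" "c 1 = d 0"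
  shows "pathin X (path_join c d)"
  using path_homotopic_join[of X c c d d] assms by simp

definition path_rev :: "(real \<Rightarrow> 'a) \<Rightarrow> real \<Rightarrow> 'a" where
  "path_rev c = (\<lambda>t. c (1 - t))"

lemma path_rev_ends [simp]: "path_rev c 0 = c 1" "path_rev c 1 = c 0"
  by (auto simp: path_rev_def)

lemma comp_path_rev: "f \<circ> path_rev c = path_rev (f \<circ> c)"
  by (auto simp: path_rev_def)

lemma path_rev_image [simp]: "path_rev c ` {0..1} = c ` {0..1}"
proof -
  have "(\<lambda>t::real. 1 - t) ` {0..1} = {0..1}"
    by (auto simp: image_iff intro!: bexI[of _ "1 - _"])
  then show ?thesis
    by (metis (no_types, lifting) ext image_image path_rev_def)
qed

text \<open>The unit, inverse and associativity laws below all have this shape: one fixed path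
  composed with two self-maps of the interval that agree at the ends.\<close>

lemma path_homotopic_reparam:
  assumes "pathin X c" "continuous_on {0..1} f" "continuous_on {0..1} g"
    "f ` {0..1} \<subseteq> {0..1}" "g ` {0..1} \<subseteq> {0..1}" "f 0 = g 0" "f 1 = g 1"
  shows "path_homotopic X (c \<circ> f) (c \<circ> g)"
  by (rule path_homotopic_convex[where S="{0..1::real}"]) (use assms in \<open>auto simp: pathin_def\<close>)

lemma pathin_rev:
  assumes "pathin X c"
  shows "pathin X (path_rev c)"
proof -
  have "path_homotopic X (c \<circ> (\<lambda>t. 1 - t)) (c \<circ> (\<lambda>t. 1 - t))"
    by (rule path_homotopic_reparam[OF assms]) (auto intro!: continuous_intros)
  then show ?thesis by (simp add: path_rev_def o_def)
qed

lemma path_homotopic_rev: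
  assumes "path_homotopic X c d"
  shows "path_homotopic X (path_rev c) (path_rev d)"
proof -
  let ?I = "top_of_set {0..1::real}"
  obtain h where h: "continuous_map (prod_topology ?I ?I) X h"
    "\<And>t. h (0, t) = c t" "\<And>t. h (1, t) = d t" "\<And>s. s \<in> {0..1} \<Longrightarrow> h (s, 0) = c 0 \<and> h (s, 1) = c 1"
    using assms(1) unfolding path_homotopic_def homotopic_with_def by auto
  have "continuous_map (prod_topology ?I ?I) X (h \<circ> (\<lambda>x. (fst x, 1 - snd x)))"
    by (rule continuous_map_compose[OF _ h(1)]) (auto intro!: continuous_intros)
  then show ?thesis
    by (rule path_homotopicI) (use h in \<open>auto simp: path_rev_def\<close>)
qed

lemma continuous_on_halves:
  fixes f g :: "real \<Rightarrow> 'b::topological_space"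
  assumes "continuous_on {0..1/2} f" "continuous_on {1/2..1} g" "f (1/2) = g (1/2)"
  shows "continuous_on {0..1} (\<lambda>t. if t \<le> 1/2 then f t else g t)"
proof -
  have "continuous_on ({0..1/2} \<union> {1/2..1::real}) (\<lambda>t. if t \<le> 1/2 then f t else g t)"
  proof (rule continuous_on_cases)
    show "\<forall>t. t \<in> {0..1/2} \<and> \<not> t \<le> 1/2 \<or> t \<in> {1/2..1} \<and> t \<le> 1/2 \<longrightarrow> f t = g t"
    proof (intro allI impI)
      fix t :: real assume "t \<in> {0..1/2} \<and> \<not> t \<le> 1/2 \<or> t \<in> {1/2..1} \<and> t \<le> 1/2"
      then have "t = 1/2" by auto
      with assms(3) show "f t = g t" by (simp only:)
    qed
  qed (use assms in auto)
  moreover have "{0..1/2} \<union> {1/2..1::real} = {0..1}" by auto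
  ultimately show ?thesis by simp
qed

lemma path_join_const_right:
  assumes "pathin X c"
  shows "path_homotopic X (path_join c (\<lambda>_. c 1)) c"
proof -
  have "path_homotopic X (c \<circ> (\<lambda>t. if t \<le> 1/2 then 2 * t else 1)) (c \<circ> (\<lambda>t. t))"
    by (rule path_homotopic_reparam[OF assms], intro continuous_on_halves continuous_intros)
      (auto intro!: continuous_intros)
  moreover have "c \<circ> (\<lambda>t. if t \<le> 1/2 then 2 * t else 1) = path_join c (\<lambda>_. c 1)"
    by (auto simp: path_join_def)
  ultimately show ?thesis by (simp add: o_def)
qed

lemma path_join_const_left:
  assumes "pathin X c"
  shows "path_homotopic X (path_join (\<lambda>_. c 0) c) c"
proof -
  have "path_homotopic X (c \<circ> (\<lambda>t. if t \<le> 1/2 then 0 else 2 * t - 1)) (c \<circ> (\<lambda>t. t))"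
    by (rule path_homotopic_reparam[OF assms], intro continuous_on_halves continuous_intros)
      (auto intro!: continuous_intros)
  moreover have "c \<circ> (\<lambda>t. if t \<le> 1/2 then 0 else 2 * t - 1) = path_join (\<lambda>_. c 0) c"
    by (auto simp: path_join_def)
  ultimately show ?thesis by (simp add: o_def)
qed

lemma path_join_rev_right:
  assumes "pathin X c"
  shows "path_homotopic X (path_join c (path_rev c)) (\<lambda>_. c 0)"
proof -
  have "path_homotopic X (c \<circ> (\<lambda>t. if t \<le> 1/2 then 2 * t else 1 - (2 * t - 1))) (c \<circ> (\<lambda>t. 0))"
    by (rule path_homotopic_reparam[OF assms], intro continuous_on_halves continuous_intros)
      (auto intro!: continuous_intros)
  moreover have "c \<circ> (\<lambda>t. if t \<le> 1/2 then 2 * t else 1 - (2 * t - 1)) = path_join c (path_rev c)"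
    by (auto simp: path_join_def path_rev_def)
  ultimately show ?thesis by (simp add: o_def)
qed

lemma path_join_assoc:
  assumes "pathin X c" "pathin X d" "pathin X e" "c 1 = d 0" "d 1 = e 0"
  shows "path_homotopic X (path_join (path_join c d) e) (path_join c (path_join d e))"
proof -
  let ?p = "path_join c (path_join d e)"
  \<comment> \<open>\<open>?f\<close> sends the breakpoints 1/4 and 1/2 of the left bracketing to
    the breakpoints 1/2 and 3/4 of the right one.\<close>
  let ?f = "\<lambda>t::real. if t \<le> 1/2 then (if t \<le> 1/4 then 2 * t else t + 1/4) else t/2 + 1/2"
  have p: "pathin X ?p"
    using assms by (intro pathin_path_join) auto
  have *: "continuous_on {0..1} ?f"
  proof (rule continuous_on_halves)
    have "continuous_on ({0..1/4} \<union> {1/4..1/2::real}) (\<lambda>t. if t \<le> 1/4 then 2 * t else t + 1/4)"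
      by (rule continuous_on_cases) (auto intro!: continuous_intros)
    moreover have "{0..1/4} \<union> {1/4..1/2::real} = {0..1/2}" by auto
    ultimately show "continuous_on {0..1/2::real} (\<lambda>t. if t \<le> 1/4 then 2 * t else t + 1/4)" by simp
  qed (auto intro!: continuous_intros)
  have "path_homotopic X (?p \<circ> ?f) (?p \<circ> (\<lambda>t. t))"
    by (rule path_homotopic_reparam[OF p *]) auto
  moreover have "?p \<circ> ?f = path_join (path_join c d) e"
  proof
    fix t :: real
    have "2 * (t + 1/4) - 1 = 2 * t - 1/2" "2 * (2 * t - 1/2) = 2 * (2 * t) - 1"
      "2 * (t / 2 + 1 / 2) - 1 = t" "2 * (2 * (t / 2 + 1/2) - 1) - 1 = 2 * t - 1"
      by (simp_all add: field_simps)
    then show "(?p \<circ> ?f) t = path_join (path_join c d) e t"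
      by (auto simp: path_join_def assms)
  qed
  ultimately show ?thesis by (simp add: o_def)
qed

section \<open>The fundamental groupoid\<close>

definition path_class :: "'a topology \<Rightarrow> (real \<Rightarrow> 'a) \<Rightarrow> (real \<Rightarrow> 'a) set" where
  "path_class X c = {d. path_homotopic X c d}"

text \<open>Canonical paths join the base point to arbitrary configurations, so all hom sets of the
  fundamental groupoid are needed, not only its vertex groups.\<close>

definition path_classes :: "'a topology \<Rightarrow> 'a \<Rightarrow> 'a \<Rightarrow> (real \<Rightarrow> 'a) set set" where
  "path_classes X x y = {path_class X c | c. pathin X c \<and> c 0 = x \<and> c 1 = y}"

text \<open>The composition is defined for all sets of paths, so that it is associative without
  conditions on end points; non-composable classes have the empty set as composite.\<close>

definition class_comp :: "'a topology \<Rightarrow> (real \<Rightarrow> 'a) set \<Rightarrow> (real \<Rightarrow> 'a) set \<Rightarrow> (real \<Rightarrow> 'a) set" where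
  "class_comp X A B = {e. \<exists>c\<in>A. \<exists>d\<in>B. pathin X c \<and> pathin X d \<and> c 1 = d 0 \<and> path_homotopic X (path_join c d) e}"

definition class_inv :: "'a topology \<Rightarrow> (real \<Rightarrow> 'a) set \<Rightarrow> (real \<Rightarrow> 'a) set" where
  "class_inv X A = {d. \<exists>c\<in>A. path_homotopic X (path_rev c) d}"

lemma class_compI:
  assumes "c \<in> A" "d \<in> B" "pathin X c" "pathin X d" "c 1 = d 0" "path_homotopic X (path_join c d) e"
  shows "e \<in> class_comp X A B"
  using assms unfolding class_comp_def by blast

lemma class_comp_assoc: "class_comp X (class_comp X A B) C = class_comp X A (class_comp X B C)"
proof (intro subset_antisym subsetI)
  fix f assume "f \<in> class_comp X (class_comp X A B) C"
  then obtain c d u e where *: "c \<in> A" "d \<in> B" "e \<in> C" "pathin X c" "pathin X d" "pathin X u" "pathin X e"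
    "c 1 = d 0" "path_homotopic X (path_join c d) u" "u 1 = e 0" "path_homotopic X (path_join u e) f"
    unfolding class_comp_def by blast
  have de: "d 1 = e 0" using path_homotopic_ends[OF *(9)] * by simp
  have "path_homotopic X (path_join (path_join c d) e) (path_join u e)"
    using * de by (intro path_homotopic_join) auto
  then have "path_homotopic X (path_join c (path_join d e)) f"
    using * de path_homotopic_trans path_homotopic_sym path_join_assoc by metis
  then show "f \<in> class_comp X A (class_comp X B C)"
    using * de by (auto intro!: class_compI[of c A "path_join d e"] class_compI[of d B e] pathin_path_join)
next
  fix f assume "f \<in> class_comp X A (class_comp X B C)"
  then obtain c d u e where *: "c \<in> A" "d \<in> B" "e \<in> C" "pathin X c" "pathin X d" "pathin X u" "pathin X e"
    "d 1 = e 0" "path_homotopic X (path_join d e) u" "c 1 = u 0" "path_homotopic X (path_join c u) f"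
    unfolding class_comp_def by blast
  have cd: "c 1 = d 0" using path_homotopic_ends[OF *(9)] * by simp
  have "path_homotopic X (path_join c (path_join d e)) (path_join c u)"
    using * cd by (intro path_homotopic_join) auto
  then have "path_homotopic X (path_join (path_join c d) e) f"
    using * cd path_homotopic_trans path_join_assoc by metis
  then show "f \<in> class_comp X (class_comp X A B) C"
    using * cd by (auto intro!: class_compI[of "path_join c d" _ e] class_compI[of c A d] pathin_path_join)
qed

lemma path_class_self: "pathin X c \<Longrightarrow> c \<in> path_class X c"
  by (simp add: path_class_def)

lemma path_class_eq:
  assumes "path_homotopic X c d"
  shows "path_class X c = path_class X d"
  unfolding path_class_def using assms path_homotopic_trans path_homotopic_sym by blast

lemma path_class_eq_iff:
  assumes "pathin X d"
  shows "path_class X c = path_class X d \<longleftrightarrow> path_homotopic X c d"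
  using assms path_class_eq path_class_self[OF assms] by (auto simp: path_class_def)

lemma path_class_cong:
  assumes "pathin X c" "\<And>t. t \<in> {0..1} \<Longrightarrow> c t = d t"
  shows "path_class X c = path_class X d"
  by (intro path_class_eq path_homotopic_eq assms)

lemma class_comp_class:
  assumes "pathin X c" "pathin X d" "c 1 = d 0"
  shows "class_comp X (path_class X c) (path_class X d) = path_class X (path_join c d)"
proof (intro subset_antisym subsetI)
  fix e assume "e \<in> class_comp X (path_class X c) (path_class X d)"
  then obtain c' d' where "path_homotopic X c c'" "path_homotopic X d d'" "path_homotopic X (path_join c' d') e"
    by (auto simp: class_comp_def path_class_def)
  then show "e \<in> path_class X (path_join c d)"
    using path_homotopic_join path_homotopic_trans assms by (fastforce simp: path_class_def)
next
  fix e assume "e \<in> path_class X (path_join c d)"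
  then show "e \<in> class_comp X (path_class X c) (path_class X d)"
    using assms by (auto simp: path_class_def intro!: class_compI[of c _ d])
qed

lemma class_inv_class:
  assumes "pathin X c"
  shows "class_inv X (path_class X c) = path_class X (path_rev c)"
proof (intro subset_antisym subsetI)
  fix e assume "e \<in> class_inv X (path_class X c)"
  then obtain c' where "path_homotopic X c c'" "path_homotopic X (path_rev c') e"
    by (auto simp: class_inv_def path_class_def)
  then show "e \<in> path_class X (path_rev c)"
    using path_homotopic_rev path_homotopic_trans by (fastforce simp: path_class_def)
next
  fix e assume "e \<in> path_class X (path_rev c)"
  then show "e \<in> class_inv X (path_class X c)"
    using assms by (auto simp: class_inv_def path_class_def intro!: exI[of _ c])
qed

definition class_one :: "'a topology \<Rightarrow> 'a \<Rightarrow> (real \<Rightarrow> 'a) set" where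
  "class_one X x = path_class X (\<lambda>_. x)"

lemma path_classesI [intro]:
  assumes "pathin X c" "c 0 = x" "c 1 = y"
  shows "path_class X c \<in> path_classes X x y"
  using assms by (auto simp: path_classes_def)

lemma path_classesE:
  assumes "A \<in> path_classes X x y"
  obtains c where "pathin X c" "c 0 = x" "c 1 = y" "A = path_class X c"
  using assms by (auto simp: path_classes_def)

lemma pathin_topspace: "pathin X c \<Longrightarrow> t \<in> {0..1} \<Longrightarrow> c t \<in> topspace X"
  by (auto simp: pathin_def continuous_map_def)

lemma path_classes_topspace:
  assumes "A \<in> path_classes X x y"
  shows "x \<in> topspace X" "y \<in> topspace X"
  using assms by (auto elim!: path_classesE intro!: pathin_topspace)

lemma path_classes_ends:
  assumes "A \<in> path_classes X x y" "A \<in> path_classes X x' y'"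
  shows "x = x'" "y = y'"
proof -
  obtain c d where "pathin X c" "c 0 = x" "c 1 = y" "A = path_class X c"
    "pathin X d" "d 0 = x'" "d 1 = y'" "A = path_class X d"
    using assms by (metis path_classesE)
  then show "x = x'" "y = y'"
    using path_class_eq_iff[of X d c] path_homotopic_ends[of X c d] by auto
qed

lemma class_one_closed [intro]: "x \<in> topspace X \<Longrightarrow> class_one X x \<in> path_classes X x x"
  unfolding class_one_def by (intro path_classesI) (auto simp: pathin_const)

lemma class_comp_closed [intro]:
  assumes "A \<in> path_classes X x y" "B \<in> path_classes X y z"
  shows "class_comp X A B \<in> path_classes X x z"
  using assms by (elim path_classesE) (auto simp: class_comp_class pathin_path_join)

lemma class_inv_closed [intro]:
  assumes "A \<in> path_classes X x y"
  shows "class_inv X A \<in> path_classes X y x"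
  using assms by (elim path_classesE) (auto simp: class_inv_class pathin_rev)

lemma class_comp_one [simp]:
  assumes "A \<in> path_classes X x y"
  shows "class_comp X A (class_one X y) = A" "class_comp X (class_one X x) A = A"
proof -
  from assms obtain c where c: "pathin X c" "c 0 = x" "c 1 = y" "A = path_class X c"
    by (rule path_classesE)
  have "x \<in> topspace X" "y \<in> topspace X" using assms by (auto dest: path_classes_topspace)
  then have "pathin X (\<lambda>_. x)" "pathin X (\<lambda>_. y)" by (auto simp: pathin_const)
  then show "class_comp X A (class_one X y) = A" "class_comp X (class_one X x) A = A"
    using c path_join_const_right[OF c(1)] path_join_const_left[OF c(1)]
    by (auto simp: class_one_def class_comp_class path_class_eq)
qed

lemma class_comp_inv [simp]:
  assumes "A \<in> path_classes X x y"
  shows "class_comp X A (class_inv X A) = class_one X x" "class_comp X (class_inv X A) A = class_one X y"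
proof -
  from assms obtain c where c: "pathin X c" "c 0 = x" "c 1 = y" "A = path_class X c"
    by (rule path_classesE)
  have "path_rev (path_rev c) = c" by (simp add: path_rev_def)
  then show "class_comp X A (class_inv X A) = class_one X x" "class_comp X (class_inv X A) A = class_one X y"
    using c path_join_rev_right[OF c(1)] path_join_rev_right[OF pathin_rev[OF c(1)]]
    by (auto simp: class_one_def class_comp_class class_inv_class pathin_rev path_class_eq)
qed

text \<open>Both sides are images of the two boundary routes of the unit square from (0, 0) to (1,
  1), which are homotopic because the square is convex.\<close>

lemma class_comp_square:
  assumes "continuous_map (top_of_set ({0..1} \<times> {0..1})) X (f :: real \<times> real \<Rightarrow> 'a)"
  shows "class_comp X (path_class X (\<lambda>t. f (0, t))) (path_class X (\<lambda>s. f (s, 1)))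
    = class_comp X (path_class X (\<lambda>s. f (s, 0))) (path_class X (\<lambda>t. f (1, t)))"
proof -
  let ?Q = "{0..1::real} \<times> {0..1::real}"
  have path: "pathin (top_of_set ?Q) g" if "continuous_on {0..1} g" "\<And>t. t \<in> {0..1} \<Longrightarrow> g t \<in> ?Q" for g
    using that by (auto simp: pathin_def)
  have 4: "pathin (top_of_set ?Q) (\<lambda>t. (0, t))" "pathin (top_of_set ?Q) (\<lambda>s. (s, 1))"
    "pathin (top_of_set ?Q) (\<lambda>s. (s, 0))" "pathin (top_of_set ?Q) (\<lambda>t. (1, t))"
    by (rule path; auto intro!: continuous_intros)+
  have p4: "pathin X (\<lambda>t. f (0, t))" "pathin X (\<lambda>s. f (s, 1))"
    "pathin X (\<lambda>s. f (s, 0))" "pathin X (\<lambda>t. f (1, t))"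
    using 4[THEN pathin_compose[OF _ assms]] by (auto simp: o_def)
  have "path_homotopic X (f \<circ> path_join (\<lambda>t. (0, t)) (\<lambda>s. (s, 1))) (f \<circ> path_join (\<lambda>s. (s, 0)) (\<lambda>t. (1, t)))"
    by (rule path_homotopic_convex[OF _ assms]) (auto intro!: pathin_path_join 4 convex_Times)
  then have "path_homotopic X (path_join (\<lambda>t. f (0, t)) (\<lambda>s. f (s, 1))) (path_join (\<lambda>s. f (s, 0)) (\<lambda>t. f (1, t)))"
    unfolding comp_path_join by (simp add: o_def)
  then show ?thesis
    using p4 by (simp add: class_comp_class path_class_eq)
qed

section \<open>The fundamental group\<close>

lemma loops_path_homotopic: "c \<in> loops X b \<Longrightarrow> path_homotopic X c d \<Longrightarrow> d \<in> loops X b"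
  using path_homotopic_ends[of X c d] path_homotopic_imp_pathin(2)[of X c d] by (simp add: loops_def)

text \<open>The link between the quotient in the definition of the group and
  \<open>path_class\<close>: whatever is homotopic to a loop is a loop at the same point, so
  restricting the relation to loops loses nothing.\<close>

lemma loop_rel_class:
  assumes "c \<in> loops X b"
  shows "loop_rel X b `` {c} = path_class X c"
  using assms loops_path_homotopic[OF assms] by (auto simp: loop_rel_def path_class_def)

lemma carrier_fundamental_group: "carrier (fundamental_group X b) = path_classes X b b"
proof -
  have "loops X b // loop_rel X b = path_class X ` loops X b"
    by (auto simp: quotient_def loop_rel_class)
  then show ?thesis
    by (auto simp: fundamental_group_def path_classes_def loops_def)
qed

lemma one_fundamental_group:
  assumes "b \<in> topspace X"
  shows "\<one>\<^bsub>fundamental_group X b\<^esub> = class_one X b"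
  using assms by (simp add: fundamental_group_def class_one_def loop_rel_class loops_def pathin_const)

lemma mult_fundamental_group:
  assumes "A \<in> path_classes X b b" "B \<in> path_classes X b b"
  shows "A \<otimes>\<^bsub>fundamental_group X b\<^esub> B = class_comp X A B"
proof -
  have loop: "c \<in> loops X b" if "c \<in> A" "A \<in> path_classes X b b" for A c
  proof -
    obtain e where "e \<in> loops X b" "A = path_class X e"
      using \<open>A \<in> path_classes X b b\<close> by (auto simp: path_classes_def loops_def)
    then show ?thesis using \<open>c \<in> A\<close> loops_path_homotopic by (auto simp: path_class_def)
  qed
  have "path_join c d \<in> loops X b" if "c \<in> A" "d \<in> B" for c d
    using loop[OF that(1)] loop[OF that(2)] assms by (auto simp: loops_def pathin_path_join)
  then have "A \<otimes>\<^bsub>fundamental_group X b\<^esub> B = (\<Union>c\<in>A. \<Union>d\<in>B. path_class X (path_join c d))"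
    by (simp add: fundamental_group_def loop_rel_class)
  also have "\<dots> = class_comp X A B"
  proof (intro subset_antisym subsetI)
    fix e assume "e \<in> (\<Union>c\<in>A. \<Union>d\<in>B. path_class X (path_join c d))"
    then obtain c d where "c \<in> A" "d \<in> B" "path_homotopic X (path_join c d) e"
      by (auto simp: path_class_def)
    then show "e \<in> class_comp X A B"
      using loop[OF \<open>c \<in> A\<close> assms(1)] loop[OF \<open>d \<in> B\<close> assms(2)]
      by (intro class_compI[of c A d B]) (auto simp: loops_def)
  qed (auto simp: class_comp_def path_class_def)
  finally show ?thesis .
qed

lemma group_fundamental_group:
  assumes "b \<in> topspace X"
  shows "group (fundamental_group X b)"
  using assms
  by (intro groupI)
    (simp_all add: carrier_fundamental_group mult_fundamental_group one_fundamental_group class_comp_closed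
      class_comp_assoc class_one_closed, metis class_inv_closed class_comp_inv(2) mult_fundamental_group)

lemma inv_fundamental_group:
  assumes "b \<in> topspace X" "A \<in> path_classes X b b"
  shows "inv\<^bsub>fundamental_group X b\<^esub> A = class_inv X A"
  by (rule group.inv_equality[OF group_fundamental_group[OF assms(1)]])
    (use assms in \<open>simp_all add: carrier_fundamental_group mult_fundamental_group one_fundamental_group class_inv_closed\<close>)

lemma induced_hom_class:
  assumes "continuous_map X Y f" "pathin X c" "f (c 0) = y" "f (c 1) = y"
  shows "induced_hom Y y f (path_class X c) = path_class Y (f \<circ> c)"
proof -
  have *: "loop_rel Y y `` {f \<circ> d} = path_class Y (f \<circ> c)" if d: "path_homotopic X c d" for d
  proof -
    have "path_homotopic Y (f \<circ> c) (f \<circ> d)"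
      using d assms(1) by (rule path_homotopic_compose)
    moreover from this have "f \<circ> d \<in> loops Y y"
      using path_homotopic_ends[OF d] path_homotopic_imp_pathin assms by (fastforce simp: loops_def)
    ultimately show ?thesis
      using path_class_eq by (metis loop_rel_class)
  qed
  show ?thesis
    unfolding induced_hom_def using * path_class_self[OF assms(2)] unfolding path_class_def by blast
qed

section \<open>Local to global for paths\<close>

text \<open>The path is continuous into \<open>X\<close> and only its image is confined to
  \<open>S\<close>, so that its class is a class of \<open>X\<close>.\<close>

definition joinable :: "'a topology \<Rightarrow> 'a set \<Rightarrow> 'a \<Rightarrow> 'a \<Rightarrow> bool" where
  "joinable X S x y \<longleftrightarrow> (\<exists>c. pathin X c \<and> c ` {0..1} \<subseteq> S \<and> c 0 = x \<and> c 1 = y)"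

lemma joinable_trans: "joinable X S x y \<Longrightarrow> joinable X S y z \<Longrightarrow> joinable X S x z"
  unfolding joinable_def
  by (metis path_join_ends(1) path_join_ends(2) path_join_image pathin_path_join)

lemma joinable_sym: "joinable X S x y \<Longrightarrow> joinable X S y x"
  unfolding joinable_def by (metis path_rev_ends path_rev_image pathin_rev)

lemma joinable_mem:
  assumes "joinable X S x y"
  shows "x \<in> S" "y \<in> S"
proof -
  obtain c where "c ` {0..1::real} \<subseteq> S" "c 0 = x" "c 1 = y"
    using assms unfolding joinable_def by blast
  then show "x \<in> S" "y \<in> S" by auto
qed

definition subpath_of :: "(real \<Rightarrow> 'a) \<Rightarrow> real \<Rightarrow> real \<Rightarrow> real \<Rightarrow> 'a" where
  "subpath_of c s t = (\<lambda>u. c (s + u * (t - s)))"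

lemma subpath_of_ends [simp]: "subpath_of c s t 0 = c s" "subpath_of c s t 1 = c t"
  by (auto simp: subpath_of_def)

lemma affine_in_unit:
  fixes s t u :: real
  assumes "0 \<le> s" "s \<le> t" "t \<le> 1" "0 \<le> u" "u \<le> 1"
  shows "s \<le> s + u * (t - s)" "s + u * (t - s) \<le> t"
  using assms mult_left_le_one_le[of "t - s" u] by auto

lemma pathin_subpath_of:
  assumes "pathin X c" "0 \<le> s" "s \<le> t" "t \<le> 1"
  shows "pathin X (subpath_of c s t)"
proof -
  let ?f = "\<lambda>u. s + u * (t - s)"
  have "?f ` {0..1} \<subseteq> {0..1}"
    using affine_in_unit[OF assms(2-4)] assms by force
  then have "path_homotopic X (c \<circ> ?f) (c \<circ> ?f)"
    by (intro path_homotopic_reparam[OF assms(1)]) (auto intro!: continuous_intros)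
  then show ?thesis by (simp add: subpath_of_def o_def)
qed

lemma class_subpath_of:
  assumes "pathin X c" "0 \<le> s" "s \<le> t" "t \<le> v" "v \<le> 1"
  shows "path_class X (subpath_of c s v) =
    class_comp X (path_class X (subpath_of c s t)) (path_class X (subpath_of c t v))"
proof -
  \<comment> \<open>Both reparametrisations run from \<open>s\<close> to \<open>v\<close>:
    \<open>?f\<close> reaches \<open>t\<close> at half time, \<open>?g\<close> has constant
    speed.\<close>
  let ?f = "\<lambda>u. if u \<le> 1/2 then s + 2 * u * (t - s) else t + (2 * u - 1) * (v - t)"
  let ?g = "\<lambda>u. s + u * (v - s)"
  have f: "continuous_on {0..1} ?f"
    by (intro continuous_on_halves continuous_intros) auto
  have "?f u \<in> {0..1}" if "u \<in> {0..1}" for u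
    using that affine_in_unit[of s t "2 * u"] affine_in_unit[of t v "2 * u - 1"] assms by auto
  then have f': "?f ` {0..1} \<subseteq> {0..1}" by blast
  have "?g u \<in> {0..1}" if "u \<in> {0..1}" for u
    using that affine_in_unit[of s v u] assms by auto
  then have g': "?g ` {0..1} \<subseteq> {0..1}" by blast
  have "path_homotopic X (c \<circ> ?f) (c \<circ> ?g)"
    by (rule path_homotopic_reparam[OF assms(1) f _ f' g']) (simp_all add: continuous_intros)
  moreover have "c \<circ> ?f = path_join (subpath_of c s t) (subpath_of c t v)"
    by (auto simp: path_join_def subpath_of_def)
  ultimately have "path_class X (path_join (subpath_of c s t) (subpath_of c t v)) = path_class X (subpath_of c s v)"
    by (simp add: path_class_eq subpath_of_def o_def)
  then show ?thesis
    using assms by (simp add: class_comp_class pathin_subpath_of)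
qed

text \<open>The relation \<open>Q s t\<close> of the proof states \<open>P\<close> for the piece of \<open>c\<close> over \<open>[s, t]\<close>, prolonged at both
  ends by short paths to points of \<open>R\<close>. This makes it additive in the interval although \<open>c s\<close> and \<open>c t\<close>
  need not lie in \<open>R\<close>.\<close>

lemma path_class_local_global:
  assumes comp: "\<And>A B x y z. \<lbrakk>P A; P B; A \<in> path_classes X x y; B \<in> path_classes X y z;
      x \<in> R; y \<in> R; z \<in> R\<rbrakk> \<Longrightarrow> P (class_comp X A B)"
    and op: "\<And>D. D \<in> \<D> \<Longrightarrow> openin X D"
    and loc: "\<And>D c. \<lbrakk>D \<in> \<D>; pathin X c; c ` {0..1} \<subseteq> D; c 0 \<in> R; c 1 \<in> R\<rbrakk> \<Longrightarrow> P (path_class X c)"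
    and dense: "\<And>D E x. \<lbrakk>D \<in> \<D>; E \<in> \<D>; x \<in> D; x \<in> E\<rbrakk> \<Longrightarrow> \<exists>u\<in>R. joinable X (D \<inter> E) x u"
    and c: "pathin X c" "c ` {0..1} \<subseteq> \<Union>\<D>" "c 0 \<in> R" "c 1 \<in> R"
  shows "P (path_class X c)"
proof -
  let ?cl = "path_class X"
  define Q where "Q s t \<longleftrightarrow> (\<forall>D\<in>\<D>. \<forall>E\<in>\<D>. \<forall>p q. pathin X p \<and> p ` {0..1} \<subseteq> D \<and> p 0 \<in> R \<and> p 1 = c s \<and>
      pathin X q \<and> q ` {0..1} \<subseteq> E \<and> q 0 = c t \<and> q 1 \<in> R \<longrightarrow>
      P (class_comp X (?cl p) (class_comp X (?cl (subpath_of c s t)) (?cl q))))" for s t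
  have comp': "P (?cl (path_join d e))" if "P (?cl d)" "P (?cl e)" "pathin X d" "pathin X e" "d 1 = e 0"
     "d 0 \<in> R" "d 1 \<in> R" "e 1 \<in> R" for d e
    using comp[of "?cl d" "?cl e" "d 0" "d 1" "e 1"] that by (auto simp: class_comp_class)
  have "0 \<le> s \<and> t \<le> 1 \<longrightarrow> Q s t" if "s \<le> t" for s t
    using that
  \<comment> \<open>Compactness of the interval enters through bisection: it remains to concatenate
    adjacent intervals and to treat all short intervals around each point.\<close>
  proof (induction s t rule: Bolzano)
    case (trans s t v)
    show ?case
    proof (clarsimp simp: Q_def)
      fix D E p q
      assume st: "0 \<le> s" "v \<le> 1" and DE: "D \<in> \<D>" "E \<in> \<D>" and pq: "pathin X p" "p ` {0..1} \<subseteq> D" "p 0 \<in> R" "p 1 = c s"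
        "pathin X q" "q ` {0..1} \<subseteq> E" "q 0 = c v" "q 1 \<in> R"
      have t: "t \<in> {0..1}" using st trans by auto
      then obtain F where F: "F \<in> \<D>" "c t \<in> F" using c(2) by blast
      \<comment> \<open>\<open>w\<close> leads from the subdivision point into \<open>R\<close>.
        Inserted out and back it makes both halves end in \<open>R\<close>, and it cancels in the
        composite.\<close>
      obtain w where w: "pathin X w" "w ` {0..1} \<subseteq> F" "w 0 = c t" "w 1 \<in> R"
        using dense[OF F(1) F(1) F(2) F(2)] by (auto simp: joinable_def)
      have sub: "pathin X (subpath_of c s t)" "pathin X (subpath_of c t v)"
        using st trans by (auto intro!: pathin_subpath_of c)
      have 1: "P (class_comp X (?cl p) (class_comp X (?cl (subpath_of c s t)) (?cl w)))"
      proof -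
        have "Q s t" using trans st by auto
        from this[unfolded Q_def, rule_format, OF DE(1) F(1), of p w] show ?thesis
          using w pq by simp
      qed
      have 2: "P (class_comp X (class_inv X (?cl w)) (class_comp X (?cl (subpath_of c t v)) (?cl q)))"
      proof -
        have "P (class_comp X (?cl (path_rev w)) (class_comp X (?cl (subpath_of c t v)) (?cl q)))"
        proof -
          have "Q t v" using trans st by auto
          from this[unfolded Q_def, rule_format, OF F(1) DE(2), of "path_rev w" q] show ?thesis
            using w pq pathin_rev[OF w(1)] by simp
        qed
        then show ?thesis using w by (simp add: class_inv_class)
      qed
      have mem: "?cl p \<in> path_classes X (p 0) (c s)" "?cl (subpath_of c s t) \<in> path_classes X (c s) (c t)"
         "?cl (subpath_of c t v) \<in> path_classes X (c t) (c v)" "?cl q \<in> path_classes X (c v) (q 1)"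
         "?cl w \<in> path_classes X (c t) (w 1)"
        using pq w sub by auto
      have "P (class_comp X (class_comp X (?cl p) (class_comp X (?cl (subpath_of c s t)) (?cl w)))
         (class_comp X (class_inv X (?cl w)) (class_comp X (?cl (subpath_of c t v)) (?cl q))))"
        by (rule comp[OF 1 2, where x="p 0" and y="w 1" and z="q 1"]) (use mem pq w in \<open>auto intro!: class_comp_closed class_inv_closed\<close>)
      also have "class_comp X (class_comp X (?cl p) (class_comp X (?cl (subpath_of c s t)) (?cl w)))
         (class_comp X (class_inv X (?cl w)) (class_comp X (?cl (subpath_of c t v)) (?cl q)))
         = class_comp X (?cl p) (class_comp X (class_comp X (?cl (subpath_of c s t))
           (class_comp X (class_comp X (?cl w) (class_inv X (?cl w))) (?cl (subpath_of c t v)))) (?cl q))"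
        by (simp add: class_comp_assoc)
      also have "class_comp X (class_comp X (?cl w) (class_inv X (?cl w))) (?cl (subpath_of c t v)) = ?cl (subpath_of c t v)"
        using mem by simp
      also have "class_comp X (?cl (subpath_of c s t)) (?cl (subpath_of c t v)) = ?cl (subpath_of c s v)"
        by (rule class_subpath_of[OF c(1), symmetric]) (use st trans(3,4) in simp_all)
      finally show "P (class_comp X (?cl p) (class_comp X (?cl (subpath_of c s v)) (?cl q)))" .
    qed
  next
    case (local x)
    show ?case
    proof (cases "x \<in> {0..1}")
      case False
      then have "(x < 0 \<or> x > 1)" by auto
      then show ?thesis
        \<comment> \<open>No interval through \<open>x\<close> lies in [0, 1], so any positive bound
          does.\<close>
        by (intro exI[of _ "if x < 0 then -x else x - 1"]) auto
    next
      case True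
      then obtain D where D: "D \<in> \<D>" "c x \<in> D" using c(2) by blast
      have "openin (top_of_set {0..1}) {t \<in> {0..1}. c t \<in> D}"
        using openin_continuous_map_preimage[OF c(1)[unfolded pathin_def] op[OF D(1)]] by simp
      then obtain e where e: "e > 0" "\<And>t. t \<in> {0..1} \<Longrightarrow> dist t x < e \<Longrightarrow> c t \<in> D"
        using True D unfolding openin_euclidean_subtopology_iff by auto
      show ?thesis
      proof (intro exI[of _ e] conjI e allI impI)
        fix s t assume st: "s \<le> x \<and> x \<le> t \<and> t - s < e" "0 \<le> s \<and> t \<le> 1"
        have inD: "subpath_of c s t ` {0..1} \<subseteq> D"
        proof
          fix y assume "y \<in> subpath_of c s t ` {0..1}"
          then obtain u where u: "u \<in> {0..1}" "y = c (s + u * (t - s))" by (auto simp: subpath_of_def)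
          let ?v = "s + u * (t - s)"
          have v: "s \<le> ?v" "?v \<le> t" using affine_in_unit[of s t u] st u by auto
          then have "\<bar>?v - x\<bar> < e" "?v \<in> {0..1}" using st unfolding abs_less_iff atLeastAtMost_iff by linarith+
          then show "y \<in> D" using e(2)[of ?v] u by (simp add: dist_real_def)
        qed
        have sub: "pathin X (subpath_of c s t)"
          using st by (auto intro!: pathin_subpath_of c)
        show "Q s t"
          unfolding Q_def
        proof (intro ballI allI impI)
          fix E F p q assume EF: "E \<in> \<D>" "F \<in> \<D>" and pq: "pathin X p \<and> p ` {0..1} \<subseteq> E \<and> p 0 \<in> R \<and> p 1 = c s \<and>
            pathin X q \<and> q ` {0..1} \<subseteq> F \<and> q 0 = c t \<and> q 1 \<in> R"
          have cs: "c s \<in> E" "c s \<in> D" "c t \<in> F" "c t \<in> D"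
            using pq inD subpath_of_ends[of c s t] by (metis atLeastAtMost_iff image_subset_iff order_refl zero_le_one)+
          \<comment> \<open>The prolongations \<open>p\<close> and \<open>q\<close> lie in other
            members of the cover than the piece of \<open>c\<close>. The detours \<open>u\<close>
            and \<open>v\<close>, taken inside the intersections, cut the prolonged piece into three
            paths, each inside one member and with ends in \<open>R\<close>.\<close>
          obtain u where u: "pathin X u" "u ` {0..1} \<subseteq> E \<inter> D" "u 0 = c s" "u 1 \<in> R"
            using dense[OF EF(1) D(1) cs(1,2)] by (auto simp: joinable_def)
          obtain v where v: "pathin X v" "v ` {0..1} \<subseteq> F \<inter> D" "v 0 = c t" "v 1 \<in> R"
            using dense[OF EF(2) D(1) cs(3,4)] by (auto simp: joinable_def)
          have im: "u ` {0..1} \<subseteq> E" "u ` {0..1} \<subseteq> D" "v ` {0..1} \<subseteq> F" "v ` {0..1} \<subseteq> D"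
            using u(2) v(2) by blast+
          have 1: "P (?cl (path_join p u))"
            by (intro loc[OF EF(1)] pathin_path_join path_join_image) (use u pq im in simp_all)
          have 2: "P (?cl (path_join (path_rev u) (path_join (subpath_of c s t) v)))"
            by (intro loc[OF D(1)] pathin_path_join pathin_rev path_join_image) (use u v sub inD im in simp_all)
          have 3: "P (?cl (path_join (path_rev v) q))"
            by (intro loc[OF EF(2)] pathin_path_join pathin_rev path_join_image) (use v pq im in simp_all)
          have mem: "?cl p \<in> path_classes X (p 0) (c s)" "?cl (subpath_of c s t) \<in> path_classes X (c s) (c t)"
            "?cl q \<in> path_classes X (c t) (q 1)" "?cl u \<in> path_classes X (c s) (u 1)" "?cl v \<in> path_classes X (c t) (v 1)"
            using pq u v sub by auto
          have "P (?cl (path_join (path_join p u) (path_join (path_join (path_rev u) (path_join (subpath_of c s t) v)) (path_join (path_rev v) q))))"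
            by (intro comp' 1 2 3 pathin_path_join pathin_rev) (use u(1,3,4) v(1,3,4) pq sub in simp_all)
          also have "?cl (path_join (path_join p u) (path_join (path_join (path_rev u) (path_join (subpath_of c s t) v)) (path_join (path_rev v) q)))
            = class_comp X (class_comp X (?cl p) (?cl u)) (class_comp X (class_comp X (class_inv X (?cl u))
               (class_comp X (?cl (subpath_of c s t)) (?cl v))) (class_comp X (class_inv X (?cl v)) (?cl q)))"
            using u v pq sub by (simp add: class_comp_class class_inv_class pathin_path_join pathin_rev)
          also have "\<dots> = class_comp X (?cl p) (class_comp X (class_comp X (class_comp X (?cl u) (class_inv X (?cl u))) (?cl (subpath_of c s t)))
               (class_comp X (class_comp X (?cl v) (class_inv X (?cl v))) (?cl q)))"
            by (simp add: class_comp_assoc)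
          also have "\<dots> = class_comp X (?cl p) (class_comp X (?cl (subpath_of c s t)) (?cl q))"
            using mem by simp
          finally show "P (class_comp X (?cl p) (class_comp X (?cl (subpath_of c s t)) (?cl q)))" .
        qed
      qed
    qed
  qed
  then have Q: "Q 0 1" by auto
  have top: "c 0 \<in> topspace X" "c 1 \<in> topspace X" by (simp_all add: pathin_topspace[OF c(1)])
  obtain D E where DE: "D \<in> \<D>" "c 0 \<in> D" "E \<in> \<D>" "c 1 \<in> E" 
    using c(2) by (metis UnionE atLeastAtMost_iff image_subset_iff order_refl zero_le_one)
  \<comment> \<open>The ends of \<open>c\<close> lie in \<open>R\<close> already, so constant
    prolongations serve.\<close>
  have "P (class_comp X (?cl (\<lambda>_. c 0)) (class_comp X (?cl (subpath_of c 0 1)) (?cl (\<lambda>_. c 1))))"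
    by (rule Q[unfolded Q_def, rule_format, OF DE(1,3)]) (use DE c(3,4) top in \<open>simp add: pathin_const image_subset_iff\<close>)
  moreover have "subpath_of c 0 1 = c" by (simp add: subpath_of_def)
  moreover have "?cl c \<in> path_classes X (c 0) (c 1)" using c by auto
  ultimately show ?thesis by (simp flip: class_one_def)
qed

section \<open>Boxes in configuration spaces\<close>

lemma finite_positive_bound:
  fixes A :: "real set"
  assumes "finite A" "\<And>x. x \<in> A \<Longrightarrow> 0 < x"
  obtains d where "d > 0" "\<And>x. x \<in> A \<Longrightarrow> d \<le> x"
proof
  \<comment> \<open>The inserted \<open>1\<close> covers the case of an empty set.\<close>
  show "Min (insert 1 A) > 0" using assms by simp
  show "Min (insert 1 A) \<le> x" if "x \<in> A" for x using assms that by simp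
qed

text \<open>Shared by two configuration spaces: \<open>f\<close> is the identity for the punctured
  plane and the projection of the charts for the orbifold. Shrinking the factors so that each
  \<open>f (c i)\<close> moves by less than half the least mutual distance keeps these points
  distinct.\<close>

lemma open_contains_product_box:
  fixes f :: "'b::topological_space \<Rightarrow> 'c::metric_space"
  assumes "finite I" "open S" and f: "continuous_on UNIV f"
    and C: "\<And>c. c \<in> PiE I (\<lambda>_. S) \<Longrightarrow> c \<in> C \<longleftrightarrow> inj_on (\<lambda>i. f (c i)) I"
    and W: "openin (subtopology (product_topology (\<lambda>_. top_of_set S) I) C) W" "c \<in> W"
  obtains V where "\<And>i. i \<in> I \<Longrightarrow> open (V i)" "\<And>i. i \<in> I \<Longrightarrow> c i \<in> V i" "PiE I V \<subseteq> W"
proof -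
  obtain T where T: "openin (product_topology (\<lambda>_. top_of_set S) I) T" "W = T \<inter> C"
    using W(1) by (auto simp: openin_subtopology)
  have "c \<in> T" using T(2) W(2) by blast
  then have "\<exists>U. finite {i \<in> I. U i \<noteq> topspace (top_of_set S)} \<and>
      (\<forall>i\<in>I. openin (top_of_set S) (U i)) \<and> c \<in> PiE I U \<and> PiE I U \<subseteq> T"
    by (rule bspec[OF T(1)[unfolded openin_product_topology_alt]])
  then obtain U where U: "\<And>i. i \<in> I \<Longrightarrow> openin (top_of_set S) (U i)" "c \<in> PiE I U" "PiE I U \<subseteq> T"
    by blast
  have US: "U i \<subseteq> S" if "i \<in> I" for i using openin_subset[OF U(1)[OF that]] by simp
  have PiE_US: "PiE I U \<subseteq> PiE I (\<lambda>_. S)" by (rule PiE_mono) (rule US)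
  then have "c \<in> PiE I (\<lambda>_. S)" using U(2) by blast
  then have inj: "inj_on (\<lambda>i. f (c i)) I" using C T(2) W(2) by blast
  let ?A = "(\<lambda>(i, j). dist (f (c i)) (f (c j)) / 2) ` (I \<times> I - Id)"
  have "0 < v" if "v \<in> ?A" for v
    using that inj_onD[OF inj] by auto
  then obtain d where d: "d > 0" "\<And>v. v \<in> ?A \<Longrightarrow> d \<le> v"
    using assms(1) by (rule_tac finite_positive_bound[of ?A]) auto
  define V where "V i = U i \<inter> f -` ball (f (c i)) d" for i
  show thesis
  proof (rule that)
    show "open (V i)" if "i \<in> I" for i
      unfolding V_def using openin_open_trans[OF U(1)[OF that] assms(2)] f
      by (intro open_Int open_vimage) auto
    show "c i \<in> V i" if "i \<in> I" for i using PiE_mem[OF U(2) that] d(1) by (simp add: V_def)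
    show "PiE I V \<subseteq> W"
    proof
      fix e assume e: "e \<in> PiE I V"
      have V: "e i \<in> U i" "dist (f (c i)) (f (e i)) < d" if "i \<in> I" for i
        using PiE_mem[OF e that] by (auto simp: V_def)
      have "inj_on (\<lambda>i. f (e i)) I"
      proof (rule inj_onI, rule ccontr)
        fix i j assume ij: "i \<in> I" "j \<in> I" "f (e i) = f (e j)" "i \<noteq> j"
        then have "d \<le> dist (f (c i)) (f (c j)) / 2" by (intro d(2)) auto
        then show False
          using dist_triangle2[of "f (c i)" "f (c j)" "f (e i)"] V(2)[OF ij(1)] V(2)[OF ij(2)] ij(3) by simp
      qed
      moreover have "e \<in> PiE I U" using e V(1) by (simp add: PiE_iff)
      ultimately show "e \<in> W" using T(2) U(3) C PiE_US by blast
    qed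
  qed
qed

lemma openin_product_box:
  assumes "finite I" "\<And>i. i \<in> I \<Longrightarrow> open (V i)"
    and sub: "PiE I V \<subseteq> topspace (subtopology (product_topology (\<lambda>_. top_of_set S) I) C)"
  shows "openin (subtopology (product_topology (\<lambda>_. top_of_set S) I) C) (PiE I V)"
  unfolding openin_subtopology
proof (intro exI[of _ "PiE I (\<lambda>i. S \<inter> V i)"] conjI)
  show "openin (product_topology (\<lambda>_. top_of_set S) I) (PiE I (\<lambda>i. S \<inter> V i))"
    using assms(1,2) by (subst openin_PiE) (auto simp: openin_open_Int)
  have "PiE I V \<subseteq> PiE I (\<lambda>_. S) \<inter> C" using sub by simp
  moreover have "PiE I (\<lambda>i. S \<inter> V i) = PiE I (\<lambda>_. S) \<inter> PiE I V" by (auto simp: PiE_iff)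
  ultimately show "PiE I V = PiE I (\<lambda>i. S \<inter> V i) \<inter> C" by blast
qed

text \<open>Straight-line homotopies in all coordinates at once. Later \<open>f\<close> is the
  identity for polydiscs, while for chart boxes it attaches the constant chart numbers.\<close>

lemma path_homotopic_convex_box:
  fixes B :: "'i \<Rightarrow> 'b::real_normed_vector set"
  assumes f: "continuous_map (subtopology (product_topology (\<lambda>_. euclidean) I) (PiE I B)) X f"
    and B: "\<And>i. i \<in> I \<Longrightarrow> convex (B i)"
    and c: "c \<in> {0..1} \<rightarrow> PiE I B" "\<And>i. i \<in> I \<Longrightarrow> continuous_on {0..1} (\<lambda>t. c t i)"
    and d: "d \<in> {0..1} \<rightarrow> PiE I B" "\<And>i. i \<in> I \<Longrightarrow> continuous_on {0..1} (\<lambda>t. d t i)"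
    and ends: "c 0 = d 0" "c 1 = d 1"
  shows "path_homotopic X (f \<circ> c) (f \<circ> d)"
proof (rule path_homotopic_compose[OF path_homotopicI f])
  let ?h = "\<lambda>z::real \<times> real. \<lambda>i\<in>I. (1 - fst z) *\<^sub>R c (snd z) i + fst z *\<^sub>R d (snd z) i"
  have "?h z \<in> PiE I B" if z: "fst z \<in> {0..1}" "snd z \<in> {0..1}" for z
  proof -
    have "c (snd z) i \<in> B i" "d (snd z) i \<in> B i" if "i \<in> I" for i
      using c(1) d(1) z(2) that by (auto simp: Pi_iff PiE_iff)
    then have "(1 - fst z) *\<^sub>R c (snd z) i + fst z *\<^sub>R d (snd z) i \<in> B i" if "i \<in> I" for i
      using z(1) that by (intro convexD_alt B) auto
    then show ?thesis by auto
  qed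
  moreover have "continuous_on ({0..1} \<times> {0..1}) (\<lambda>z. ?h z i)" if i: "i \<in> I" for i
  proof -
    have "continuous_on ({0..1::real} \<times> {0..1}) (\<lambda>z. c (snd z) i)"
      by (rule continuous_on_compose2[OF c(2)[OF i]]) (auto intro!: continuous_intros)
    moreover have "continuous_on ({0..1::real} \<times> {0..1}) (\<lambda>z. d (snd z) i)"
      by (rule continuous_on_compose2[OF d(2)[OF i]]) (auto intro!: continuous_intros)
    ultimately show ?thesis using i by (auto intro!: continuous_intros)
  qed
  ultimately show "continuous_map (prod_topology (top_of_set {0..1}) (top_of_set {0..1}))
      (subtopology (product_topology (\<lambda>_. euclidean) I) (PiE I B)) ?h"
    by (auto simp: continuous_map_in_subtopology continuous_map_componentwise Pi_iff PiE_iff)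
  have ext: "c t \<in> extensional I" "d t \<in> extensional I" if "t \<in> {0..1}" for t
    using c(1) d(1) that by (auto simp: Pi_iff PiE_iff)
  show "?h (0, t) = c t" "?h (1, t) = d t" if "t \<in> {0..1}" for t
    using ext[OF that] by (auto simp: fun_eq_iff extensional_def)
  show "?h (s, 0) = c 0" "?h (s, 1) = c 1" for s
    using ext[of 0] ext[of 1] ends by (auto simp: fun_eq_iff extensional_def simp flip: scaleR_left_distrib)
qed

section \<open>Points stacked over the real line\<close>

text \<open>\<open>n\<close> points move and \<open>r\<close> are fixed. The same locale with
  \<open>n + r\<close> moving and no fixed points describes the ambient ordered configurations of
  the full braid group.\<close>

locale line_points =
  fixes n r :: nat and a :: "nat \<Rightarrow> real"
  assumes mono: "strict_mono_on {1..n + r} a"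
begin

abbreviation N where "N \<equiv> n + r"
abbreviation M where "M \<equiv> punctured_conf n r a"
abbreviation full where "full \<equiv> add_straight n r a"
abbreviation base where "base \<equiv> base_conf n a"

lemma a_less: "1 \<le> i \<Longrightarrow> i < j \<Longrightarrow> j \<le> N \<Longrightarrow> a i < a j"
  using mono by (auto simp: strict_mono_on_def)

lemma full_moving [simp]: "l \<in> {1..n} \<Longrightarrow> full c l = c l"
  by (simp add: add_straight_def)

lemma full_fixed [simp]: "n < l \<Longrightarrow> l \<le> N \<Longrightarrow> full c l = of_real (a l)"
  by (simp add: add_straight_def)

lemma full_base [simp]: "l \<in> {1..N} \<Longrightarrow> full base l = of_real (a l)"
  by (simp add: add_straight_def base_conf_def)

lemma index_cases:
  assumes "l \<in> {1..N}"
  obtains "l \<in> {1..n}" | "n < l" "l \<le> N"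
  using assms by (cases "l \<le> n") auto

text \<open>Avoiding the punctures and being pairwise distinct become one injectivity condition, so
  that moving and fixed points are treated alike from here on.\<close>

lemma topspace_M: "topspace M = {c \<in> extensional {1..n}. inj_on (full c) {1..N}}"
proof -
  let ?F = "(complex_of_real \<circ> a) ` {n+1..N}"
  have "(c \<in> PiE {1..n} (\<lambda>_. - ?F) \<and> inj_on c {1..n}) \<longleftrightarrow> (c \<in> extensional {1..n} \<and> inj_on (full c) {1..N})" for c
  proof
    assume *: "c \<in> PiE {1..n} (\<lambda>_. - ?F) \<and> inj_on c {1..n}"
    have "full c i \<noteq> full c j" if ij: "i \<in> {1..N}" "j \<in> {1..N}" "i < j" for i j
    proof (cases "j \<le> n")
      case True
      then have "i \<in> {1..n}" "j \<in> {1..n}" using ij by auto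
      then show ?thesis using conjunct2[OF *] ij(3) by (metis full_moving inj_onD less_irrefl)
    next
      case j: False
      show ?thesis
      proof (cases "i \<le> n")
        case True
        then have "c i \<notin> ?F" using * ij by (auto simp: PiE_iff)
        then show ?thesis using j ij True by auto
      next
        case False
        then show ?thesis using j ij a_less[of i j] by auto
      qed
    qed
    then have "inj_on (full c) {1..N}" by (metis linorder_inj_onI')
    then show "c \<in> extensional {1..n} \<and> inj_on (full c) {1..N}" using * by (simp add: PiE_iff)
  next
    assume *: "c \<in> extensional {1..n} \<and> inj_on (full c) {1..N}"
    have "inj_on c {1..n}"
    proof (rule inj_onI)
      fix i j assume "i \<in> {1..n}" "j \<in> {1..n}" "c i = c j"
      then show "i = j" using * inj_onD[of "full c" "{1..N}" i j] by auto
    qed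
    moreover have "c i \<notin> ?F" if "i \<in> {1..n}" for i
    proof
      assume "c i \<in> ?F"
      then obtain l where "l \<in> {n+1..N}" "c i = of_real (a l)" by auto
      then show False using * inj_onD[of "full c" "{1..N}" i l] that by auto
    qed
    ultimately show "c \<in> PiE {1..n} (\<lambda>_. - ?F) \<and> inj_on c {1..n}" using * by (auto simp: PiE_iff)
  qed
  then show ?thesis by (auto simp: punctured_conf_def pconf_def)
qed

lemma continuous_map_M:
  "continuous_map Z M f \<longleftrightarrow> f \<in> topspace Z \<rightarrow> topspace M \<and>
     (\<forall>i\<in>{1..n}. continuous_map Z euclidean (\<lambda>z. f z i))" (is "?L \<longleftrightarrow> ?R")
proof -
  have "?L \<longleftrightarrow> continuous_map Z M f \<and> f \<in> topspace Z \<rightarrow> topspace M"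
    by (auto simp: continuous_map_def)
  also have "\<dots> \<longleftrightarrow> ?R"
    by (auto simp: punctured_conf_def pconf_def continuous_map_in_subtopology continuous_map_componentwise
      Pi_iff PiE_iff)
  finally show ?thesis .
qed

lemma pathin_M:
  "pathin M p \<longleftrightarrow> p ` {0..1} \<subseteq> topspace M \<and> (\<forall>i\<in>{1..n}. continuous_on {0..1} (\<lambda>t. p t i))"
  by (auto simp: pathin_def continuous_map_M)

lemma continuous_full: "l \<in> {1..N} \<Longrightarrow> continuous_map M euclidean (\<lambda>c. full c l)"
proof (erule index_cases)
  assume "l \<in> {1..n}"
  moreover have "continuous_map M M id" by simp
  ultimately show ?thesis unfolding continuous_map_M by simp
qed (simp add: continuous_map_const)

definition stacked :: "(nat \<Rightarrow> real) \<Rightarrow> (nat \<Rightarrow> complex) set" where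
  "stacked \<rho> = {c \<in> extensional {1..n}. \<forall>i\<in>{1..N}. \<forall>j\<in>{1..N}.
     \<rho> j < \<rho> i \<and> Re (full c i) = Re (full c j) \<longrightarrow> Im (full c j) < Im (full c i)}"

definition generic :: "(nat \<Rightarrow> complex) set" where
  "generic = {c \<in> extensional {1..n}. inj_on (\<lambda>l. Re (full c l)) {1..N}}"

lemma stacked_subset:
  assumes "inj_on \<rho> {1..N}"
  shows "stacked \<rho> \<subseteq> topspace M"
proof
  fix c assume c: "c \<in> stacked \<rho>"
  have "full c i \<noteq> full c j" if "i \<in> {1..N}" "j \<in> {1..N}" "i \<noteq> j" for i j
  proof -
    have "\<rho> i < \<rho> j \<or> \<rho> j < \<rho> i" using assms that by (metis inj_onD neqE)
    then show ?thesis using c that by (fastforce simp: stacked_def)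
  qed
  then have "inj_on (full c) {1..N}" unfolding inj_on_def by blast
  then show "c \<in> topspace M" using c by (simp add: topspace_M stacked_def)
qed

lemma generic_stacked: "generic \<subseteq> stacked \<rho>"
  by (auto simp: generic_def stacked_def inj_on_def)

lemma generic_subset: "generic \<subseteq> topspace M"
  by (auto simp: generic_def topspace_M inj_on_def)

lemma base_generic: "base \<in> generic"
proof -
  have "inj_on a {1..N}" using mono by (rule strict_mono_on_imp_inj_on)
  moreover have "inj_on (\<lambda>l. Re (full base l)) {1..N} \<longleftrightarrow> inj_on a {1..N}"
    by (rule inj_on_cong) simp
  ultimately show ?thesis by (simp add: generic_def base_conf_def)
qed

text \<open>A pair violates the condition when its real parts agree and its heights are weakly in
  the wrong order, which is a closed condition; only finitely many pairs occur.\<close>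

lemma openin_stacked:
  assumes "inj_on \<rho> {1..N}"
  shows "openin M (stacked \<rho>)"
proof -
  let ?S = "\<lambda>i j. {c \<in> topspace M. \<not> (\<rho> j < \<rho> i \<and> Re (full c i) = Re (full c j) \<and> Im (full c i) \<le> Im (full c j))}"
  have "openin M (?S i j)" if "i \<in> {1..N}" "j \<in> {1..N}" for i j
  proof -
    have "continuous_map M (prod_topology euclidean euclidean) (\<lambda>c. (full c i, full c j))"
      using continuous_full that by (intro continuous_map_pairedI) auto
    moreover have "closed {z :: complex \<times> complex. Re (fst z) = Re (snd z) \<and> Im (fst z) \<le> Im (snd z)}"
      by (intro closed_Collect_conj closed_Collect_eq closed_Collect_le continuous_intros)
    then have "open {z :: complex \<times> complex. \<not> (\<rho> j < \<rho> i \<and> Re (fst z) = Re (snd z) \<and> Im (fst z) \<le> Im (snd z))}"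
      by (cases "\<rho> j < \<rho> i") (auto simp: closed_def Collect_neg_eq[symmetric])
    ultimately show ?thesis
      using openin_continuous_map_preimage[of M "prod_topology euclidean euclidean" "\<lambda>c. (full c i, full c j)"] by fastforce
  qed
  \<comment> \<open>An empty intersection would be the universe, so the case of no points is kept
    apart.\<close>
  then have "openin M (\<Inter>(i, j)\<in>{1..N} \<times> {1..N}. ?S i j)" if "N > 0"
    using that by (intro openin_INT2) auto
  moreover have eq: "stacked \<rho> = {c \<in> topspace M. \<forall>i\<in>{1..N}. \<forall>j\<in>{1..N}. c \<in> ?S i j}"
  proof -
    have "c \<in> stacked \<rho> \<longleftrightarrow> (\<forall>i\<in>{1..N}. \<forall>j\<in>{1..N}. c \<in> ?S i j)" if "c \<in> topspace M" for c
      using that by (simp add: stacked_def topspace_M not_le, blast)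
    then show ?thesis using stacked_subset[OF assms] by blast
  qed
  moreover have "stacked \<rho> = (\<Inter>(i, j)\<in>{1..N} \<times> {1..N}. ?S i j)" if "N > 0"
    using that unfolding eq by fastforce
  moreover have "stacked \<rho> = topspace M" if "N = 0"
    using that eq by auto
  ultimately show ?thesis by (cases "N = 0") auto
qed

subsection \<open>The stacked region is simply connected\<close>

text \<open>Over the fixed point number \<open>l\<close> the reference height of point \<open>i\<close> is \<open>\<rho> i - \<rho> l\<close>, so that the
  fixed points are at their reference height and the reference heights are ordered by \<open>\<rho>\<close>.\<close>

definition profile :: "(nat \<Rightarrow> real) \<Rightarrow> real \<Rightarrow> real" where
  "profile \<rho> = (SOME g. continuous_on UNIV g \<and> (\<forall>l\<in>{n+1..N}. g (a l) = \<rho> l))"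

lemma profile:
  shows continuous_profile: "continuous_on UNIV (profile \<rho>)"
    and profile_fixed: "n < l \<Longrightarrow> l \<le> N \<Longrightarrow> profile \<rho> (a l) = \<rho> l"
proof -
  have inj: "inj_on a {n+1..N}"
    using strict_mono_on_imp_inj_on[OF mono] by (rule inj_on_subset) auto
  let ?f = "\<lambda>y. \<rho> (inv_into {n+1..N} a y)"
  \<comment> \<open>Tietze extension from the finite set of fixed abscissas, bounded by the largest
    absolute value prescribed; the inserted \<open>0\<close> keeps the maximum defined when there
    are no fixed points.\<close>
  obtain g where g: "continuous_on UNIV g" "\<And>x. x \<in> a ` {n+1..N} \<Longrightarrow> g x = ?f x"
  proof (rule Tietze[of "a ` {n+1..N}" ?f UNIV "Max (insert 0 ((norm \<circ> ?f) ` a ` {n+1..N}))"])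
    show "continuous_on (a ` {n+1..N}) ?f" by (rule continuous_on_finite) auto
  qed (auto intro!: finite_imp_closed Max_ge)
  have "\<exists>g. continuous_on UNIV g \<and> (\<forall>l\<in>{n+1..N}. g (a l) = \<rho> l)"
    using g inj by (intro exI[of _ g]) auto
  from someI_ex[OF this, folded profile_def]
  show "continuous_on UNIV (profile \<rho>)" "n < l \<Longrightarrow> l \<le> N \<Longrightarrow> profile \<rho> (a l) = \<rho> l"
    by auto
qed

lemma continuous_on_profile [continuous_intros]:
  "continuous_on S f \<Longrightarrow> continuous_on S (\<lambda>x. profile \<rho> (f x))"
  using continuous_on_compose2[OF continuous_profile] by auto

definition lift :: "(nat \<Rightarrow> real) \<Rightarrow> (nat \<Rightarrow> complex) \<Rightarrow> real \<Rightarrow> nat \<Rightarrow> complex" where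
  "lift \<rho> c \<tau> = (\<lambda>i\<in>{1..n}. Complex (Re (c i)) ((1 - \<tau>) * Im (c i) + \<tau> * (\<rho> i - profile \<rho> (Re (c i)))))"

definition flat :: "(nat \<Rightarrow> real) \<Rightarrow> (nat \<Rightarrow> real) \<Rightarrow> nat \<Rightarrow> complex" where
  "flat \<rho> u = (\<lambda>i\<in>{1..n}. Complex (u i) (\<rho> i - profile \<rho> (u i)))"

text \<open>The formula extends to the fixed points because \<open>profile \<rho>\<close> takes the
  value \<open>\<rho> l\<close> at \<open>a l\<close>: their reference height is the height 0 they
  already have.\<close>

lemma full_lift:
  assumes "l \<in> {1..N}"
  shows "full (lift \<rho> c \<tau>) l = Complex (Re (full c l)) ((1 - \<tau>) * Im (full c l) + \<tau> * (\<rho> l - profile \<rho> (Re (full c l))))"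
  using assms by (rule index_cases) (auto simp: lift_def profile_fixed complex_eq_iff)

lemma full_flat:
  assumes "l \<in> {1..N}"
  shows "full (flat \<rho> u) l = (let x = if l \<le> n then u l else a l in Complex x (\<rho> l - profile \<rho> x))"
  using assms by (rule index_cases) (auto simp: flat_def profile_fixed complex_eq_iff Let_def)

text \<open>Over a common abscissa the two \<open>profile\<close> terms are equal, and what remains
  are convex combinations of two pairs of heights that are both in the right order.\<close>

lemma lift_stacked:
  assumes "c \<in> stacked \<rho>" "\<tau> \<in> {0..1}"
  shows "lift \<rho> c \<tau> \<in> stacked \<rho>"
proof -
  have "Im (full (lift \<rho> c \<tau>) j) < Im (full (lift \<rho> c \<tau>) i)"
    if "i \<in> {1..N}" "j \<in> {1..N}" "\<rho> j < \<rho> i" "Re (full c i) = Re (full c j)" for i j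
  proof -
    have "Im (full c j) < Im (full c i)" using assms(1) that by (auto simp: stacked_def)
    then have "(1 - \<tau>) * Im (full c j) + \<tau> * \<rho> j < (1 - \<tau>) * Im (full c i) + \<tau> * \<rho> i"
      using that(3) assms(2)
      by (cases "\<tau> = 0") (auto intro!: add_le_less_mono mult_left_mono)
    then show ?thesis using that by (simp add: full_lift algebra_simps)
  qed
  then show ?thesis using assms(1) by (auto simp: stacked_def full_lift) (auto simp: lift_def)
qed

lemma flat_stacked: "flat \<rho> u \<in> stacked \<rho>"
  by (auto simp: stacked_def full_flat Let_def) (auto simp: flat_def)

lemma lift_0: "c \<in> extensional {1..n} \<Longrightarrow> lift \<rho> c 0 = c"
  by (auto simp: lift_def fun_eq_iff extensional_def)

lemma lift_1: "lift \<rho> c 1 = flat \<rho> (\<lambda>i. Re (c i))"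
  by (auto simp: lift_def flat_def fun_eq_iff)

definition shift :: "(nat \<Rightarrow> complex) \<Rightarrow> (nat \<Rightarrow> complex) \<Rightarrow> real \<Rightarrow> nat \<Rightarrow> real" where
  "shift x y s = (\<lambda>i. (1 - s) * Re (x i) + s * Re (y i))"

lemma pathin_lift:
  assumes "inj_on \<rho> {1..N}" "c \<in> stacked \<rho>"
  shows "pathin M (lift \<rho> c)" "lift \<rho> c ` {0..1} \<subseteq> stacked \<rho>"
proof -
  show *: "lift \<rho> c ` {0..1} \<subseteq> stacked \<rho>" using assms lift_stacked by blast
  show "pathin M (lift \<rho> c)"
    using * stacked_subset[OF assms(1)]
    by (auto simp: pathin_M lift_def Complex_eq intro!: continuous_intros)
qed

lemma pathin_flat_shift:
  assumes "inj_on \<rho> {1..N}"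
  shows "pathin M (\<lambda>s. flat \<rho> (shift x y s))"
proof -
  have "(\<lambda>s. flat \<rho> (shift x y s)) ` {0..1} \<subseteq> topspace M"
    using flat_stacked stacked_subset[OF assms] by blast
  then show ?thesis
    unfolding pathin_M by (simp add: flat_def Complex_eq shift_def continuous_intros)
qed

text \<open>The path is a vertical lift, a linear change of the abscissas and a vertical descent.
  Linear interpolation preserves every strict inequality valid at both ends; this refinement of mere
  connectedness is what makes rankings comparable in \<open>canon_agree\<close>.\<close>

lemma stacked_joinable:
  assumes "inj_on \<rho> {1..N}" "x \<in> stacked \<rho>" "y \<in> stacked \<rho>"
  shows "joinable M {c \<in> stacked \<rho>. \<forall>i\<in>{1..N}. \<forall>j\<in>{1..N}. Re (full x i) < Re (full x j) \<and>
      Re (full y i) < Re (full y j) \<longrightarrow> Re (full c i) < Re (full c j)} x y" (is "joinable M ?S x y")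
proof -
  have ext: "x \<in> extensional {1..n}" "y \<in> extensional {1..n}" using assms by (auto simp: stacked_def)
  have up: "joinable M ?S c (flat \<rho> (\<lambda>i. Re (c i)))" if "c \<in> {x, y}" for c
    unfolding joinable_def
    using that assms ext pathin_lift[OF assms(1), of c]
    by (intro exI[of _ "lift \<rho> c"]) (auto simp: lift_0 lift_1 full_lift)
  have mid: "joinable M ?S (flat \<rho> (\<lambda>i. Re (x i))) (flat \<rho> (\<lambda>i. Re (y i)))"
    unfolding joinable_def
  proof (intro exI[of _ "\<lambda>s. flat \<rho> (shift x y s)"] conjI pathin_flat_shift assms)
    have "Re (full (flat \<rho> (shift x y s)) l) = (1 - s) * Re (full x l) + s * Re (full y l)"
      if "l \<in> {1..N}" for s l
      using that by (auto simp: full_flat Let_def shift_def algebra_simps elim!: index_cases)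
    moreover have "(1 - s) * u + s * v < (1 - s) * u' + s * v'" if "u < u'" "v < v'" "s \<in> {0..1}"
      for s u v u' v' :: real
      using that by (cases "s = 0") (auto intro!: add_le_less_mono mult_left_mono)
    ultimately show "(\<lambda>s. flat \<rho> (shift x y s)) ` {0..1} \<subseteq> ?S"
      using flat_stacked by auto
  qed (auto simp: shift_def)
  then show ?thesis
    using joinable_trans[OF joinable_trans[OF up[of x] mid] joinable_sym[OF up[of y]]] by simp
qed

text \<open>Conjugation by the vertical lifts of the ends replaces a path by its flat shadow, which
  depends on the abscissas only. Two shadows with the same ends are homotopic by interpolating
  abscissas, as every flat configuration is stacked.\<close>

lemma stacked_path_class:
  assumes \<rho>: "inj_on \<rho> {1..N}" and p: "pathin M p" "p ` {0..1} \<subseteq> stacked \<rho>"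
    and q: "pathin M q" "q ` {0..1} \<subseteq> stacked \<rho>" and pq: "p 0 = q 0" "p 1 = q 1"
  shows "path_class M p = path_class M q"
proof -
  let ?E = "\<lambda>p t. flat \<rho> (\<lambda>i. Re (p t i))"
  have ext: "c \<in> extensional {1..n}" if "c \<in> stacked \<rho>" for c using that by (auto simp: stacked_def)
  have square: "path_class M p = class_comp M (path_class M (lift \<rho> (p 0)))
      (class_comp M (path_class M (?E p)) (class_inv M (path_class M (lift \<rho> (p 1)))))"
    if p: "pathin M p" "p ` {0..1} \<subseteq> stacked \<rho>" for p
  proof -
    have cont: "continuous_on ({0..1::real} \<times> {0..1}) (\<lambda>z. p (snd z) i)" if "i \<in> {1..n}" for i
    proof -
      have "continuous_on {0..1} (\<lambda>t. p t i)" using p(1) that by (simp add: pathin_M)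
      then show ?thesis by (rule continuous_on_compose2) (auto intro!: continuous_intros)
    qed
    \<comment> \<open>The square has \<open>p\<close> and its flat shadow as opposite sides; the
      other two sides are the lifts of the end points.\<close>
    have f: "continuous_map (top_of_set ({0..1} \<times> {0..1})) M (\<lambda>z. lift \<rho> (p (snd z)) (fst z))"
      unfolding continuous_map_M
    proof (intro conjI ballI)
      show "(\<lambda>z. lift \<rho> (p (snd z)) (fst z)) \<in> topspace (top_of_set ({0..1} \<times> {0..1})) \<rightarrow> topspace M"
      proof
        fix z :: "real \<times> real" assume "z \<in> topspace (top_of_set ({0..1} \<times> {0..1}))"
        then have z: "fst z \<in> {0..1}" "snd z \<in> {0..1}" by auto
        then have "p (snd z) \<in> stacked \<rho>" using p(2) by blast
        then show "lift \<rho> (p (snd z)) (fst z) \<in> topspace M"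
          using lift_stacked z(1) stacked_subset[OF \<rho>] by blast
      qed
      show "continuous_map (top_of_set ({0..1} \<times> {0..1})) euclidean (\<lambda>z. lift \<rho> (p (snd z)) (fst z) i)"
        if "i \<in> {1..n}" for i
        using cont[OF that] that by (auto simp: lift_def Complex_eq intro!: continuous_intros)
    qed
    have 0: "path_class M (\<lambda>t. lift \<rho> (p t) 0) = path_class M p"
      by (rule path_class_cong[symmetric]) (use p ext in \<open>auto simp: lift_0 image_subset_iff\<close>)
    have eq: "class_comp M (path_class M p) (path_class M (lift \<rho> (p 1)))
      = class_comp M (path_class M (lift \<rho> (p 0))) (path_class M (?E p))"
      using class_comp_square[OF f] by (simp add: 0 lift_1)
    have st: "p 0 \<in> stacked \<rho>" "p 1 \<in> stacked \<rho>" using p by auto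
    have mem: "path_class M (lift \<rho> (p 1)) \<in> path_classes M (p 1) (lift \<rho> (p 1) 1)" "path_class M p \<in> path_classes M (p 0) (p 1)"
      using p st lift_0[OF ext[OF st(2)]] by (auto intro!: path_classesI pathin_lift \<rho>)
    have "path_class M p = class_comp M (class_comp M (path_class M p) (path_class M (lift \<rho> (p 1))))
       (class_inv M (path_class M (lift \<rho> (p 1))))"
      using mem by (simp add: class_comp_assoc)
    then show ?thesis by (simp add: eq class_comp_assoc)
  qed
  have "path_homotopic M (?E p) (?E q)"
  proof (rule path_homotopicI)
    show "continuous_map (prod_topology (top_of_set {0..1}) (top_of_set {0..1})) M
        (\<lambda>z. flat \<rho> (shift (p (snd z)) (q (snd z)) (fst z)))"
      unfolding continuous_map_M
    proof (intro conjI ballI)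
      fix i assume i: "i \<in> {1..n}"
      have pq_i: "continuous_on {0..1} (\<lambda>t. p t i)" "continuous_on {0..1} (\<lambda>t. q t i)"
        using p(1) q(1) i by (simp_all add: pathin_M)
      have "continuous_on ({0..1::real} \<times> {0..1}) (\<lambda>z. p (snd z) i)"
        by (rule continuous_on_compose2[OF pq_i(1)]) (auto intro!: continuous_intros)
      moreover have "continuous_on ({0..1::real} \<times> {0..1}) (\<lambda>z. q (snd z) i)"
        by (rule continuous_on_compose2[OF pq_i(2)]) (auto intro!: continuous_intros)
      ultimately
      show "continuous_map (prod_topology (top_of_set {0..1}) (top_of_set {0..1})) euclidean
          (\<lambda>z. flat \<rho> (shift (p (snd z)) (q (snd z)) (fst z)) i)"
        using i by (auto simp: flat_def shift_def Complex_eq intro!: continuous_intros)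
    qed (use flat_stacked stacked_subset[OF \<rho>] in auto)
  qed (auto simp: shift_def pq algebra_simps)
  then have "path_class M (?E p) = path_class M (?E q)" by (rule path_class_eq)
  then show ?thesis by (simp add: square[OF p] square[OF q] pq)
qed

subsection \<open>Canonical classes\<close>

text \<open>The choice is harmless: \<open>stacked_joinable\<close> provides a path and
  \<open>stacked_path_class\<close> makes its class independent of it.\<close>

definition canon :: "(nat \<Rightarrow> real) \<Rightarrow> (nat \<Rightarrow> complex) \<Rightarrow> (nat \<Rightarrow> complex) \<Rightarrow> (real \<Rightarrow> nat \<Rightarrow> complex) set" where
  "canon \<rho> x y = path_class M (SOME p. pathin M p \<and> p ` {0..1} \<subseteq> stacked \<rho> \<and> p 0 = x \<and> p 1 = y)"

lemma path_class_canon: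
  assumes "inj_on \<rho> {1..N}" "pathin M p" "p ` {0..1} \<subseteq> stacked \<rho>"
  shows "path_class M p = canon \<rho> (p 0) (p 1)"
proof -
  let ?q = "SOME q. pathin M q \<and> q ` {0..1} \<subseteq> stacked \<rho> \<and> q 0 = p 0 \<and> q 1 = p 1"
  have "pathin M ?q \<and> ?q ` {0..1} \<subseteq> stacked \<rho> \<and> ?q 0 = p 0 \<and> ?q 1 = p 1"
    by (rule someI[of _ p]) (use assms in simp)
  then show ?thesis
    unfolding canon_def by (intro stacked_path_class[OF assms]) auto
qed

lemma canon_path:
  assumes "inj_on \<rho> {1..N}" "x \<in> stacked \<rho>" "y \<in> stacked \<rho>"
  obtains p where "pathin M p" "p ` {0..1} \<subseteq> stacked \<rho>" "p 0 = x" "p 1 = y" "canon \<rho> x y = path_class M p"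
proof -
  obtain p where p: "pathin M p" "p ` {0..1} \<subseteq> stacked \<rho>" "p 0 = x" "p 1 = y"
    using stacked_joinable[OF assms] unfolding joinable_def by blast
  then show thesis using that path_class_canon[OF assms(1) p(1,2)] by simp
qed

lemma canon_closed:
  assumes "inj_on \<rho> {1..N}" "x \<in> stacked \<rho>" "y \<in> stacked \<rho>"
  shows "canon \<rho> x y \<in> path_classes M x y"
  using canon_path[OF assms] by (metis path_classesI)

lemma canon_comp:
  assumes \<rho>: "inj_on \<rho> {1..N}" and "x \<in> stacked \<rho>" "y \<in> stacked \<rho>" "z \<in> stacked \<rho>"
  shows "class_comp M (canon \<rho> x y) (canon \<rho> y z) = canon \<rho> x z"
proof -
  obtain p where p: "pathin M p" "p ` {0..1} \<subseteq> stacked \<rho>" "p 0 = x" "p 1 = y" "canon \<rho> x y = path_class M p"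
    using canon_path assms by metis
  obtain q where q: "pathin M q" "q ` {0..1} \<subseteq> stacked \<rho>" "q 0 = y" "q 1 = z" "canon \<rho> y z = path_class M q"
    using canon_path assms by metis
  show ?thesis
    using p q path_class_canon[OF \<rho>, of "path_join p q"]
    by (simp add: class_comp_class pathin_path_join path_join_image)
qed

lemma canon_self:
  assumes "inj_on \<rho> {1..N}" "x \<in> stacked \<rho>"
  shows "canon \<rho> x x = class_one M x"
proof -
  have "x \<in> topspace M" using assms stacked_subset by blast
  then show ?thesis
    using path_class_canon[OF assms(1), of "\<lambda>_. x"] assms(2)
    by (simp add: class_one_def pathin_const image_subset_iff)
qed

lemma canon_inv:
  assumes \<rho>: "inj_on \<rho> {1..N}" and "x \<in> stacked \<rho>" "y \<in> stacked \<rho>"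
  shows "class_inv M (canon \<rho> x y) = canon \<rho> y x"
proof -
  obtain p where p: "pathin M p" "p ` {0..1} \<subseteq> stacked \<rho>" "p 0 = x" "p 1 = y" "canon \<rho> x y = path_class M p"
    using canon_path assms by metis
  show ?thesis
    using p path_class_canon[OF \<rho>, of "path_rev p"] by (simp add: class_inv_class pathin_rev)
qed

text \<open>Along the order-preserving path of \<open>stacked_joinable\<close> for
  \<open>\<rho>\<close>, a pair on which the rankings disagree never shares a real part. The path is
  therefore stacked for \<open>\<rho>'\<close> as well and computes both classes.\<close>

lemma canon_agree:
  assumes \<rho>: "inj_on \<rho> {1..N}" and \<rho>': "inj_on \<rho>' {1..N}" and "x \<in> stacked \<rho>" "y \<in> stacked \<rho>"
    and sep: "\<And>i j. \<lbrakk>i \<in> {1..N}; j \<in> {1..N}; \<rho> j < \<rho> i; \<rho>' i < \<rho>' j\<rbrakk> \<Longrightarrow>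
      Re (full x i) < Re (full x j) \<and> Re (full y i) < Re (full y j) \<or>
      Re (full x j) < Re (full x i) \<and> Re (full y j) < Re (full y i)"
  shows "canon \<rho> x y = canon \<rho>' x y"
proof -
  obtain p where p: "pathin M p" "p 0 = x" "p 1 = y" and im: "p ` {0..1} \<subseteq> {c \<in> stacked \<rho>.
      \<forall>i\<in>{1..N}. \<forall>j\<in>{1..N}. Re (full x i) < Re (full x j) \<and>
      Re (full y i) < Re (full y j) \<longrightarrow> Re (full c i) < Re (full c j)}"
    using stacked_joinable[OF \<rho> assms(3,4)] unfolding joinable_def by blast
  have im1: "p ` {0..1} \<subseteq> stacked \<rho>" using im by blast
  have "p t \<in> stacked \<rho>'" if t: "t \<in> {0..1}" for t
  proof -
    have st: "p t \<in> stacked \<rho>" using im t by blast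
    have ord: "Re (full (p t) i) < Re (full (p t) j)"
      if "i \<in> {1..N}" "j \<in> {1..N}" "Re (full x i) < Re (full x j)" "Re (full y i) < Re (full y j)" for i j
      using im t that by blast
    have "Im (full (p t) j) < Im (full (p t) i)"
      if ij: "i \<in> {1..N}" "j \<in> {1..N}" "\<rho>' j < \<rho>' i" "Re (full (p t) i) = Re (full (p t) j)" for i j
    proof -
      have "\<rho> i \<noteq> \<rho> j" using \<rho> ij by (metis inj_onD less_irrefl)
      moreover have "\<not> \<rho> i < \<rho> j" using sep[of j i] ord[of i j] ord[of j i] ij by auto
      ultimately show ?thesis using st ij by (auto simp: stacked_def)
    qed
    then show ?thesis using st by (auto simp: stacked_def)
  qed
  then have "p ` {0..1} \<subseteq> stacked \<rho>'" by blast
  then show ?thesis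
    using path_class_canon[OF \<rho> p(1) im1] path_class_canon[OF \<rho>' p(1)] p(2,3) by simp
qed

text \<open>Smaller indices rank higher, but \<open>j\<close> ranks just above \<open>l\<close>; hence the doubling.\<close>

definition prio :: "nat \<Rightarrow> nat \<Rightarrow> nat \<Rightarrow> real" where
  "prio j l x = of_int (if x = j then 1 - 2 * int l else - 2 * int x)"

lemma inj_prio [simp]: "inj_on (prio j l) A"
  by (rule inj_onI) (auto simp: prio_def split: if_splits, presburger+)

text \<open>The value of \<open>j\<close> drops from \<open>1 - 2 * l\<close> to
  \<open>-1 - 2 * l\<close> and passes only the value \<open>-2 * l\<close> of
  \<open>l\<close>.\<close>

lemma prio_Suc_disagree:
  assumes "prio j l v < prio j l u" "prio j (Suc l) u < prio j (Suc l) v"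
  shows "u = j \<and> v = l"
  using assms by (auto simp: prio_def split: if_splits)

text \<open>The odd value \<open>1 - 2 * j\<close> lies between the values of \<open>j - 1\<close>
  and \<open>j\<close> in the natural ranking. The latter is written \<open>prio 0 0\<close>: the
  displaced index 0 names no point.\<close>

lemma prio_self_agree:
  assumes "prio j j v < prio j j u" "u > 0" "v > 0"
  shows "prio 0 0 v < prio 0 0 u"
  using assms by (auto simp: prio_def split: if_splits)

lemma canon_prio_self:
  assumes "x \<in> generic" "y \<in> generic"
  shows "canon (prio j j) x y = canon (prio 0 0) x y"
proof (rule canon_agree)
  fix i l assume "i \<in> {1..N}" "l \<in> {1..N}" "prio j j l < prio j j i" "prio 0 0 i < prio 0 0 l"
  then show "Re (full x i) < Re (full x l) \<and> Re (full y i) < Re (full y l) \<or>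
      Re (full x l) < Re (full x i) \<and> Re (full y l) < Re (full y i)"
    using prio_self_agree[of j l i] by auto
qed (use assms generic_stacked in auto)

lemma canon_prio_Suc:
  assumes "x \<in> generic" "y \<in> generic"
    and "Re (full x l) < Re (full x j) \<and> Re (full y l) < Re (full y j) \<or>
      Re (full x j) < Re (full x l) \<and> Re (full y j) < Re (full y l)"
  shows "canon (prio j l) x y = canon (prio j (Suc l)) x y"
proof (rule canon_agree)
  fix u v assume "prio j l v < prio j l u" "prio j (Suc l) u < prio j (Suc l) v"
  then show "Re (full x u) < Re (full x v) \<and> Re (full y u) < Re (full y v) \<or>
      Re (full x v) < Re (full x u) \<and> Re (full y v) < Re (full y u)"
    using prio_Suc_disagree[of j l v u] assms(3) by auto
qed (use assms generic_stacked in auto)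

lemma canon_prio_closed: "x \<in> generic \<Longrightarrow> y \<in> generic \<Longrightarrow> canon (prio j l) x y \<in> path_classes M x y"
  using generic_stacked by (intro canon_closed) auto

lemma canon_prio_comp:
  "x \<in> generic \<Longrightarrow> y \<in> generic \<Longrightarrow> z \<in> generic \<Longrightarrow>
    class_comp M (canon (prio j l) x y) (canon (prio j l) y z) = canon (prio j l) x z"
  using generic_stacked by (intro canon_comp) auto

lemma canon_prio_comp_assoc:
  "x \<in> generic \<Longrightarrow> y \<in> generic \<Longrightarrow> z \<in> generic \<Longrightarrow>
    class_comp M (canon (prio j l) x y) (class_comp M (canon (prio j l) y z) A) = class_comp M (canon (prio j l) x z) A"
  by (simp add: canon_prio_comp flip: class_comp_assoc)

lemma canon_prio_inv:
  "x \<in> generic \<Longrightarrow> y \<in> generic \<Longrightarrow> class_inv M (canon (prio j l) x y) = canon (prio j l) y x"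
  using generic_stacked by (intro canon_inv) auto

lemma canon_prio_one: "x \<in> generic \<Longrightarrow> canon (prio j l) x x = class_one M x"
  using generic_stacked by (intro canon_self) auto

text \<open>For \<open>i < j\<close> and any generic \<open>x\<close> in which \<open>j\<close> is to the left of \<open>i\<close>: points \<open>i\<close> and \<open>j\<close> change sides
  with \<open>j\<close> above \<open>i\<close> and change back with \<open>i\<close> above \<open>j\<close>, while the points in between stay below both.\<close>

definition twist :: "nat \<Rightarrow> nat \<Rightarrow> (nat \<Rightarrow> complex) \<Rightarrow> (real \<Rightarrow> nat \<Rightarrow> complex) set" where
  "twist i j x = class_comp M (canon (prio j i) base x) (canon (prio j (Suc i)) x base)"

lemma twist_closed: "x \<in> generic \<Longrightarrow> twist i j x \<in> path_classes M base base"
  unfolding twist_def using base_generic by (blast intro: canon_prio_closed class_comp_closed)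

text \<open>Between two such configurations \<open>i\<close> and \<open>j\<close> do not change
  sides, so the connecting canonical classes of both rankings agree and cancel in the middle of the
  loop.\<close>

lemma twist_indep:
  assumes "x \<in> generic" "y \<in> generic" "Re (full x j) < Re (full x i)" "Re (full y j) < Re (full y i)"
  shows "twist i j x = twist i j y"
proof -
  have "canon (prio j i) base x = class_comp M (canon (prio j i) base y) (canon (prio j i) y x)"
    using assms base_generic by (simp add: canon_prio_comp)
  moreover have "canon (prio j i) y x = canon (prio j (Suc i)) y x"
    by (rule canon_prio_Suc) (use assms in auto)
  ultimately show ?thesis
    using assms base_generic by (simp add: twist_def class_comp_assoc canon_prio_comp)
qed

definition twists :: "(real \<Rightarrow> nat \<Rightarrow> complex) set set" where
  "twists = {twist i j x | i j x. i \<in> {1..n} \<and> i < j \<and> j \<le> N \<and> x \<in> generic \<and> Re (full x j) < Re (full x i)}"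

lemma twistsI:
  "\<lbrakk>i \<in> {1..n}; i < j; j \<le> N; x \<in> generic; Re (full x j) < Re (full x i)\<rbrakk> \<Longrightarrow> twist i j x \<in> twists"
  unfolding twists_def by blast

section \<open>The subgroup generated by the twists\<close>

abbreviation G where "G \<equiv> fundamental_group M base"

lemma base_topspace: "base \<in> topspace M"
  using base_generic generic_subset by blast

lemma group_G: "group G"
  using base_topspace by (rule group_fundamental_group)

abbreviation H where "H \<equiv> generate G twists"

lemma twists_subset: "twists \<subseteq> carrier G"
  using twist_closed by (auto simp: twists_def carrier_fundamental_group)

lemma H_subset: "H \<subseteq> path_classes M base base"
  using group.generate_incl[OF group_G twists_subset] by (simp add: carrier_fundamental_group)

lemma H_comp: "A \<in> H \<Longrightarrow> B \<in> H \<Longrightarrow> class_comp M A B \<in> H"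
  using generate.eng[of A G twists B] H_subset by (auto simp: mult_fundamental_group subset_iff)

lemma H_one: "class_one M base \<in> H"
  using generate.one[of G twists] base_topspace by (simp add: one_fundamental_group)

lemma H_inv: "A \<in> H \<Longrightarrow> class_inv M A \<in> H"
  using group.generate_m_inv_closed[OF group_G twists_subset] H_subset base_topspace
  by (metis inv_fundamental_group subsetD)

text \<open>Descending induction from \<open>l = j\<close>, where the ranking is the natural one.
  Raising \<open>j\<close> above one more point \<open>l\<close> multiplies the comparison loop by
  \<open>twist l j x\<close>, which is trivial if \<open>l\<close> and \<open>j\<close> stand in
  \<open>x\<close> as in the base point.\<close>

lemma canon_prio_H:
  assumes "x \<in> generic" "1 \<le> l" "l \<le> j" "j \<le> N"
  shows "class_comp M (canon (prio j l) base x) (canon (prio 0 0) x base) \<in> H"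
  using assms(3,2)
proof (induction l rule: inc_induct)
  case base
  have "canon (prio j j) base x = canon (prio 0 0) base x"
    using assms base_generic by (intro canon_prio_self) auto
  then show ?case
    using assms base_generic H_one by (simp add: canon_prio_comp canon_prio_one)
next
  case (step l)
  have lj: "l < j" using step by simp
  have b: "base_conf n a \<in> generic" by (rule base_generic)
  \<comment> \<open>The class for \<open>Suc l\<close> is inserted back to the base point and out
    again; its first half completes the twist.\<close>
  have "class_comp M (canon (prio j l) (base_conf n a) x) (canon (prio 0 0) x (base_conf n a))
      = class_comp M (twist l j x) (class_comp M (canon (prio j (Suc l)) (base_conf n a) x) (canon (prio 0 0) x (base_conf n a)))"
    unfolding twist_def class_comp_assoc
    using assms(1) b class_comp_one[OF canon_prio_closed[OF assms(1) b, of 0 0]]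
    by (simp add: canon_prio_comp_assoc canon_prio_one)
  moreover have "twist l j x \<in> H"
  proof (cases "Re (full x l) < Re (full x j)")
    case True
    have "canon (prio j l) (base_conf n a) x = canon (prio j (Suc l)) (base_conf n a) x"
      by (rule canon_prio_Suc) (use True b assms step a_less[of l j] in auto)
    then show ?thesis using assms(1) b H_one by (simp add: twist_def canon_prio_comp canon_prio_one)
  next
    case False
    then have "Re (full x j) < Re (full x l)"
    proof -
      have "inj_on (\<lambda>l. Re (full x l)) {1..N}" using assms(1) by (simp add: generic_def)
      then have "Re (full x l) \<noteq> Re (full x j)"
        using inj_onD[of "\<lambda>l. Re (full x l)" "{1..N}" l j] step(1,4) lj assms(4) by auto
      then show ?thesis using False by linarith
    qed
    \<comment> \<open>If \<open>l\<close> were fixed, the larger index \<open>j\<close> would be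
      fixed too, and the two could not have changed sides.\<close>
    moreover from this have "l \<le> n"
      using assms step lj a_less[of l j] by (cases "l \<le> n") auto
    ultimately have "twist l j x \<in> twists"
      using assms step lj by (intro twistsI) auto
    then show ?thesis by (rule generate.incl)
  qed
  ultimately show ?case using H_comp step by auto
qed

text \<open>The class is closed to a loop by canonical classes of the natural ranking. A class
  determines its end points, so at most one instance of the quantifiers matters.\<close>

definition tame :: "(real \<Rightarrow> nat \<Rightarrow> complex) set \<Rightarrow> bool" where
  "tame A \<longleftrightarrow> (\<forall>x\<in>generic. \<forall>y\<in>generic. A \<in> path_classes M x y \<longrightarrow>
     class_comp M (canon (prio 0 0) base x) (class_comp M A (canon (prio 0 0) y base)) \<in> H)"

lemma tame_comp:
  assumes "tame A" "tame B" "A \<in> path_classes M x y" "B \<in> path_classes M y z"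
    "x \<in> generic" "y \<in> generic" "z \<in> generic"
  shows "tame (class_comp M A B)"
proof -
  have "class_comp M A B \<in> path_classes M x z" using assms by blast
  then have "x' = x" "z' = z" if "class_comp M A B \<in> path_classes M x' z'" for x' z'
    using that path_classes_ends by metis+
  moreover have "class_comp M (canon (prio 0 0) base x) (class_comp M (class_comp M A B) (canon (prio 0 0) z base)) \<in> H"
  proof -
    have "class_comp M (class_comp M (canon (prio 0 0) base x) (class_comp M A (canon (prio 0 0) y base)))
        (class_comp M (canon (prio 0 0) base y) (class_comp M B (canon (prio 0 0) z base))) \<in> H"
      by (rule H_comp) (use assms in \<open>simp_all add: tame_def\<close>)
    moreover have "class_comp M (canon (prio 0 0) y base) (class_comp M (canon (prio 0 0) base y) C) = C"
      if "C \<in> path_classes M y w" for C w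
      using that assms base_generic by (simp add: canon_prio_comp_assoc canon_prio_one)
    moreover have "class_comp M B (canon (prio 0 0) z base) \<in> path_classes M y base"
      using assms base_generic canon_prio_closed by blast
    ultimately show ?thesis by (simp add: class_comp_assoc)
  qed
  ultimately show ?thesis unfolding tame_def by blast
qed

text \<open>The case \<open>l = j\<close> is the natural order, \<open>l = 1\<close> has
  \<open>j\<close> on top of all others.\<close>

definition regions :: "(nat \<Rightarrow> complex) set set" where
  "regions = {stacked (prio j l) | j l. 1 \<le> l \<and> l \<le> j \<and> j \<le> N}"

text \<open>Inside one region the class factors through the base point by canonical classes of that
  ranking. Each factor differs from the one of the natural ranking by a loop as in
  \<open>canon_prio_H\<close> or its inverse.\<close>

lemma tame_region:
  assumes "D \<in> regions" "pathin M c" "c ` {0..1} \<subseteq> D" "c 0 \<in> generic" "c 1 \<in> generic"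
  shows "tame (path_class M c)"
proof -
  obtain j l where jl: "D = stacked (prio j l)" "1 \<le> l" "l \<le> j" "j \<le> N"
    using assms(1) by (auto simp: regions_def)
  let ?x = "c 0" and ?y = "c 1"
  have "path_class M c = canon (prio j l) ?x ?y"
    using assms jl by (intro path_class_canon) auto
  also have "\<dots> = class_comp M (canon (prio j l) ?x base) (canon (prio j l) base ?y)"
    using assms base_generic by (simp add: canon_prio_comp)
  finally have "class_comp M (canon (prio 0 0) base ?x) (class_comp M (path_class M c) (canon (prio 0 0) ?y base))
    = class_comp M (class_comp M (canon (prio 0 0) base ?x) (canon (prio j l) ?x base))
        (class_comp M (canon (prio j l) base ?y) (canon (prio 0 0) ?y base))"
    by (simp add: class_comp_assoc)
  moreover have "class_comp M (canon (prio 0 0) base ?x) (canon (prio j l) ?x base) \<in> H"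
  proof -
    have K: "class_comp M (canon (prio j l) base ?x) (canon (prio 0 0) ?x base) \<in> H" (is "?K \<in> H")
      using canon_prio_H assms jl by simp
    have "class_comp M (class_comp M (canon (prio 0 0) base ?x) (canon (prio j l) ?x base)) ?K = class_one M base"
      using assms base_generic class_comp_one[OF canon_prio_closed[OF assms(4) base_generic, of 0 0]]
      by (simp add: class_comp_assoc canon_prio_comp_assoc canon_prio_one canon_prio_comp)
    moreover have mem: "?K \<in> path_classes M base base" "class_comp M (canon (prio 0 0) base ?x) (canon (prio j l) ?x base) \<in> path_classes M base base"
      using assms base_generic canon_prio_closed by blast+
    ultimately have "class_inv M ?K = class_comp M (canon (prio 0 0) base ?x) (canon (prio j l) ?x base)"
      using group.inv_equality[OF group_G] base_topspace
      by (simp add: carrier_fundamental_group mult_fundamental_group one_fundamental_group flip: inv_fundamental_group)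
    then show ?thesis using H_inv[OF K] by simp
  qed
  moreover have "class_comp M (canon (prio j l) base ?y) (canon (prio 0 0) ?y base) \<in> H"
    using canon_prio_H assms jl by simp
  ultimately have *: "class_comp M (canon (prio 0 0) base ?x) (class_comp M (path_class M c) (canon (prio 0 0) ?y base)) \<in> H"
    using H_comp by simp
  have "path_class M c \<in> path_classes M ?x ?y" using assms by blast
  then have "x' = ?x" "y' = ?y" if "path_class M c \<in> path_classes M x' y'" for x' y'
    using that path_classes_ends by metis+
  then show ?thesis using * unfolding tame_def by blast
qed

subsection \<open>Boxes\<close>

definition polydisc :: "(nat \<Rightarrow> complex) \<Rightarrow> real \<Rightarrow> (nat \<Rightarrow> complex) set" where
  "polydisc x \<epsilon> = PiE {1..n} (\<lambda>i. ball (x i) \<epsilon>)"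

lemma polydisc_iff: "y \<in> polydisc x \<epsilon> \<longleftrightarrow> y \<in> extensional {1..n} \<and> (\<forall>i\<in>{1..n}. dist (y i) (x i) < \<epsilon>)"
  by (auto simp: polydisc_def PiE_iff dist_commute)

lemma open_contains_polydisc:
  assumes "openin M S" "x \<in> S"
  obtains \<epsilon> where "\<epsilon> > 0" "polydisc x \<epsilon> \<subseteq> S"
proof -
  have "open (- (complex_of_real \<circ> a) ` {n+1..N})" by (simp add: finite_imp_closed open_Compl)
  from open_contains_product_box[OF _ this continuous_on_id _ assms(1)[unfolded punctured_conf_def pconf_def] assms(2)]
  obtain V where V: "\<And>i. i \<in> {1..n} \<Longrightarrow> open (V i)" "\<And>i. i \<in> {1..n} \<Longrightarrow> x i \<in> V i" "PiE {1..n} V \<subseteq> S"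
    by auto
  then have "\<exists>e>0. ball (x i) e \<subseteq> V i" if "i \<in> {1..n}" for i
    using that by (meson open_contains_ball)
  then obtain e where e: "\<And>i. i \<in> {1..n} \<Longrightarrow> e i > 0 \<and> ball (x i) (e i) \<subseteq> V i"
    by metis
  then obtain \<epsilon> where \<epsilon>: "\<epsilon> > 0" "\<And>v. v \<in> e ` {1..n} \<Longrightarrow> \<epsilon> \<le> v"
    by (rule_tac finite_positive_bound[of "e ` {1..n}"]) auto
  have "ball (x i) \<epsilon> \<subseteq> V i" if "i \<in> {1..n}" for i
    using e[OF that] \<epsilon>(2)[OF imageI[OF that]] by (auto simp: subset_iff)
  then have "polydisc x \<epsilon> \<subseteq> S" using V(3) PiE_mono[of "{1..n}" "\<lambda>i. ball (x i) \<epsilon>" V] by (auto simp: polydisc_def)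
  then show thesis using that \<epsilon>(1) by blast
qed

lemma openin_polydisc:
  assumes "polydisc x \<epsilon> \<subseteq> topspace M"
  shows "openin M (polydisc x \<epsilon>)"
  using assms unfolding polydisc_def punctured_conf_def pconf_def by (intro openin_product_box) auto

lemma polydisc_path_class:
  assumes "polydisc x \<epsilon> \<subseteq> topspace M" "pathin M c" "c ` {0..1} \<subseteq> polydisc x \<epsilon>"
    "pathin M d" "d ` {0..1} \<subseteq> polydisc x \<epsilon>" "c 0 = d 0" "c 1 = d 1"
  shows "path_class M c = path_class M d"
proof -
  have "path_homotopic M (id \<circ> c) (id \<circ> d)"
  proof (rule path_homotopic_convex_box)
    show "continuous_map (subtopology (product_topology (\<lambda>_. euclidean) {1..n}) (PiE {1..n} (\<lambda>i. ball (x i) \<epsilon>))) M id"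
      unfolding continuous_map_M using assms(1)
      by (auto simp: polydisc_def simp del: One_nat_def
        intro!: continuous_map_from_subtopology continuous_map_product_projection)
  qed (use assms in \<open>simp_all add: pathin_M image_subset_iff_funcset polydisc_def\<close>)
  then show ?thesis by (simp add: path_class_eq)
qed
text \<open>Moving point \<open>i\<close> to the right with speed \<open>i\<close> makes real parts coincide only at finitely many times.\<close>

lemma joinable_generic:
  assumes "openin M S" "x \<in> S" "finite F"
  obtains u where "u \<in> generic" "joinable M S x u" "\<And>i. i \<in> {1..n} \<Longrightarrow> Re (u i) \<notin> F"
proof -
  obtain \<epsilon> where \<epsilon>: "\<epsilon> > 0" "polydisc x \<epsilon> \<subseteq> S" using open_contains_polydisc assms by blast
  have S: "S \<subseteq> topspace M" using assms(1) by (rule openin_subset)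
  then have x: "x \<in> extensional {1..n}" using assms(2) by (auto simp: topspace_M)
  define p where "p \<tau> = (\<lambda>i\<in>{1..n}. x i + of_real (\<tau> * real i))" for \<tau>
  let ?F = "F \<union> a ` {n+1..N}"
  \<comment> \<open>The bad times: point \<open>i\<close> reaches a value of \<open>F\<close> or a
    fixed abscissa, or points \<open>i\<close> and \<open>j\<close> get the same real part. The
    pairs \<open>i = j\<close> only contribute the time 0.\<close>
  let ?B = "(\<lambda>(i, f). (f - Re (x i)) / real i) ` ({1..n} \<times> ?F) \<union>
    (\<lambda>(i, j). (Re (x j) - Re (x i)) / (real i - real j)) ` ({1..n} \<times> {1..n})"
  \<comment> \<open>The speeds are at most \<open>n\<close>, so until time
    \<open>\<epsilon> / (n + 1)\<close> no point moves by \<open>\<epsilon>\<close>.\<close>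
  have "infinite ({0<..<\<epsilon> / (n + 1)} - ?B)"
    using \<epsilon>(1) assms(3) by (intro Diff_infinite_finite) auto
  then obtain \<tau> where \<tau>: "\<tau> \<in> {0<..<\<epsilon> / (n + 1)}" "\<tau> \<notin> ?B"
    using infinite_imp_nonempty by blast
  have pS: "p (s * \<tau>) \<in> S" if s: "s \<in> {0..1}" for s
  proof -
    have "\<bar>s * \<tau> * real i\<bar> < \<epsilon>" if "i \<in> {1..n}" for i
    proof -
      have "s * \<tau> * real i \<le> 1 * \<tau> * real (n + 1)"
        using s \<tau>(1) that by (intro mult_mono) auto
      also have "\<dots> < \<epsilon>" using \<tau>(1) by (simp add: pos_less_divide_eq)
      finally show ?thesis using s \<tau>(1) by simp
    qed
    then have "dist (p (s * \<tau>) i) (x i) < \<epsilon>" if "i \<in> {1..n}" for i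
      using that by (simp add: p_def dist_norm del: of_real_mult)
    then have "p (s * \<tau>) \<in> polydisc x \<epsilon>" by (auto simp: polydisc_iff p_def)
    then show ?thesis using \<epsilon> by blast
  qed
  have notF: "Re (p \<tau> i) \<notin> ?F" if i: "i \<in> {1..n}" for i
  proof
    assume F: "Re (p \<tau> i) \<in> ?F"
    have "(Re (p \<tau> i) - Re (x i)) / real i = \<tau>" using i by (simp add: p_def)
    moreover have "(Re (p \<tau> i) - Re (x i)) / real i \<in> ?B"
      using F i by (intro UnI1 image_eqI[where x = "(i, Re (p \<tau> i))"]) auto
    ultimately have "\<tau> \<in> ?B" by simp
    then show False using \<tau>(2) by blast
  qed
  have neq: "Re (p \<tau> i) \<noteq> Re (p \<tau> j)" if ij: "i \<in> {1..n}" "j \<in> {1..n}" "i \<noteq> j" for i j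
  proof
    assume "Re (p \<tau> i) = Re (p \<tau> j)"
    then have "\<tau> * (real i - real j) = Re (x j) - Re (x i)" using ij by (simp add: p_def algebra_simps)
    then have "(Re (x j) - Re (x i)) / (real i - real j) = \<tau>" using ij(3) by (simp add: field_simps)
    moreover have "(Re (x j) - Re (x i)) / (real i - real j) \<in> ?B"
      using ij by (intro UnI2 image_eqI[where x = "(i, j)"]) auto
    ultimately have "\<tau> \<in> ?B" by simp
    then show False using \<tau>(2) by blast
  qed
  have gen: "p \<tau> \<in> generic"
  proof -
    have "Re (full (p \<tau>) i) \<noteq> Re (full (p \<tau>) j)" if ij: "i \<in> {1..N}" "j \<in> {1..N}" "i < j" for i j
    proof (cases "i \<le> n")
      case i: True
      show ?thesis
      proof (cases "j \<le> n")
        case True then show ?thesis using neq[of i j] ij by auto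
      next
        case False then show ?thesis using notF[of i] i ij by auto
      qed
    next
      case False then show ?thesis using a_less[of i j] ij by auto
    qed
    then have "inj_on (\<lambda>l. Re (full (p \<tau>) l)) {1..N}" by (metis (no_types, lifting) linorder_inj_onI')
    then show ?thesis by (simp add: generic_def p_def)
  qed
  have "joinable M S x (p \<tau>)"
    unfolding joinable_def
  proof (intro exI[of _ "\<lambda>s. p (s * \<tau>)"] conjI)
    have im: "(\<lambda>s. p (s * \<tau>)) ` {0..1} \<subseteq> S" using pS by blast
    then show "pathin M (\<lambda>s. p (s * \<tau>))"
      unfolding pathin_M using S by (auto simp: p_def intro!: continuous_intros)
    show "(\<lambda>s. p (s * \<tau>)) ` {0..1} \<subseteq> S" by (fact im)
    show "p (0 * \<tau>) = x" using x by (auto simp: p_def fun_eq_iff extensional_def)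
  qed simp
  then show thesis using that gen notF by blast
qed

text \<open>Every coincidence of real parts involves \<open>i\<close>, and the remaining real parts
  are distinct, so at most one pair coincides. If its upper point has the smaller index, the natural
  ranking fits; otherwise the upper index is displaced to just above the lower one.\<close>

lemma one_coincidence_region:
  assumes c: "c \<in> topspace M" and i: "i \<in> {1..n}" and inj: "inj_on (\<lambda>l. Re (full c l)) ({1..N} - {i})"
  shows "c \<in> \<Union>regions"
proof (cases "c \<in> generic")
  case True
  then have "c \<in> stacked (prio i i)" using generic_stacked by blast
  moreover have "stacked (prio i i) \<in> regions" using i unfolding regions_def by fastforce
  ultimately show ?thesis by blast
next
  case False
  have ext: "c \<in> extensional {1..n}" and full: "inj_on (full c) {1..N}" using c by (auto simp: topspace_M)
  have "\<exists>l\<in>{1..N}. l \<noteq> i \<and> Re (full c l) = Re (full c i)"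
  proof (rule ccontr)
    assume *: "\<not> ?thesis"
    have "inj_on (\<lambda>l. Re (full c l)) (insert i ({1..N} - {i}))"
      using inj * by (subst inj_on_insert) auto
    moreover have "insert i ({1..N} - {i}) = {1..N}" using i by auto
    ultimately show False using False ext by (simp add: generic_def)
  qed
  then obtain l where l: "l \<in> {1..N}" "l \<noteq> i" "Re (full c l) = Re (full c i)" by blast
  have pair: "{u, v} = {i, l}" if uv: "u \<in> {1..N}" "v \<in> {1..N}" "u \<noteq> v" "Re (full c u) = Re (full c v)" for u v
  proof -
    have inj': "u' = v'" if "u' \<in> {1..N}" "v' \<in> {1..N}" "u' \<noteq> i" "v' \<noteq> i" "Re (full c u') = Re (full c v')" for u' v'
      by (rule inj_onD[OF inj]) (use that in auto)
    consider "u = i" | "v = i" using inj'[of u v] uv by blast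
    then show ?thesis
    proof cases
      case 1
      then have "v \<noteq> i" "Re (full c v) = Re (full c l)" using uv(3,4) l(3) by metis+
      then have "v = l" using inj' uv(2) l(1,2) by metis
      with 1 show ?thesis by simp
    next
      case 2
      then have "u \<noteq> i" "Re (full c u) = Re (full c l)" using uv(3,4) l(3) by metis+
      then have "u = l" using inj' uv(1) l(1,2) by metis
      with 2 show ?thesis by auto
    qed
  qed
  have "Im (full c l) \<noteq> Im (full c i)"
    using inj_onD[OF full, of l i] l i by (auto simp: complex_eq_iff)
  obtain hi lo where hl: "{hi, lo} = {i, l}" "Im (full c lo) < Im (full c hi)"
  proof (cases "Im (full c l) < Im (full c i)")
    case True then show thesis using that[of i l] by simp
  next
    case False
    with \<open>Im (full c l) \<noteq> Im (full c i)\<close> show thesis using that[of l i] by (simp add: insert_commute)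
  qed
  then have hl': "hi \<in> {1..N}" "lo \<in> {1..N}" "hi \<noteq> lo" using l i by (auto simp: doubleton_eq_iff)
  have st: "c \<in> stacked \<rho>" if "\<rho> lo < \<rho> hi" for \<rho> :: "nat \<Rightarrow> real"
  proof -
    have "Im (full c v) < Im (full c u)"
      if uv: "u \<in> {1..N}" "v \<in> {1..N}" "\<rho> v < \<rho> u" "Re (full c u) = Re (full c v)" for u v
    proof -
      have "{u, v} = {hi, lo}" using pair[of u v] uv hl by auto
      then have "u = hi \<and> v = lo" using \<open>\<rho> lo < \<rho> hi\<close> uv(3) by (auto simp: doubleton_eq_iff)
      then show ?thesis using hl by simp
    qed
    then show ?thesis using ext by (auto simp: stacked_def)
  qed
  show ?thesis
  proof (cases "hi < lo")
    case True
    then have "c \<in> stacked (prio lo lo)" by (intro st) (simp add: prio_def)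
    moreover have "stacked (prio lo lo) \<in> regions" using hl' unfolding regions_def by fastforce
    ultimately show ?thesis by blast
  next
    case False
    then have "c \<in> stacked (prio hi lo)" using hl' by (intro st) (simp add: prio_def)
    moreover have "stacked (prio hi lo) \<in> regions" using hl' False unfolding regions_def by fastforce
    ultimately show ?thesis by blast
  qed
qed

text \<open>The coordinates of \<open>u\<close> are replaced by those of \<open>v\<close> one after
  the other. The hypothesis on real parts makes every intermediate configuration generic, so during
  a move only the moving point can coincide with another one in real part.\<close>

lemma joinable_coordinatewise:
  assumes n: "n > 0" and D: "polydisc x \<epsilon> \<subseteq> topspace M"
    and u: "u \<in> generic" "u \<in> polydisc x \<epsilon>" and v: "v \<in> generic" "v \<in> polydisc x \<epsilon>"
    and uv: "\<And>i l. \<lbrakk>i \<in> {1..n}; l \<in> {1..n}; i \<noteq> l\<rbrakk> \<Longrightarrow> Re (u i) \<noteq> Re (v l)"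
  shows "joinable M (polydisc x \<epsilon> \<inter> \<Union>regions) u v"
proof -
  let ?D = "polydisc x \<epsilon>"
  define w where "w s = (\<lambda>i\<in>{1..n}. if i \<le> s then v i else u i)" for s
  have ext: "u \<in> extensional {1..n}" "v \<in> extensional {1..n}" using u v by (auto simp: generic_def)
  have inj: "inj_on (\<lambda>l. Re (full u l)) {1..N}" "inj_on (\<lambda>l. Re (full v l)) {1..N}"
    using u v by (auto simp: generic_def)
  have full_w: "full (w s) l = (if l \<le> s then full v l else full u l)" if "l \<in> {1..N}" for s l
    using that by (rule index_cases) (auto simp: w_def)
  have w_inj: "inj_on (\<lambda>l. Re (full (w s) l)) {1..N}" for s
  proof (rule linorder_inj_onI')
    fix i l assume il: "i \<in> {1..N}" "l \<in> {1..N}" "i < l"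
    consider "l \<le> s" | "s < i" | "i \<le> s" "s < l" "l \<le> n" | "i \<le> s" "s < l" "n < l" by linarith
    then show "Re (full (w s) i) \<noteq> Re (full (w s) l)"
    proof cases
      case 1 then show ?thesis using inj_onD[OF inj(2), of i l] il by (auto simp: full_w)
    next
      case 2 then show ?thesis using inj_onD[OF inj(1), of i l] il by (auto simp: full_w)
    next
      case 3 then show ?thesis using uv[of l i] il by (auto simp: w_def)
    next
      case 4
      \<comment> \<open>The fixed point is common to \<open>u\<close> and \<open>v\<close>, so
        genericity of \<open>v\<close> alone separates it from point \<open>i\<close>.\<close>
      then have "full u l = full v l" using il by simp
      then show ?thesis using 4 inj_onD[OF inj(2), of i l] il by (auto simp: full_w)
    qed
  qed
  have w_D: "w s \<in> ?D" for s using u v by (auto simp: polydisc_iff w_def)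
  have "joinable M (?D \<inter> \<Union>regions) u (w s)" if "s \<le> n" for s
    using that
  proof (induction s)
    case 0
    have "w 0 = u" using ext by (auto simp: w_def fun_eq_iff extensional_def)
    moreover have "u \<in> topspace M" using u D by blast
    moreover have "u \<in> \<Union>regions"
      by (rule one_coincidence_region[of u 1]) (use n u D inj in \<open>auto intro: inj_on_subset\<close>)
    ultimately show ?case
      unfolding joinable_def using u by (intro exI[of _ "\<lambda>_. u"]) (simp add: pathin_const image_subset_iff)
  next
    case (Suc s)
    let ?k = "Suc s"
    let ?p = "\<lambda>t. (w s)(?k := linepath (u ?k) (v ?k) t)"
    have k: "?k \<in> {1..n}" using Suc by simp
    have pD: "?p t \<in> ?D" if "t \<in> {0..1}" for t
    proof -
      have "u ?k \<in> ball (x ?k) \<epsilon>" "v ?k \<in> ball (x ?k) \<epsilon>"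
        using u v k by (auto simp: polydisc_iff dist_commute)
      then have "linepath (u ?k) (v ?k) t \<in> ball (x ?k) \<epsilon>"
        using that convex_contains_segment[of "ball (x ?k) \<epsilon>"] linepath_in_path by blast
      then show ?thesis using w_D[of s] k by (auto simp: polydisc_iff dist_commute extensional_def)
    qed
    have pR: "?p t \<in> \<Union>regions" if "t \<in> {0..1}" for t
    proof (rule one_coincidence_region[OF _ k])
      show "?p t \<in> topspace M" using pD[OF that] D by blast
      have "inj_on (\<lambda>l. Re (full (?p t) l)) ({1..N} - {?k}) \<longleftrightarrow> inj_on (\<lambda>l. Re (full (w s) l)) ({1..N} - {?k})"
        by (rule inj_on_cong) (auto simp: add_straight_def)
      then show "inj_on (\<lambda>l. Re (full (?p t) l)) ({1..N} - {?k})"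
        using w_inj[of s] inj_on_subset by blast
    qed
    have "joinable M (?D \<inter> \<Union>regions) (w s) (w ?k)"
      unfolding joinable_def
    proof (intro exI[of _ ?p] conjI)
      show im: "?p ` {0..1} \<subseteq> ?D \<inter> \<Union>regions" using pD pR by blast
      show "pathin M ?p"
        unfolding pathin_M
      proof (intro conjI ballI)
        show "continuous_on {0..1} (\<lambda>t. ?p t i)" for i
          by (cases "i = ?k") (auto intro!: continuous_on_linepath continuous_intros)
      qed (use im D in blast)
      show "?p 0 = w s" "?p 1 = w ?k" using k by (auto simp: w_def fun_eq_iff linepath_def)
    qed
    then show ?case using Suc by (meson Suc_leD joinable_trans)
  qed
  from this[of n] have "joinable M (?D \<inter> \<Union>regions) u (w n)" by simp
  moreover have "w n = v" using ext by (auto simp: w_def fun_eq_iff extensional_def)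
  ultimately show ?thesis by simp
qed

subsection \<open>Generation\<close>

lemma openin_region: "D \<in> regions \<Longrightarrow> openin M D"
  by (auto simp: regions_def intro: openin_stacked)

lemma tame_regions:
  assumes "pathin M c" "c ` {0..1} \<subseteq> \<Union>regions" "c 0 \<in> generic" "c 1 \<in> generic"
  shows "tame (path_class M c)"
proof (rule path_class_local_global[where R = generic and \<D> = regions])
  fix D E x assume DE: "D \<in> regions" "E \<in> regions" "x \<in> D" "x \<in> E"
  show "\<exists>u\<in>generic. joinable M (D \<inter> E) x u"
    by (rule joinable_generic[of "D \<inter> E" x "{}"]) (use DE openin_region in auto)
next
  show "tame (class_comp M A B)" if "tame A" "tame B" "A \<in> path_classes M u v" "B \<in> path_classes M v w"
    "u \<in> generic" "v \<in> generic" "w \<in> generic" for A B u v w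
    using that by (rule tame_comp)
qed (fact assms | rule tame_region openin_region; assumption)+

text \<open>The regions do not cover the configurations with several coincidences, but polydiscs
  cover everything and are simply connected: inside one of them the path may be exchanged for a
  coordinatewise one, to which \<open>tame_regions\<close> applies.\<close>

lemma tame_path:
  assumes n: "n > 0" and "pathin M c" "c 0 \<in> generic" "c 1 \<in> generic"
  shows "tame (path_class M c)"
proof (rule path_class_local_global[where R = generic and \<D> = "{polydisc x \<epsilon> | x \<epsilon>. polydisc x \<epsilon> \<subseteq> topspace M}"])
  fix D c assume "D \<in> {polydisc x \<epsilon> | x \<epsilon>. polydisc x \<epsilon> \<subseteq> topspace M}"
    and c: "pathin M c" "c ` {0..1} \<subseteq> D" "c 0 \<in> generic" "c 1 \<in> generic"
  then obtain x \<epsilon> where D: "D = polydisc x \<epsilon>" "polydisc x \<epsilon> \<subseteq> topspace M" by blast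
  have c01: "c 0 \<in> polydisc x \<epsilon>" "c 1 \<in> polydisc x \<epsilon>" using c(2) D by auto
  \<comment> \<open>A real part occurring in \<open>c 0\<close> may occur at another index of
    \<open>c 1\<close>, which would block a direct coordinatewise passage. The intermediate
    \<open>t\<close> avoids the real parts of both.\<close>
  obtain t where t: "t \<in> generic" "joinable M (polydisc x \<epsilon>) (c 0) t"
    "\<And>i. i \<in> {1..n} \<Longrightarrow> Re (t i) \<notin> (\<lambda>i. Re (c 0 i)) ` {1..n} \<union> (\<lambda>i. Re (c 1 i)) ` {1..n}"
    by (rule joinable_generic[OF openin_polydisc[OF D(2)] c01(1),
        of "(\<lambda>i. Re (c 0 i)) ` {1..n} \<union> (\<lambda>i. Re (c 1 i)) ` {1..n}"]) auto
  have tD: "t \<in> polydisc x \<epsilon>" using t(2) by (rule joinable_mem)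
  have t_ne: "Re (c 0 i) \<noteq> Re (t l)" "Re (c 1 i) \<noteq> Re (t l)" if "i \<in> {1..n}" "l \<in> {1..n}" for i l
    using t(3)[OF that(2)] that(1) by (metis UnI1 UnI2 imageI)+
  have "joinable M (polydisc x \<epsilon> \<inter> \<Union>regions) (c 0) t" "joinable M (polydisc x \<epsilon> \<inter> \<Union>regions) (c 1) t"
    by (rule joinable_coordinatewise[OF n D(2) c(3) c01(1) t(1) tD t_ne(1)]
      joinable_coordinatewise[OF n D(2) c(4) c01(2) t(1) tD t_ne(2)]; assumption)+
  from joinable_trans[OF this(1) joinable_sym[OF this(2)]]
  obtain d where d: "pathin M d" "d ` {0..1} \<subseteq> polydisc x \<epsilon> \<inter> \<Union>regions" "d 0 = c 0" "d 1 = c 1"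
    unfolding joinable_def by blast
  have "path_class M c = path_class M d"
    by (rule polydisc_path_class[OF D(2)]) (use c d D in auto)
  moreover have "tame (path_class M d)"
    by (rule tame_regions) (use c d in auto)
  ultimately show "tame (path_class M c)" by simp
next
  fix D E x
  assume DE: "D \<in> {polydisc x \<epsilon> | x \<epsilon>. polydisc x \<epsilon> \<subseteq> topspace M}" "E \<in> {polydisc x \<epsilon> | x \<epsilon>. polydisc x \<epsilon> \<subseteq> topspace M}"
    "x \<in> D" "x \<in> E"
  show "\<exists>u\<in>generic. joinable M (D \<inter> E) x u"
    by (rule joinable_generic[of "D \<inter> E" x "{}"]) (use DE openin_polydisc in auto)
next
  show "c ` {0..1} \<subseteq> \<Union>{polydisc x \<epsilon> | x \<epsilon>. polydisc x \<epsilon> \<subseteq> topspace M}"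
  proof
    fix y assume "y \<in> c ` {0..1}"
    then have y: "y \<in> topspace M" using assms(2) by (auto simp: pathin_M)
    then obtain \<epsilon> where "\<epsilon> > 0" "polydisc y \<epsilon> \<subseteq> topspace M"
      by (rule open_contains_polydisc[OF openin_topspace])
    moreover from this y have "y \<in> polydisc y \<epsilon>" by (auto simp: polydisc_iff topspace_M)
    ultimately show "y \<in> \<Union>{polydisc x \<epsilon> | x \<epsilon>. polydisc x \<epsilon> \<subseteq> topspace M}" by blast
  qed
  show "tame (class_comp M A B)" if "tame A" "tame B" "A \<in> path_classes M u v" "B \<in> path_classes M v w"
    "u \<in> generic" "v \<in> generic" "w \<in> generic" for A B u v w
    using that by (rule tame_comp)
  show "openin M D" if "D \<in> {polydisc x \<epsilon> | x \<epsilon>. polydisc x \<epsilon> \<subseteq> topspace M}" for D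
    using that openin_polydisc by blast
qed (fact assms)+

theorem generate_twists:
  assumes "n > 0"
  shows "H = carrier G"
proof
  show "H \<subseteq> carrier G" using H_subset by (simp add: carrier_fundamental_group)
  show "carrier G \<subseteq> H"
  proof
    fix A assume "A \<in> carrier G"
    then have A: "A \<in> path_classes M base base" by (simp add: carrier_fundamental_group)
    then obtain c where c: "pathin M c" "c 0 = base" "c 1 = base" "A = path_class M c"
      by (rule path_classesE)
    then have "tame A" using tame_path[OF assms, of c] base_generic by simp
    then have "class_comp M (canon (prio 0 0) base base) (class_comp M A (canon (prio 0 0) base base)) \<in> H"
      using A base_generic unfolding tame_def by blast
    then show "A \<in> H" using A base_generic by (simp add: canon_prio_one)
  qed
qed

end

section \<open>The Artin generators\<close>

lemma topspace_quotient_topology: "topspace (quotient_topology X f) = f ` topspace X"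
proof -
  have "{x \<in> topspace X. f x \<in> f ` topspace X} = topspace X" by blast
  then have "openin (quotient_topology X f) (f ` topspace X)"
    by (simp add: openin_quotient_topology)
  moreover have "topspace (quotient_topology X f) \<subseteq> f ` topspace X"
    using openin_topspace[of "quotient_topology X f"] unfolding openin_quotient_topology by blast
  ultimately show ?thesis by (simp add: openin_subset subset_antisym)
qed

lemma continuous_map_quotient_topology: "continuous_map X (quotient_topology X f) f"
  by (auto simp: continuous_map_def topspace_quotient_topology openin_quotient_topology)

section \<open>Induced maps on path classes\<close>

lemma induced_hom_closed:
  assumes "continuous_map X Y f" "A \<in> path_classes X x y" "f x = c" "f y = c"
  shows "induced_hom Y c f A \<in> path_classes Y c c"
proof -
  obtain p where p: "pathin X p" "p 0 = x" "p 1 = y" "A = path_class X p"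
    using assms(2) by (rule path_classesE)
  have "pathin Y (f \<circ> p)" using p assms by (blast intro: pathin_compose)
  then show ?thesis using p assms by (auto simp: induced_hom_class)
qed

lemma induced_hom_comp:
  assumes f: "continuous_map X Y f" and "A \<in> path_classes X x y" "B \<in> path_classes X y z"
    "f x = c" "f y = c" "f z = c"
  shows "induced_hom Y c f (class_comp X A B) = class_comp Y (induced_hom Y c f A) (induced_hom Y c f B)"
proof -
  obtain p where p: "pathin X p" "p 0 = x" "p 1 = y" "A = path_class X p"
    using assms(2) by (rule path_classesE)
  obtain q where q: "pathin X q" "q 0 = y" "q 1 = z" "B = path_class X q"
    using assms(3) by (rule path_classesE)
  have "pathin Y (f \<circ> p)" "pathin Y (f \<circ> q)" using p q f by (blast intro: pathin_compose)+
  then show ?thesis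
    using p q assms by (simp add: class_comp_class induced_hom_class pathin_path_join comp_path_join)
qed

lemma induced_hom_inv:
  assumes f: "continuous_map X Y f" and "A \<in> path_classes X x y" "f x = c" "f y = c"
  shows "induced_hom Y c f (class_inv X A) = class_inv Y (induced_hom Y c f A)"
proof -
  obtain p where p: "pathin X p" "p 0 = x" "p 1 = y" "A = path_class X p"
    using assms(2) by (rule path_classesE)
  have "pathin Y (f \<circ> p)" using p f by (blast intro: pathin_compose)
  then show ?thesis
    using p assms by (simp add: class_inv_class induced_hom_class pathin_rev comp_path_rev)
qed

lemma induced_hom_one:
  assumes "continuous_map X Y f" "x \<in> topspace X" "f x = c"
  shows "induced_hom Y c f (class_one X x) = class_one Y c"
  using assms induced_hom_class[of X Y f "\<lambda>_. x" c] by (simp add: class_one_def pathin_const o_def)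

section \<open>Products of lists of group elements\<close>

context group
begin

lemma foldr_mult_closed: "set xs \<subseteq> carrier G \<Longrightarrow> foldr (\<otimes>) xs \<one> \<in> carrier G"
  by (induction xs) auto

lemma foldr_mult_append:
  "\<lbrakk>set xs \<subseteq> carrier G; set ys \<subseteq> carrier G\<rbrakk> \<Longrightarrow>
    foldr (\<otimes>) (xs @ ys) \<one> = foldr (\<otimes>) xs \<one> \<otimes> foldr (\<otimes>) ys \<one>"
  by (induction xs) (auto simp: m_assoc foldr_mult_closed)

text \<open>Inversion reverses the order: the increasing product of inverses at the end of
  \<open>pure_word\<close> is the inverse of the decreasing product at its beginning.\<close>

lemma foldr_mult_inv:
  "set xs \<subseteq> carrier G \<Longrightarrow> foldr (\<otimes>) (map (\<lambda>x. inv x) xs) \<one> = inv (foldr (\<otimes>) (rev xs) \<one>)"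
proof (induction xs)
  case (Cons x xs)
  then have "foldr (\<otimes>) (rev (x # xs)) \<one> = foldr (\<otimes>) (rev xs) \<one> \<otimes> x"
    using foldr_mult_append[of "rev xs" "[x]"] by simp
  then show ?case using Cons foldr_mult_closed[of "rev xs"] by (simp add: inv_mult_group del: rev.simps)
qed simp

end

section \<open>Artin generators as canonical classes of ordered configurations\<close>

locale moving_points = line_points n 0 a for n a
begin

abbreviation "Y \<equiv> uconf n euclidean"
definition q :: "(nat \<Rightarrow> complex) \<Rightarrow> complex set" where "q c = c ` {1..n}"
abbreviation "Q \<equiv> induced_hom Y (q base) q"
abbreviation "BG \<equiv> fundamental_group Y (q base)"

lemma M_eq: "M = pconf n euclidean"
  by (simp add: punctured_conf_def)

lemma continuous_q: "continuous_map M Y q"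
proof -
  have "q = (\<lambda>c. c ` {1..n})" by (auto simp: q_def)
  then show ?thesis unfolding M_eq uconf_def by (simp only: continuous_map_quotient_topology)
qed

lemma q_base: "q base = base_conf n a ` {1..n}"
  by (simp add: q_def)

lemma q_base_topspace: "q base \<in> topspace Y"
  using continuous_q base_topspace by (auto simp: continuous_map_def)

lemma group_BG: "group BG"
  using q_base_topspace by (rule group_fundamental_group)

definition conf :: "(nat \<Rightarrow> nat) \<Rightarrow> nat \<Rightarrow> complex" where
  "conf w = (\<lambda>l\<in>{1..n}. of_real (a (w l)))"

text \<open>The lift of the Artin path to ordered configurations that starts where point
  \<open>l\<close> occupies position \<open>w l\<close>.\<close>

definition artin_conf :: "nat \<Rightarrow> (nat \<Rightarrow> nat) \<Rightarrow> real \<Rightarrow> nat \<Rightarrow> complex" where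
  "artin_conf s w t = (\<lambda>l\<in>{1..n}. artin_path n a s t (w l))"

definition swap :: "nat \<Rightarrow> nat \<Rightarrow> nat" where
  "swap s l = (if l = s then s + 1 else if l = s + 1 then s else l)"

lemma q_conf: "bij_betw w {1..n} {1..n} \<Longrightarrow> q (conf w) = q base"
proof -
  assume "bij_betw w {1..n} {1..n}"
  then have "(\<lambda>l. complex_of_real (a l)) ` (w ` {1..n}) = (\<lambda>l. complex_of_real (a l)) ` {1..n}"
    by (simp add: bij_betw_def)
  then show ?thesis by (simp add: q_def conf_def base_conf_def image_image)
qed

lemma conf_generic: "bij_betw w {1..n} {1..n} \<Longrightarrow> conf w \<in> generic"
proof -
  assume w: "bij_betw w {1..n} {1..n}"
  have "inj_on a (w ` {1..n})"
    using w strict_mono_on_imp_inj_on[OF mono] by (simp add: bij_betw_def)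
  then have "inj_on (a \<circ> w) {1..n}" using w by (auto simp: bij_betw_def intro: comp_inj_on)
  moreover have "inj_on (\<lambda>l. Re (full (conf w) l)) {1..n} \<longleftrightarrow> inj_on (a \<circ> w) {1..n}"
    by (rule inj_on_cong) (simp add: conf_def)
  ultimately show ?thesis by (simp add: generic_def conf_def)
qed

lemma artin_path_Re_Im:
  assumes "l \<in> {1..n}"
  defines "m \<equiv> \<lambda>s. (a s + a (s + 1)) / 2"
  shows "l = s \<or> l = s + 1 \<Longrightarrow> Re (artin_path n a s t l) = m s + cos (pi * t) * (a l - m s)"
    and "l = s \<or> l = s + 1 \<Longrightarrow> Im (artin_path n a s t l) = sin (pi * t) * (a l - m s)"
    and "l \<noteq> s \<Longrightarrow> l \<noteq> s + 1 \<Longrightarrow> artin_path n a s t l = of_real (a l)"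
  using assms by (auto simp: artin_path_def Re_exp Im_exp)

text \<open>The turning points stay over the interval between positions \<open>s\<close> and
  \<open>s + 1\<close>, which no other point enters. Their own real parts agree only at the quarter
  turn, when the anticlockwise sense has brought the right-hand point to the top.\<close>

lemma artin_path_order:
  assumes s: "1 \<le> s" "s < n" and t: "t \<in> {0..1}" and kl: "k \<in> {1..n}" "l \<in> {1..n}" "k < l"
    and eq: "Re (artin_path n a s t k) = Re (artin_path n a s t l)"
  shows "k = s \<and> l = s + 1 \<and> Im (artin_path n a s t k) < Im (artin_path n a s t l)"
proof -
  define m where "m = (a s + a (s + 1)) / 2"
  have less: "a s < a (s + 1)" using a_less[of s "s + 1"] s by simp
  have range: "a s \<le> Re (artin_path n a s t x) \<and> Re (artin_path n a s t x) \<le> a (s + 1)" if "x = s \<or> x = s + 1" for x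
  proof -
    have x: "x \<in> {1..n}" using that s by auto
    have "\<bar>cos (pi * t) * (a x - m)\<bar> \<le> 1 * \<bar>a x - m\<bar>"
      unfolding abs_mult by (intro mult_right_mono) auto
    moreover have "\<bar>a x - m\<bar> = (a (s + 1) - a s) / 2" using that less by (auto simp: m_def field_simps abs_if)
    ultimately have "\<bar>cos (pi * t) * (a x - m)\<bar> \<le> (a (s + 1) - a s) / 2" by simp
    moreover have "Re (artin_path n a s t x) = m + cos (pi * t) * (a x - m)"
      using artin_path_Re_Im(1)[OF x that] by (simp add: m_def)
    moreover have "m - (a (s + 1) - a s) / 2 = a s" "m + (a (s + 1) - a s) / 2 = a (s + 1)"
      by (simp_all add: m_def field_simps)
    ultimately show ?thesis by linarith
  qed
  have fixed: "Re (artin_path n a s t x) = a x" if "x \<in> {1..n}" "x \<noteq> s" "x \<noteq> s + 1" for x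
    using artin_path_Re_Im(3)[OF that(1)] that by simp
  have out: "Re (artin_path n a s t x) \<noteq> Re (artin_path n a s t y)"
    if "x \<in> {1..n}" "x \<noteq> s" "x \<noteq> s + 1" "y = s \<or> y = s + 1" for x y
  proof (cases "x < s")
    case True
    then show ?thesis using a_less[of x s] range[OF that(4)] fixed[OF that(1-3)] that s by auto
  next
    case False
    then show ?thesis using a_less[of "s + 1" x] range[OF that(4)] fixed[OF that(1-3)] that s by auto
  qed
  have st: "k = s \<and> l = s + 1"
  proof (rule ccontr)
    assume *: "\<not> ?thesis"
    show False
    proof (cases "k = s \<or> k = s + 1")
      case True
      then have "l \<noteq> s" "l \<noteq> s + 1" using * kl by auto
      then show False using out[of l k] kl eq True by simp
    next
      case k: False
      show False
      proof (cases "l = s \<or> l = s + 1")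
        case True then show False using out[of k l] kl eq k by simp
      next
        case False then show False using fixed[of k] fixed[of l] k kl eq a_less[of k l] by auto
      qed
    qed
  qed
  have "cos (pi * t) * (a k - m) = cos (pi * t) * (a l - m)"
    using eq st kl artin_path_Re_Im(1)[of k s t] artin_path_Re_Im(1)[of l s t] by (simp add: m_def)
  then have cos: "cos (pi * t) = 0" using st less by auto
  have "sin (pi * t) \<ge> 0" using t by (intro sin_ge_zero) auto
  moreover have "(sin (pi * t))\<^sup>2 = 1" using sin_cos_squared_add[of "pi * t"] cos by simp
  ultimately have "sin (pi * t) = 1" by (simp add: power2_eq_1_iff)
  then show ?thesis
    using st less kl artin_path_Re_Im(2)[of k s t] artin_path_Re_Im(2)[of l s t] by simp
qed

lemma artin_conf_stacked:
  assumes s: "1 \<le> s" "s < n" and w: "bij_betw w {1..n} {1..n}"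
    and \<rho>: "\<And>i j. \<lbrakk>i \<in> {1..n}; j \<in> {1..n}; w i = s; w j = s + 1\<rbrakk> \<Longrightarrow> \<rho> i < \<rho> j"
    and t: "t \<in> {0..1}"
  shows "artin_conf s w t \<in> stacked \<rho>"
proof -
  have "Im (full (artin_conf s w t) j) < Im (full (artin_conf s w t) i)"
    if ij: "i \<in> {1..n}" "j \<in> {1..n}" "\<rho> j < \<rho> i" "Re (full (artin_conf s w t) i) = Re (full (artin_conf s w t) j)" for i j
  proof -
    have wij: "w i \<in> {1..n}" "w j \<in> {1..n}" using w ij by (auto simp: bij_betw_def)
    have "w i \<noteq> w j" using w ij by (metis bij_betw_inv_into_left less_irrefl)
    then consider "w i < w j" | "w j < w i" by linarith
    then show ?thesis
    proof cases
      case 1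
      then show ?thesis
        using artin_path_order[OF s t wij 1] \<rho>[of i j] ij by (auto simp: artin_conf_def)
    next
      case 2
      then show ?thesis
        using artin_path_order[OF s t wij(2,1) 2] ij by (auto simp: artin_conf_def)
    qed
  qed
  then show ?thesis by (simp add: stacked_def artin_conf_def)
qed

text \<open>For a ranking that places the point at position \<open>s + 1\<close> above the one at
  \<open>s\<close>, the lifted half turn is stacked; hence it represents the canonical class between
  its ends.\<close>

lemma Q_artin:
  assumes s: "1 \<le> s" "s < n" and w: "bij_betw w {1..n} {1..n}" and inj: "inj_on \<rho> {1..n}"
    and \<rho>: "\<And>i j. \<lbrakk>i \<in> {1..n}; j \<in> {1..n}; w i = s; w j = s + 1\<rbrakk> \<Longrightarrow> \<rho> i < \<rho> j"
  shows "Q (canon \<rho> (conf w) (conf (swap s \<circ> w))) = artin n a s"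
proof -
  let ?p = "artin_conf s w"
  have "?p t \<in> stacked \<rho>" if "t \<in> {0..1}" for t
    by (rule artin_conf_stacked[OF s w _ that]) (rule \<rho>)
  then have sub: "?p ` {0..1} \<subseteq> stacked \<rho>" by blast
  have wl: "w l \<in> {1..n}" if "l \<in> {1..n}" for l using w that by (auto simp: bij_betw_def)
  have path: "pathin M ?p"
    unfolding pathin_M
  proof (intro conjI ballI)
    show "?p ` {0..1} \<subseteq> topspace M" using sub stacked_subset inj by force
    show "continuous_on {0..1} (\<lambda>t. ?p t i)" if "i \<in> {1..n}" for i
      using that wl[OF that] unfolding artin_conf_def artin_path_def
      by (cases "w i = s \<or> w i = s + 1") (auto intro!: continuous_intros)
  qed
  have 0: "?p 0 = conf w"
    using wl by (auto simp: artin_conf_def conf_def artin_path_def fun_eq_iff)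
  have 1: "?p 1 = conf (swap s \<circ> w)"
    using wl by (auto simp: artin_conf_def conf_def artin_path_def fun_eq_iff swap_def field_simps)
  have "q (?p t) = artin_path n a s t ` {1..n}" for t
  proof -
    have "q (?p t) = artin_path n a s t ` (w ` {1..n})" by (simp add: q_def artin_conf_def image_image)
    then show ?thesis using w by (simp add: bij_betw_def)
  qed
  then have qp: "q \<circ> ?p = (\<lambda>t. artin_path n a s t ` {1..n})" by auto
  have swap: "bij_betw (swap s) {1..n} {1..n}"
    by (rule bij_betw_byWitness[of _ "swap s"]) (use s in \<open>auto simp: swap_def\<close>)
  have ends: "q (?p 0) = q base" "q (?p 1) = q base"
    using q_conf[OF w] q_conf[OF bij_betw_trans[OF w swap]] 0 1 by auto
  have "canon \<rho> (conf w) (conf (swap s \<circ> w)) = path_class M ?p"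
    using path_class_canon[OF _ path sub] inj 0 1 by simp
  then have "Q (canon \<rho> (conf w) (conf (swap s \<circ> w))) = path_class Y (q \<circ> ?p)"
    using induced_hom_class[OF continuous_q path, OF ends] by simp
  also have "\<dots> = loop_rel Y (q base) `` {q \<circ> ?p}"
    using ends pathin_compose[OF path continuous_q] by (intro loop_rel_class[symmetric]) (auto simp: loops_def)
  also have "\<dots> = artin n a s" by (simp add: artin_def qp q_base)
  finally show ?thesis .
qed

text \<open>The arrangement after point \<open>j\<close> has travelled left past
  \<open>j - 1\<close> down to \<open>l\<close>, each of which has moved one position to the
  right.\<close>

definition cycle :: "nat \<Rightarrow> nat \<Rightarrow> nat \<Rightarrow> nat" where
  "cycle j l x = (if x = j then l else if l \<le> x \<and> x < j then x + 1 else x)"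

lemma bij_cycle:
  assumes "1 \<le> l" "l \<le> j" "j \<le> n"
  shows "bij_betw (cycle j l) {1..n} {1..n}"
  by (rule bij_betw_byWitness[of _ "\<lambda>y. if y = l then j else if l < y \<and> y \<le> j then y - 1 else y"])
    (use assms in \<open>auto simp: cycle_def\<close>)

lemma swap_cycle: "l < j \<Longrightarrow> swap l \<circ> cycle j (Suc l) = cycle j l"
  by (auto simp: swap_def cycle_def fun_eq_iff)

lemma swap_cycle': "l < j \<Longrightarrow> swap l \<circ> cycle j l = cycle j (Suc l)"
  by (auto simp: swap_def cycle_def fun_eq_iff)

lemma conf_cycle_self: "conf (cycle j j) = base"
  by (auto simp: conf_def cycle_def base_conf_def fun_eq_iff)

lemma artin_closed:
  assumes "1 \<le> s" "s < n"
  shows "artin n a s \<in> carrier BG"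
proof -
  \<comment> \<open>From the base arrangement the half turn needs point \<open>s + 1\<close> above
    point \<open>s\<close>, hence the increasing ranking.\<close>
  have "Q (canon (\<lambda>x. real x) (conf id) (conf (swap s \<circ> id))) = artin n a s"
    by (rule Q_artin) (use assms in auto)
  moreover have "bij_betw (swap s) {1..n} {1..n}"
    by (rule bij_betw_byWitness[of _ "swap s"]) (use assms in \<open>auto simp: swap_def\<close>)
  then have "canon (\<lambda>x. real x) (conf id) (conf (swap s \<circ> id)) \<in> path_classes M (conf id) (conf (swap s))"
    "q (conf id) = q base" "q (conf (swap s)) = q base"
    using conf_generic[of id] conf_generic[of "swap s"] generic_stacked q_conf
    by (auto intro!: canon_closed)
  ultimately show ?thesis
    using induced_hom_closed[OF continuous_q] by (metis carrier_fundamental_group)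
qed

text \<open>As \<open>i < l\<close>, point \<open>j\<close> outranks all points it passes. Each
  passage is a lifted half turn, and since \<open>j\<close> starts at position \<open>j\<close>, the
  letters come in decreasing order from \<open>j - 1\<close> to \<open>l\<close>.\<close>

lemma Q_canon_cycle:
  assumes "1 \<le> i" "i < l" "l \<le> j" "j \<le> n"
  shows "Q (canon (prio j i) base (conf (cycle j l)))
    = foldr (\<otimes>\<^bsub>BG\<^esub>) (map (artin n a) (rev [l..<j])) \<one>\<^bsub>BG\<^esub>"
  using assms(3,2)
proof (induction l rule: inc_induct)
  case base
  have "Q (canon (prio j i) (base_conf n a) (conf (cycle j j))) = class_one Y (q (base_conf n a))"
    unfolding conf_cycle_self canon_prio_one[OF base_generic]
    by (rule induced_hom_one[OF continuous_q base_topspace, OF HOL.refl])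
  then show ?case using q_base_topspace by (simp add: one_fundamental_group)
next
  case (step l)
  let ?b = "base_conf n a"
  have b: "?b \<in> generic" by (rule base_generic)
  have bij: "bij_betw (cycle j l) {1..n} {1..n}" "bij_betw (cycle j (Suc l)) {1..n} {1..n}"
    by (rule bij_cycle; use step assms in simp)+
  have gen: "conf (cycle j l) \<in> generic" "conf (cycle j (Suc l)) \<in> generic"
    using bij conf_generic by auto
  have mem: "canon (prio j i) ?b (conf (cycle j (Suc l))) \<in> path_classes M ?b (conf (cycle j (Suc l)))"
    "canon (prio j i) (conf (cycle j (Suc l))) (conf (cycle j l)) \<in> path_classes M (conf (cycle j (Suc l))) (conf (cycle j l))"
    using gen b by (auto intro!: canon_prio_closed)
  have "Q (canon (prio j i) (conf (cycle j (Suc l))) (conf (swap l \<circ> cycle j (Suc l)))) = artin n a l"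
    by (rule Q_artin) (use step assms bij in \<open>auto simp: cycle_def prio_def split: if_splits\<close>)
  then have art: "Q (canon (prio j i) (conf (cycle j (Suc l))) (conf (cycle j l))) = artin n a l"
    using swap_cycle step by simp
  have "Q (canon (prio j i) ?b (conf (cycle j l)))
    = Q (class_comp M (canon (prio j i) ?b (conf (cycle j (Suc l)))) (canon (prio j i) (conf (cycle j (Suc l))) (conf (cycle j l))))"
    using gen b by (simp add: canon_prio_comp)
  also have "\<dots> = class_comp Y (foldr (\<otimes>\<^bsub>BG\<^esub>) (map (artin n a) (rev [Suc l..<j])) \<one>\<^bsub>BG\<^esub>) (artin n a l)"
    using induced_hom_comp[OF continuous_q mem] q_conf[OF bij(1)] q_conf[OF bij(2)] art step by simp
  also have "\<dots> = foldr (\<otimes>\<^bsub>BG\<^esub>) (map (artin n a) (rev [Suc l..<j])) \<one>\<^bsub>BG\<^esub> \<otimes>\<^bsub>BG\<^esub> artin n a l"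
  proof -
    have "artin n a l \<in> carrier BG" "set (map (artin n a) (rev [Suc l..<j])) \<subseteq> carrier BG"
      using step assms artin_closed by auto
    then show ?thesis
      using group.foldr_mult_closed[OF group_BG] by (intro mult_fundamental_group[symmetric]) (simp_all add: carrier_fundamental_group)
  qed
  also have "\<dots> = foldr (\<otimes>\<^bsub>BG\<^esub>) (map (artin n a) (rev [Suc l..<j]) @ [artin n a l]) \<one>\<^bsub>BG\<^esub>"
  proof -
    have "artin n a l \<in> carrier BG" "set (map (artin n a) (rev [Suc l..<j])) \<subseteq> carrier BG"
      using step assms artin_closed by auto
    then show ?thesis
      using group.is_monoid[OF group_BG] by (subst group.foldr_mult_append[OF group_BG]) (auto simp: monoid.r_one)
  qed
  also have "map (artin n a) (rev [Suc l..<j]) @ [artin n a l] = map (artin n a) (rev [l..<j])"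
    using step by (simp add: upt_rec[of l j])
  finally show ?case .
qed

text \<open>By \<open>twist_indep\<close> the arrangement \<open>cycle j i\<close> may serve as
  \<open>x\<close>. Both halves of the loop are routed through \<open>?v\<close>, where
  \<open>j\<close> has become the right neighbour of \<open>i\<close>: the way to \<open>?v\<close>
  gives the conjugating word, and the two exchanges between \<open>?v\<close> and \<open>?w\<close>
  give the square of one generator.\<close>

lemma Q_twist:
  assumes "1 \<le> i" "i < j" "j \<le> n" "x \<in> generic" "Re (full x j) < Re (full x i)"
  shows "Q (twist i j x) = pure_word n a i j"
proof -
  let ?\<rho> = "prio j i" and ?\<rho>' = "prio j (Suc i)" and ?w = "conf (cycle j i)" and ?v = "conf (cycle j (Suc i))"
  let ?\<Theta> = "foldr (\<otimes>\<^bsub>BG\<^esub>) (map (artin n a) (rev [Suc i..<j])) \<one>\<^bsub>BG\<^esub>"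
  interpret BG: group BG by (rule group_BG)
  have bij: "bij_betw (cycle j i) {1..n} {1..n}" "bij_betw (cycle j (Suc i)) {1..n} {1..n}"
    by (rule bij_cycle; use assms in simp)+
  have gen: "base \<in> generic" "?w \<in> generic" "?v \<in> generic" using bij conf_generic base_generic by auto
  have qs: "q ?w = q base" "q ?v = q base" using bij q_conf by auto
  have "Re (full ?w j) < Re (full ?w i)"
    using assms a_less[of i "i + 1"] by (simp add: conf_def cycle_def)
  then have "twist i j x = twist i j ?w" by (rule twist_indep[OF assms(4) gen(2) assms(5)])
  also have "\<dots> = class_comp M (canon ?\<rho> base ?v) (class_comp M (canon ?\<rho> ?v ?w)
      (class_comp M (canon ?\<rho>' ?w ?v) (canon ?\<rho>' ?v base)))"
    using gen by (simp add: twist_def canon_prio_comp canon_prio_comp_assoc)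
  \<comment> \<open>The two rankings disagree only on \<open>i\<close> and \<open>j\<close>, which
    stand in the same order in \<open>?v\<close> and in the base point. So the way home is the
    inverse of the way out.\<close>
  also have "canon ?\<rho>' ?v base = canon ?\<rho> ?v base"
    by (rule canon_prio_Suc[symmetric]) (use gen assms a_less[of i "i + 1"] a_less[of i j] in \<open>auto simp: conf_def cycle_def base_conf_def\<close>)
  also have "\<dots> = class_inv M (canon ?\<rho> base ?v)" using gen by (simp add: canon_prio_inv)
  finally have tw: "twist i j x = class_comp M (canon ?\<rho> base ?v) (class_comp M (canon ?\<rho> ?v ?w)
      (class_comp M (canon ?\<rho>' ?w ?v) (class_inv M (canon ?\<rho> base ?v))))" .
  have mem: "canon ?\<rho> base ?v \<in> path_classes M base ?v" "canon ?\<rho> ?v ?w \<in> path_classes M ?v ?w"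
    "canon ?\<rho>' ?w ?v \<in> path_classes M ?w ?v"
    using gen by (auto intro!: canon_prio_closed)
  have 1: "Q (canon ?\<rho> base ?v) = ?\<Theta>" using Q_canon_cycle[of i "Suc i" j] assms by simp
  have "Q (canon ?\<rho> ?v (conf (swap i \<circ> cycle j (Suc i)))) = artin n a i"
    by (rule Q_artin) (use assms bij in \<open>auto simp: cycle_def prio_def split: if_splits\<close>)
  then have 2: "Q (canon ?\<rho> ?v ?w) = artin n a i" using swap_cycle assms by simp
  \<comment> \<open>Now \<open>i\<close> is the right-hand point of the pair, and
    \<open>?\<rho>'\<close> ranks it above \<open>j\<close>; the exchange back is again an
    anticlockwise half turn.\<close>
  have "Q (canon ?\<rho>' ?w (conf (swap i \<circ> cycle j i))) = artin n a i"
    by (rule Q_artin) (use assms bij in \<open>auto simp: cycle_def prio_def split: if_splits\<close>)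
  then have 3: "Q (canon ?\<rho>' ?w ?v) = artin n a i" using swap_cycle' assms by simp
  have car: "artin n a i \<in> carrier BG" "set (map (artin n a) (rev [Suc i..<j])) \<subseteq> carrier BG"
    using assms artin_closed by auto
  have \<Theta>: "?\<Theta> \<in> carrier BG" using car(2) by (rule BG.foldr_mult_closed)
  have "Q (twist i j x) = class_comp Y ?\<Theta> (class_comp Y (artin n a i) (class_comp Y (artin n a i) (class_inv Y ?\<Theta>)))"
  proof -
    let ?A = "canon ?\<rho> base ?v" and ?B = "canon ?\<rho> ?v ?w" and ?C = "canon ?\<rho>' ?w ?v"
    have A': "class_inv M ?A \<in> path_classes M ?v base" using mem(1) by (rule class_inv_closed)
    have CA: "class_comp M ?C (class_inv M ?A) \<in> path_classes M ?w base" using mem(3) A' by (rule class_comp_closed)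
    have BCA: "class_comp M ?B (class_comp M ?C (class_inv M ?A)) \<in> path_classes M ?v base"
      using mem(2) CA by (rule class_comp_closed)
    have "Q (class_inv M ?A) = class_inv Y (Q ?A)"
      by (rule induced_hom_inv[OF continuous_q mem(1), OF HOL.refl qs(2)])
    moreover have "Q (class_comp M ?C (class_inv M ?A)) = class_comp Y (Q ?C) (Q (class_inv M ?A))"
      by (rule induced_hom_comp[OF continuous_q mem(3) A', OF qs HOL.refl])
    moreover have "Q (class_comp M ?B (class_comp M ?C (class_inv M ?A))) = class_comp Y (Q ?B) (Q (class_comp M ?C (class_inv M ?A)))"
      by (rule induced_hom_comp[OF continuous_q mem(2) CA, OF qs(2,1) HOL.refl])
    moreover have "Q (twist i j x) = class_comp Y (Q ?A) (Q (class_comp M ?B (class_comp M ?C (class_inv M ?A))))"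
      unfolding tw by (rule induced_hom_comp[OF continuous_q mem(1) BCA, OF HOL.refl qs(2) HOL.refl])
    ultimately show ?thesis by (simp only: 1 2 3)
  qed
  also have "\<dots> = ?\<Theta> \<otimes>\<^bsub>BG\<^esub> (artin n a i \<otimes>\<^bsub>BG\<^esub> (artin n a i \<otimes>\<^bsub>BG\<^esub> inv\<^bsub>BG\<^esub> ?\<Theta>))"
  proof -
    have "class_comp Y A B = A \<otimes>\<^bsub>BG\<^esub> B" if "A \<in> carrier BG" "B \<in> carrier BG" for A B
      using that mult_fundamental_group by (metis carrier_fundamental_group)
    moreover have "class_inv Y ?\<Theta> = inv\<^bsub>BG\<^esub> ?\<Theta>"
      using \<Theta> inv_fundamental_group[OF q_base_topspace] by (metis carrier_fundamental_group)
    ultimately show ?thesis using car(1) \<Theta> by simp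
  qed
  also have "\<dots> = pure_word n a i j"
  proof -
    have "foldr (\<otimes>\<^bsub>BG\<^esub>) (map (\<lambda>l. inv\<^bsub>BG\<^esub> artin n a l) [Suc i..<j]) \<one>\<^bsub>BG\<^esub> = inv\<^bsub>BG\<^esub> ?\<Theta>"
      using BG.foldr_mult_inv[of "map (artin n a) [Suc i..<j]"] car(2) by (simp add: rev_map o_def)
    then show ?thesis
      unfolding pure_word_def Let_def q_base[symmetric]
      using car(1) \<Theta> by (simp add: BG.m_assoc numeral_2_eq_2 del: upt_Suc)
  qed
  finally show ?thesis .
qed

end

section \<open>From twists to pure braids with straight strings\<close>

context line_points
begin

text \<open>Adding the straight strings preserves being stacked for a given ranking, because fixed
  points took part in the comparison from the start. Canonical classes thus go to canonical classes
  and the twist to the twist of the ambient space, whose word is known.\<close>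

lemma twist_pure_braid:
  assumes "i \<in> {1..n}" "i < j" "j \<le> N" "x \<in> generic" "Re (full x j) < Re (full x i)"
  shows "twist i j x \<in> pure_braid n r a i j"
proof -
  interpret F: moving_points "n + r" a
    by unfold_locales (use mono in simp)
  have F_full: "add_straight (n + r) 0 a (full c) l = full c l" if "l \<in> {1..N}" for c l
    using that by simp
  have ext: "full c \<in> extensional {1..N}" for c by (simp add: add_straight_def)
  have st: "full c \<in> F.stacked \<rho>" if "c \<in> stacked \<rho>" for c \<rho>
    using that ext by (simp add: stacked_def F.stacked_def F_full del: full_moving)
  have gen: "full c \<in> F.generic" if "c \<in> generic" for c
  proof -
    have "inj_on (\<lambda>l. Re (add_straight (n + r) 0 a (full c) l)) {1..N} \<longleftrightarrow> inj_on (\<lambda>l. Re (full c l)) {1..N}"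
      by (rule inj_on_cong) simp
    then show ?thesis using that ext by (simp add: generic_def F.generic_def)
  qed
  have top: "full c \<in> topspace F.M" if "c \<in> topspace M" for c
  proof -
    have "inj_on (add_straight (n + r) 0 a (full c)) {1..N} \<longleftrightarrow> inj_on (full c) {1..N}"
      by (rule inj_on_cong) simp
    then show ?thesis using that ext by (simp add: topspace_M F.topspace_M)
  qed
  have cont: "continuous_map M F.M full"
    unfolding F.continuous_map_M using top continuous_full by auto
  have base: "full base = base_conf (n + r) a"
    by (auto simp: add_straight_def base_conf_def fun_eq_iff)
  let ?\<rho> = "prio j i" and ?\<rho>' = "prio j (Suc i)"
  have x: "x \<in> stacked \<rho>" and b: "base \<in> stacked \<rho>" for \<rho>
    using assms(4) base_generic generic_stacked by blast+
  obtain p where p: "pathin M p" "p ` {0..1} \<subseteq> stacked ?\<rho>" "p 0 = base" "p 1 = x" "canon ?\<rho> base x = path_class M p"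
    using canon_path[OF inj_prio b x] by metis
  obtain p' where p': "pathin M p'" "p' ` {0..1} \<subseteq> stacked ?\<rho>'" "p' 0 = x" "p' 1 = base" "canon ?\<rho>' x base = path_class M p'"
    using canon_path[OF inj_prio x b] by metis
  have fp: "pathin F.M (full \<circ> p)" "pathin F.M (full \<circ> p')"
    using p p' cont by (blast intro: pathin_compose)+
  have im: "(full \<circ> p) ` {0..1} \<subseteq> F.stacked ?\<rho>" "(full \<circ> p') ` {0..1} \<subseteq> F.stacked ?\<rho>'"
    using p(2) p'(2) st by auto
  have "induced_hom F.M (full base) full (path_class M (path_join p p')) = path_class F.M (full \<circ> path_join p p')"
    by (rule induced_hom_class[OF cont]) (use p p' in \<open>simp_all add: pathin_path_join\<close>)
  also have "\<dots> = class_comp F.M (path_class F.M (full \<circ> p)) (path_class F.M (full \<circ> p'))"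
    using fp p p' by (simp add: class_comp_class comp_path_join)
  also have "path_class F.M (full \<circ> p) = F.canon ?\<rho> (full base) (full x)"
    using F.path_class_canon[OF inj_prio fp(1) im(1)] p by simp
  also have "path_class F.M (full \<circ> p') = F.canon ?\<rho>' (full x) (full base)"
    using F.path_class_canon[OF inj_prio fp(2) im(2)] p' by simp
  also have "path_class M (path_join p p') = twist i j x"
    using p p' by (simp add: twist_def class_comp_class)
  finally have "induced_hom F.M (base_conf (n + r) a) full (twist i j x) = F.twist i j (full x)"
    by (simp add: F.twist_def base)
  moreover have "F.Q (F.twist i j (full x)) = pure_word (n + r) a i j"
    by (rule F.Q_twist) (use assms gen F_full in \<open>auto simp del: full_moving\<close>)
  moreover have "F.q = (\<lambda>c. c ` {1..n + r})" by (auto simp: F.q_def)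
  moreover have "twist i j x \<in> carrier G"
    using twist_closed[OF assms(4)] by (simp add: carrier_fundamental_group)
  ultimately show ?thesis
    by (simp only: pure_braid_def F.M_eq mem_Collect_eq simp_thms)
qed

theorem generate_pure_braids:
  assumes "n > 0"
  shows "generate G (\<Union>i\<in>{1..n}. \<Union>j\<in>{i<..N}. pure_braid n r a i j) = carrier G"
proof
  have sub: "(\<Union>i\<in>{1..n}. \<Union>j\<in>{i<..N}. pure_braid n r a i j) \<subseteq> carrier G"
    by (auto simp: pure_braid_def)
  then show "generate G (\<Union>i\<in>{1..n}. \<Union>j\<in>{i<..N}. pure_braid n r a i j) \<subseteq> carrier G"
    by (rule group.generate_incl[OF group_G])
  have "twists \<subseteq> (\<Union>i\<in>{1..n}. \<Union>j\<in>{i<..N}. pure_braid n r a i j)"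
  proof
    fix A assume "A \<in> twists"
    then obtain i j x where "A = twist i j x" "i \<in> {1..n}" "i < j" "j \<le> N" "x \<in> generic" "Re (full x j) < Re (full x i)"
      unfolding twists_def by blast
    then show "A \<in> (\<Union>i\<in>{1..n}. \<Union>j\<in>{i<..N}. pure_braid n r a i j)"
      using twist_pure_braid by (intro UN_I[of i] UN_I[of j]) auto
  qed
  then show "carrier G \<subseteq> generate G (\<Union>i\<in>{1..n}. \<Union>j\<in>{i<..N}. pure_braid n r a i j)"
    using generate_twists[OF assms] group.mono_generate[OF group_G] by blast
qed

end

section \<open>Paths in topological groupoids\<close>

lemma gpath_Nil_iff [simp]: "gpath G x [] y \<longleftrightarrow> x = y \<and> x \<in> topspace (Obj G)"
  by (auto elim: gpath.cases intro: gpath.intros)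

lemma gpath_Along_iff [simp]:
  "gpath G x (Along c # w) y \<longleftrightarrow> pathin (Obj G) c \<and> c 0 = x \<and> gpath G (c 1) w y"
  by (auto elim: gpath.cases intro: gpath.intros)

lemma gpath_Jump_iff [simp]:
  "gpath G x (Jump g # w) y \<longleftrightarrow> g \<in> topspace (Arr G) \<and> Src G g = x \<and> gpath G (Tgt G g) w y"
  by (auto elim: gpath.cases intro: gpath.intros)

lemma gpath_append:
  "gpath G x u y \<Longrightarrow> gpath G y v z \<Longrightarrow> gpath G x (u @ v) z"
  by (induction rule: gpath.induct) auto

lemma gpath_homotopic_gpath:
  "gpath_homotopic G x y u v \<Longrightarrow> gpath G x u y \<and> gpath G x v y"
  by (induction rule: gpath_homotopic.induct) auto

lemma gmove_homotopic:
  "gmove G l r \<Longrightarrow> gpath G x l y \<Longrightarrow> gpath G x r y \<Longrightarrow> gpath_homotopic G x y l r"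
  using gpath_homotopic.move[of G l r x "[]" "[]" y] by simp

text \<open>An elementary move already takes place inside an arbitrary context, so the appended word
  is absorbed by the right-hand context.\<close>

lemma gpath_homotopic_append_right:
  "gpath_homotopic G x y u v \<Longrightarrow> gpath G y s z \<Longrightarrow> gpath_homotopic G x z (u @ s) (v @ s)"
proof (induction rule: gpath_homotopic.induct)
  case (refl w)
  then show ?case using gpath_append[of G x w y s z] by (simp add: gpath_homotopic.refl)
next
  case (sym u v)
  then show ?case by (simp add: gpath_homotopic.sym)
next
  case (trans u v w)
  show ?case
    by (rule gpath_homotopic.trans[OF trans.IH(1)[OF trans.prems] trans.IH(2)[OF trans.prems]])
next
  case (move l r u v)
  have "gpath G x ((u @ l @ v) @ s) z" "gpath G x ((u @ r @ v) @ s) z"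
    using gpath_append[OF move(2,4)] gpath_append[OF move(3,4)] .
  then show ?case using gpath_homotopic.move[OF move(1), of x u "v @ s" z] by simp
qed

lemma gpath_homotopic_append_left:
  "gpath_homotopic G x y u v \<Longrightarrow> gpath G z s x \<Longrightarrow> gpath_homotopic G z y (s @ u) (s @ v)"
proof (induction rule: gpath_homotopic.induct)
  case (refl w)
  then show ?case using gpath_append[of G z s x w y] by (simp add: gpath_homotopic.refl)
next
  case (sym u v)
  then show ?case by (simp add: gpath_homotopic.sym)
next
  case (trans u v w)
  show ?case
    by (rule gpath_homotopic.trans[OF trans.IH(1)[OF trans.prems] trans.IH(2)[OF trans.prems]])
next
  case (move l r u v)
  have "gpath G z (s @ (u @ l @ v)) y" "gpath G z (s @ (u @ r @ v)) y"
    using gpath_append[OF move(4,2)] gpath_append[OF move(4,3)] .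
  then show ?case using gpath_homotopic.move[OF move(1), of z "s @ u" v y] by simp
qed

lemma gpath_homotopic_append:
  assumes "gpath_homotopic G x y u u'" "gpath_homotopic G y z v v'"
  shows "gpath_homotopic G x z (u @ v) (u' @ v')"
proof (rule gpath_homotopic.trans)
  show "gpath_homotopic G x z (u @ v) (u' @ v)"
    using gpath_homotopic_append_right[OF assms(1)] gpath_homotopic_gpath[OF assms(2)] by simp
  show "gpath_homotopic G x z (u' @ v) (u' @ v')"
    using gpath_homotopic_append_left[OF assms(2)] gpath_homotopic_gpath[OF assms(1)] by simp
qed

lemma pathin_ends: "pathin X c \<Longrightarrow> c 0 \<in> topspace X" "pathin X c \<Longrightarrow> c 1 \<in> topspace X"
  by (simp_all add: pathin_topspace)

lemma gpath_homotopic_Along: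
  assumes "path_homotopic (Obj G) c d"
  shows "gpath_homotopic G (c 0) (c 1) [Along c] [Along d]"
  by (rule gmove_homotopic[OF gmove.homotopy[OF assms]])
    (use path_homotopic_ends[OF assms] path_homotopic_imp_pathin[OF assms] pathin_ends in auto)

lemma gpath_homotopic_join:
  assumes "pathin (Obj G) c" "pathin (Obj G) d" "c 1 = d 0"
  shows "gpath_homotopic G (c 0) (d 1) [Along c, Along d] [Along (path_join c d)]"
  by (rule gmove_homotopic[OF gmove.join[OF assms]])
    (use assms pathin_path_join[OF assms] pathin_topspace[of "Obj G" d 1] in auto)

lemma gpath_homotopic_const:
  assumes "x \<in> topspace (Obj G)"
  shows "gpath_homotopic G x x [Along (\<lambda>_. x)] []"
  by (rule gmove_homotopic[OF gmove.const[OF assms]]) (use assms in \<open>auto simp: pathin_const\<close>)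

lemma gpath_homotopic_rev:
  assumes "pathin (Obj G) c"
  shows "gpath_homotopic G (c 0) (c 0) [Along c, Along (path_rev c)] []"
proof -
  have "gpath_homotopic G (c 0) (c 0) [Along c, Along (path_rev c)] [Along (path_join c (path_rev c))]"
    using gpath_homotopic_join[of G c "path_rev c"] assms pathin_rev by force
  moreover have "gpath_homotopic G (c 0) (c 0) [Along (path_join c (path_rev c))] [Along (\<lambda>_. c 0)]"
    using gpath_homotopic_Along[OF path_join_rev_right[OF assms]] by simp
  moreover have "gpath_homotopic G (c 0) (c 0) [Along (\<lambda>_. c 0)] []"
    by (rule gpath_homotopic_const[OF pathin_ends(1)[OF assms]])
  ultimately show ?thesis by (meson gpath_homotopic.trans)
qed

definition gclass :: "('o, 'a) top_groupoid \<Rightarrow> 'o \<Rightarrow> ('o, 'a) piece list \<Rightarrow> ('o, 'a) piece list set" where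
  "gclass G b w = gloop_rel G b `` {w}"

lemma gclass_iff: "v \<in> gclass G b w \<longleftrightarrow> gpath_homotopic G b b w v"
  by (simp add: gclass_def gloop_rel_def)

lemma gclass_eq: "gpath_homotopic G b b u v \<Longrightarrow> gclass G b u = gclass G b v"
  using gpath_homotopic.sym gpath_homotopic.trans by (metis gclass_iff subsetI subset_antisym)

lemma carrier_orb_fundamental_group:
  "carrier (orb_fundamental_group G b) = {gclass G b w | w. gpath G b w b}"
  by (auto simp: orb_fundamental_group_def quotient_def gclass_def)

lemma one_orb_fundamental_group: "\<one>\<^bsub>orb_fundamental_group G b\<^esub> = gclass G b []"
  by (simp add: orb_fundamental_group_def gclass_def)

lemma mult_orb_fundamental_group:
  assumes "gpath G b u b" "gpath G b v b"
  shows "gclass G b u \<otimes>\<^bsub>orb_fundamental_group G b\<^esub> gclass G b v = gclass G b (u @ v)"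
proof -
  have "gclass G b (u' @ v') = gclass G b (u @ v)" if "u' \<in> gclass G b u" "v' \<in> gclass G b v" for u' v'
    using that by (intro gclass_eq[symmetric] gpath_homotopic_append) (auto simp: gclass_iff)
  moreover have "u \<in> gclass G b u" "v \<in> gclass G b v"
    using assms by (auto simp: gclass_iff intro: gpath_homotopic.refl)
  ultimately have "(\<Union>u'\<in>gclass G b u. \<Union>v'\<in>gclass G b v. gclass G b (u' @ v')) = gclass G b (u @ v)"
    by blast
  then show ?thesis by (simp add: orb_fundamental_group_def gclass_def)
qed

section \<open>The configuration orbifold\<close>

text \<open>The chart number ranges over a discrete type, so the charts are open pieces and
  continuity is checked on each separately.\<close>

lemma continuous_on_discrete_fst:
  fixes f :: "'a::discrete_topology \<times> 'b::topological_space \<Rightarrow> 'c::topological_space"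
  assumes "\<And>j. continuous_on UNIV (\<lambda>w. f (j, w))"
  shows "continuous_on UNIV f"
proof -
  have "continuous_on (\<Union>j. {j} \<times> UNIV) f"
  proof (rule continuous_on_open_UN)
    fix j :: 'a
    show "open ({j} \<times> (UNIV :: 'b set))" by (intro open_Times) (auto simp: open_discrete)
    have "continuous_on ({j} \<times> UNIV) (\<lambda>z. f (j, snd z))"
      by (rule continuous_on_compose2[OF assms]) (auto intro: continuous_intros)
    then show "continuous_on ({j} \<times> UNIV) f"
      by (rule continuous_on_eq) auto
  qed
  moreover have "(\<Union>j. {j} \<times> UNIV) = (UNIV :: ('a \<times> 'b) set)" by auto
  ultimately show ?thesis by simp
qed

lemma continuous_cone_proj: "continuous_on UNIV (cone_proj x q)"
proof (rule continuous_on_discrete_fst)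
  show "continuous_on UNIV (\<lambda>w. cone_proj x q (j, w))" for j
    by (cases "j = 0") (auto simp: cone_proj_def intro!: continuous_intros)
qed

locale cone_orbifold =
  fixes n k m :: nat and q :: "nat \<Rightarrow> nat" and a :: "nat \<Rightarrow> real"
  assumes q: "\<And>j. j \<in> {1..m} \<Longrightarrow> q j > 1"
    and mono: "strict_mono_on {1..n + k + m} a"
begin

sublocale line_points n "k + m" a
  by unfold_locales (use mono in \<open>simp add: add.assoc\<close>)

abbreviation P where "P \<equiv> \<lambda>j. complex_of_real (a (n + j))"
abbreviation X where "X \<equiv> \<lambda>j. complex_of_real (a (n + k + j))"
abbreviation \<pi> where "\<pi> \<equiv> cone_proj X q"
abbreviation Objects where "Objects \<equiv> cone_objects k m q P X"
abbreviation Arrows where "Arrows \<equiv> cone_arrows k m q P X"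
abbreviation K where "K \<equiv> conf_orbifold n k m q a"

section \<open>Objects and arrows of the configuration groupoid\<close>

lemma inj_X: "i \<in> {1..m} \<Longrightarrow> j \<in> {1..m} \<Longrightarrow> X i = X j \<Longrightarrow> i = j"
  using strict_mono_on_imp_inj_on[OF mono] by (auto dest: inj_onD[of a _ "n + k + i" "n + k + j"])

lemma fixed_points: "(complex_of_real \<circ> a) ` {n+1..n+(k+m)} = P ` {1..k} \<union> X ` {1..m}"
proof -
  have "{n+1..n+(k+m)} = (\<lambda>j. n + j) ` {1..k} \<union> (\<lambda>j. n + k + j) ` {1..m}"
  proof -
    have "l \<in> (\<lambda>j. n + j) ` {1..k} \<union> (\<lambda>j. n + k + j) ` {1..m}" if "l \<in> {n+1..n+(k+m)}" for l
    proof (cases "l \<le> n + k")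
      case True
      then show ?thesis using that by (intro UnI1 image_eqI[of _ _ "l - n"]) auto
    next
      case False
      then show ?thesis using that by (intro UnI2 image_eqI[of _ _ "l - n - k"]) auto
    qed
    then show ?thesis by auto
  qed
  then show ?thesis by (simp only: image_Un image_image comp_apply)
qed

lemma proj_chart_0 [simp]: "\<pi> (0, w) = w"
  by (simp add: cone_proj_def)

text \<open>Chart \<open>j\<close> omits the other cone points, so only its own centre lies over
  one; as \<open>q j\<close> is positive, the power vanishes at the centre alone.\<close>

lemma cone_point_iff:
  assumes "u \<in> Objects"
  shows "\<pi> u \<in> X ` {1..m} \<longleftrightarrow> fst u \<noteq> 0 \<and> snd u = 0"
proof -
  obtain j w where u: "u = (j, w)" by (cases u)
  have jm: "j \<le> m" and notin: "\<pi> (j, w) \<notin> X ` ({1..m} - {j})"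
    using assms u by (simp_all add: cone_objects_def del: split_paired_All)
  show ?thesis
  proof (cases "j = 0")
    case True
    then show ?thesis using notin u by simp
  next
    case False
    then have "q j > 1" using q jm by simp
    then have "w ^ q j = 0 \<longleftrightarrow> w = 0" by simp
    moreover have "\<pi> (j, w) \<in> X ` {1..m} \<longleftrightarrow> \<pi> (j, w) = X j"
    proof
      assume "\<pi> (j, w) \<in> X ` {1..m}"
      then obtain l where "l \<in> {1..m}" "\<pi> (j, w) = X l" by blast
      then show "\<pi> (j, w) = X j" using notin by (cases "l = j") auto
    next
      assume "\<pi> (j, w) = X j"
      then show "\<pi> (j, w) \<in> X ` {1..m}" using False jm by auto
    qed
    ultimately show ?thesis using u False by (simp add: cone_proj_def)
  qed
qed

text \<open>The chart groups act transitively on the fibres, so lying in one orbit is the same as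
  having one projection. This turns \<open>conf_objects\<close> into a plain injectivity
  condition.\<close>

lemma arrow_between:
  assumes "u \<in> Objects" "v \<in> Objects"
  shows "(\<exists>\<zeta>. (u, v, \<zeta>) \<in> Arrows) \<longleftrightarrow> \<pi> u = \<pi> v"
proof
  assume eq: "\<pi> u = \<pi> v"
  obtain i w j z where uv: "u = (i, w)" "v = (j, z)" by (cases u, cases v)
  show "\<exists>\<zeta>. (u, v, \<zeta>) \<in> Arrows"
  proof (cases "i = j \<and> w \<noteq> 0 \<and> i \<noteq> 0")
    case True
    then have "w ^ q i = z ^ q i" using eq uv by (simp add: cone_proj_def)
    moreover have "w ^ q i \<noteq> 0" using True by simp
    ultimately have "(z / w) ^ q i = 1" unfolding power_divide by (simp del: power_eq_0_iff)
    then have "(u, v, z / w) \<in> Arrows" using assms uv eq True by (simp add: cone_arrows_def)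
    then show ?thesis by blast
  next
    case False
    have "z = w" if "i = j" "i = 0" using that eq uv by simp
    moreover have "z = 0" if "i = j" "w = 0" "i \<noteq> 0"
    proof -
      have "q i > 1" using that q assms uv by (simp add: cone_objects_def)
      then have "z ^ q i = 0" using that eq uv by (simp add: cone_proj_def zero_power)
      then show ?thesis by simp
    qed
    ultimately have "(u, v, 1) \<in> Arrows" using assms uv eq False by (auto simp: cone_arrows_def)
    then show ?thesis by blast
  qed
qed (auto simp: cone_arrows_def)

lemma C_simps:
  "Obj (cone_plane k m q P X) = top_of_set Objects" "Arr (cone_plane k m q P X) = top_of_set Arrows"
  "Src (cone_plane k m q P X) g = fst g" "Tgt (cone_plane k m q P X) g = fst (snd g)"
  by (simp_all add: cone_plane_def case_prod_unfold)

lemma Obj_K: "Obj K = subtopology (product_topology (\<lambda>_. top_of_set Objects) {1..n}) (conf_objects n (cone_plane k m q P X))"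
  and Arr_K: "Arr K = subtopology (product_topology (\<lambda>_. top_of_set Arrows) {1..n})
      {g. (\<lambda>i\<in>{1..n}. fst (g i)) \<in> conf_objects n (cone_plane k m q P X)}"
  by (simp_all add: conf_orbifold_def conf_groupoid_def C_simps)

lemma arrow_objects: "g \<in> Arrows \<Longrightarrow> fst g \<in> Objects" "g \<in> Arrows \<Longrightarrow> fst (snd g) \<in> Objects"
  and arrow_proj: "g \<in> Arrows \<Longrightarrow> \<pi> (fst (snd g)) = \<pi> (fst g)"
  by (auto simp: cone_arrows_def)

lemma conf_objects_iff:
  assumes c: "c \<in> PiE {1..n} (\<lambda>_. Objects)"
  shows "c \<in> conf_objects n (cone_plane k m q P X) \<longleftrightarrow> inj_on (\<lambda>i. \<pi> (c i)) {1..n}"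
proof -
  have "(\<exists>g\<in>Arrows. fst g = c i \<and> fst (snd g) = c j) \<longleftrightarrow> \<pi> (c i) = \<pi> (c j)" if "i \<in> {1..n}" "j \<in> {1..n}" for i j
  proof -
    have "(\<exists>g\<in>Arrows. fst g = c i \<and> fst (snd g) = c j) \<longleftrightarrow> (\<exists>\<zeta>. (c i, c j, \<zeta>) \<in> Arrows)"
      by (metis fst_conv prod.collapse snd_conv)
    then show ?thesis using arrow_between[of "c i" "c j"] c that by (simp add: PiE_iff)
  qed
  then show ?thesis
    unfolding conf_objects_def inj_on_def C_simps topspace_euclidean_subtopology mem_Collect_eq by blast
qed

lemma topspace_Obj: "topspace (Obj K) = {c \<in> PiE {1..n} (\<lambda>_. Objects). inj_on (\<lambda>i. \<pi> (c i)) {1..n}}"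
  using conf_objects_iff by (auto simp: Obj_K)

lemma topspace_Arr:
  "topspace (Arr K) = {g \<in> PiE {1..n} (\<lambda>_. Arrows). inj_on (\<lambda>i. \<pi> (fst (g i))) {1..n}}"
proof -
  have "(\<lambda>i\<in>{1..n}. fst (g i)) \<in> conf_objects n (cone_plane k m q P X) \<longleftrightarrow> inj_on (\<lambda>i. \<pi> (fst (g i))) {1..n}"
    if g: "g \<in> PiE {1..n} (\<lambda>_. Arrows)" for g
  proof -
    have "(\<lambda>i\<in>{1..n}. fst (g i)) \<in> PiE {1..n} (\<lambda>_. Objects)"
      using g arrow_objects by (auto simp: PiE_iff)
    moreover have "inj_on (\<lambda>i. \<pi> ((\<lambda>i\<in>{1..n}. fst (g i)) i)) {1..n} \<longleftrightarrow> inj_on (\<lambda>i. \<pi> (fst (g i))) {1..n}"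
      by (rule inj_on_cong) simp
    ultimately show ?thesis using conf_objects_iff by simp
  qed
  then show ?thesis unfolding Arr_K by auto
qed

lemma K_simps:
  "Src K g = (\<lambda>i\<in>{1..n}. fst (g i))" "Tgt K g = (\<lambda>i\<in>{1..n}. fst (snd (g i)))"
  "Idt K c = (\<lambda>i\<in>{1..n}. (c i, c i, 1))" "Cmp K g h = (\<lambda>i\<in>{1..n}. cone_comp (g i) (h i))"
  by (auto simp: conf_orbifold_def conf_groupoid_def cone_plane_def case_prod_unfold)

lemma pathin_Obj:
  "pathin (Obj K) c \<longleftrightarrow> c ` {0..1} \<subseteq> topspace (Obj K) \<and> (\<forall>i\<in>{1..n}. continuous_on {0..1} (\<lambda>t. c t i))"
proof -
  have "pathin (Obj K) c \<longleftrightarrow> pathin (Obj K) c \<and> c ` {0..1} \<subseteq> topspace (Obj K)"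
    by (auto simp: pathin_def continuous_map_def)
  also have "\<dots> \<longleftrightarrow> c ` {0..1} \<subseteq> topspace (Obj K) \<and> (\<forall>i\<in>{1..n}. continuous_on {0..1} (\<lambda>t. c t i))"
    unfolding pathin_def Obj_K continuous_map_in_subtopology continuous_map_componentwise
    by (auto simp: Pi_iff PiE_iff)
  finally show ?thesis .
qed

lemma pathin_Arr:
  "pathin (Arr K) c \<longleftrightarrow> c ` {0..1} \<subseteq> topspace (Arr K) \<and> (\<forall>i\<in>{1..n}. continuous_on {0..1} (\<lambda>t. c t i))"
proof -
  have "pathin (Arr K) c \<longleftrightarrow> pathin (Arr K) c \<and> c ` {0..1} \<subseteq> topspace (Arr K)"
    by (auto simp: pathin_def continuous_map_def)
  also have "\<dots> \<longleftrightarrow> c ` {0..1} \<subseteq> topspace (Arr K) \<and> (\<forall>i\<in>{1..n}. continuous_on {0..1} (\<lambda>t. c t i))"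
    unfolding pathin_def Arr_K continuous_map_in_subtopology continuous_map_componentwise
    by (auto simp: Pi_iff PiE_iff)
  finally show ?thesis .
qed

section \<open>Regular configurations and the change to chart 0\<close>

abbreviation incl where "incl \<equiv> regular_incl n"

definition regular :: "(nat \<Rightarrow> nat \<times> complex) set" where
  "regular = {c \<in> topspace (Obj K). \<forall>i\<in>{1..n}. \<pi> (c i) \<notin> X ` {1..m}}"

definition Proj :: "(nat \<Rightarrow> nat \<times> complex) \<Rightarrow> nat \<Rightarrow> complex" where
  "Proj c = (\<lambda>i\<in>{1..n}. \<pi> (c i))"

text \<open>The change of all charts to chart 0. The last entry 1 is right in both cases: it is the
  identity germ for a point of chart 0 and the conventional value between different charts.\<close>

definition down :: "(nat \<Rightarrow> nat \<times> complex) \<Rightarrow> nat \<Rightarrow> cone_arrow" where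
  "down c = (\<lambda>i\<in>{1..n}. (c i, (0, \<pi> (c i)), 1))"

definition up :: "(nat \<Rightarrow> nat \<times> complex) \<Rightarrow> nat \<Rightarrow> cone_arrow" where
  "up c = (\<lambda>i\<in>{1..n}. ((0, \<pi> (c i)), c i, 1))"

lemma regular_Obj: "c \<in> regular \<Longrightarrow> c \<in> topspace (Obj K)"
  by (simp add: regular_def)

lemma Obj_ext: "c \<in> topspace (Obj K) \<Longrightarrow> c \<in> extensional {1..n}"
  and Obj_object: "c \<in> topspace (Obj K) \<Longrightarrow> i \<in> {1..n} \<Longrightarrow> c i \<in> Objects"
  and Obj_inj: "c \<in> topspace (Obj K) \<Longrightarrow> inj_on (\<lambda>i. \<pi> (c i)) {1..n}"
  by (auto simp: topspace_Obj PiE_iff)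

lemma Arr_ext: "g \<in> topspace (Arr K) \<Longrightarrow> g \<in> extensional {1..n}"
  and Arr_arrow: "g \<in> topspace (Arr K) \<Longrightarrow> i \<in> {1..n} \<Longrightarrow> g i \<in> Arrows"
  and Arr_inj: "g \<in> topspace (Arr K) \<Longrightarrow> inj_on (\<lambda>i. \<pi> (fst (g i))) {1..n}"
  by (auto simp: topspace_Arr PiE_iff)

lemma topspace_ObjI:
  assumes "c \<in> extensional {1..n}" "\<And>i. i \<in> {1..n} \<Longrightarrow> c i \<in> Objects" "inj_on f {1..n}"
    "\<And>i. i \<in> {1..n} \<Longrightarrow> \<pi> (c i) = f i"
  shows "c \<in> topspace (Obj K)"
proof -
  have "inj_on (\<lambda>i. \<pi> (c i)) {1..n} \<longleftrightarrow> inj_on f {1..n}"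
    by (rule inj_on_cong) (rule assms(4))
  then show ?thesis using assms(1-3) by (simp add: topspace_Obj PiE_iff)
qed

lemma topspace_ArrI:
  assumes "g \<in> extensional {1..n}" "\<And>i. i \<in> {1..n} \<Longrightarrow> g i \<in> Arrows" "inj_on f {1..n}"
    "\<And>i. i \<in> {1..n} \<Longrightarrow> \<pi> (fst (g i)) = f i"
  shows "g \<in> topspace (Arr K)"
proof -
  have "inj_on (\<lambda>i. \<pi> (fst (g i))) {1..n} \<longleftrightarrow> inj_on f {1..n}"
    by (rule inj_on_cong) (rule assms(4))
  then show ?thesis using assms(1-3) by (simp add: topspace_Arr PiE_iff)
qed

lemma Src_Obj:
  assumes "g \<in> topspace (Arr K)"
  shows "Src K g \<in> topspace (Obj K)"
  by (rule topspace_ObjI[OF _ _ Arr_inj[OF assms]])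
    (use Arr_arrow[OF assms] arrow_objects in \<open>simp_all add: K_simps\<close>)

lemma Tgt_Obj:
  assumes "g \<in> topspace (Arr K)"
  shows "Tgt K g \<in> topspace (Obj K)"
  by (rule topspace_ObjI[OF _ _ Arr_inj[OF assms]])
    (use Arr_arrow[OF assms] arrow_objects arrow_proj in \<open>simp_all add: K_simps\<close>)

lemma topspace_M_iff:
  "c \<in> topspace M \<longleftrightarrow> c \<in> PiE {1..n} (\<lambda>_. - (P ` {1..k} \<union> X ` {1..m})) \<and> inj_on c {1..n}"
  unfolding punctured_conf_def pconf_def fixed_points by simp

lemma chart_0_object: "(0, z) \<in> Objects \<longleftrightarrow> z \<notin> P ` {1..k} \<union> X ` {1..m}"
  by (auto simp: cone_objects_def)

lemma object_not_puncture: "u \<in> Objects \<Longrightarrow> \<pi> u \<notin> P ` {1..k}"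
  by (auto simp: cone_objects_def)

lemma regular_chart_0:
  assumes "c \<in> regular" "i \<in> {1..n}"
  shows "(0, \<pi> (c i)) \<in> Objects"
  using assms object_not_puncture[OF Obj_object] by (auto simp: chart_0_object regular_def)

lemma Proj_topspace:
  assumes "c \<in> regular"
  shows "Proj c \<in> topspace M"
proof -
  have "inj_on (Proj c) {1..n} \<longleftrightarrow> inj_on (\<lambda>i. \<pi> (c i)) {1..n}"
    by (rule inj_on_cong) (simp add: Proj_def)
  moreover have "Proj c \<in> PiE {1..n} (\<lambda>_. - (P ` {1..k} \<union> X ` {1..m}))"
    using regular_chart_0[OF assms] unfolding chart_0_object by (simp add: Proj_def PiE_iff)
  ultimately show ?thesis using Obj_inj[OF regular_Obj[OF assms]] by (simp only: topspace_M_iff simp_thms)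
qed

lemma incl_regular:
  assumes "y \<in> topspace M"
  shows "incl y \<in> regular"
proof -
  have y: "y \<in> PiE {1..n} (\<lambda>_. - (P ` {1..k} \<union> X ` {1..m}))" "inj_on y {1..n}"
    using assms unfolding topspace_M_iff by blast+
  have yi: "y i \<notin> P ` {1..k} \<union> X ` {1..m}" if "i \<in> {1..n}" for i
    using PiE_mem[OF y(1) that] by blast
  have "incl y \<in> topspace (Obj K)"
    by (rule topspace_ObjI[OF _ _ y(2)]) (use yi in \<open>simp_all only: regular_incl_def restrict_extensional restrict_apply' chart_0_object proj_chart_0 not_False_eq_True\<close>)
  moreover have "\<pi> (incl y i) \<notin> X ` {1..m}" if "i \<in> {1..n}" for i
    using yi[OF that] that by (simp only: regular_incl_def restrict_apply' proj_chart_0) blast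
  ultimately show ?thesis by (simp add: regular_def)
qed

lemma Proj_incl: "y \<in> topspace M \<Longrightarrow> Proj (incl y) = y"
  by (auto simp: topspace_M_iff Proj_def regular_incl_def fun_eq_iff PiE_iff extensional_def)

lemma down_Arr: "c \<in> regular \<Longrightarrow> down c \<in> topspace (Arr K)"
proof -
  assume c: "c \<in> regular"
  have "(c i, (0, \<pi> (c i)), 1) \<in> Arrows" if "i \<in> {1..n}" for i
    using Obj_object[OF regular_Obj[OF c] that] regular_chart_0[OF c that]
    by (cases "c i") (auto simp: cone_arrows_def)
  then show ?thesis
    by (intro topspace_ArrI[OF _ _ Obj_inj[OF regular_Obj[OF c]]]) (simp_all add: down_def)
qed

lemma up_Arr: "c \<in> regular \<Longrightarrow> up c \<in> topspace (Arr K)"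
proof -
  assume c: "c \<in> regular"
  have "((0, \<pi> (c i)), c i, 1) \<in> Arrows" if "i \<in> {1..n}" for i
    using Obj_object[OF regular_Obj[OF c] that] regular_chart_0[OF c that]
    by (cases "c i") (auto simp: cone_arrows_def)
  then show ?thesis
    by (intro topspace_ArrI[OF _ _ Obj_inj[OF regular_Obj[OF c]]]) (simp_all add: up_def)
qed

lemma Src_down: "c \<in> topspace (Obj K) \<Longrightarrow> Src K (down c) = c"
  and Tgt_down: "Tgt K (down c) = incl (Proj c)"
  and Src_up: "Src K (up c) = incl (Proj c)"
  and Tgt_up: "c \<in> topspace (Obj K) \<Longrightarrow> Tgt K (up c) = c"
  using Obj_ext[of c]
  by (auto simp: K_simps down_def up_def Proj_def regular_incl_def fun_eq_iff extensional_def)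

text \<open>Over regular points an arrow is determined by its ends. Inside a chart other than 0 the
  composite carries the ratio \<open>w / v\<close>, which is the given \<open>\<zeta>\<close> since
  regularity makes \<open>v\<close> nonzero.\<close>

lemma Cmp_down_up:
  assumes g: "g \<in> topspace (Arr K)" and reg: "Src K g \<in> regular"
  shows "Cmp K (down (Src K g)) (up (Tgt K g)) = g"
proof
  fix i
  show "Cmp K (down (Src K g)) (up (Tgt K g)) i = g i"
  proof (cases "i \<in> {1..n}")
    case True
    obtain j v l w \<zeta> where gi: "g i = ((j, v), (l, w), \<zeta>)" by (metis prod.exhaust)
    have arr: "((j, v), (l, w), \<zeta>) \<in> Arrows" using Arr_arrow[OF g True] gi by simp
    have "\<pi> (Src K g i) \<notin> X ` {1..m}" using reg True unfolding regular_def by blast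
    moreover have "Src K g i = (j, v)" using True gi by (simp add: K_simps)
    ultimately have "v \<noteq> 0" if "j \<noteq> 0"
      using cone_point_iff[of "(j, v)"] arrow_objects(1)[OF arr] that by simp
    moreover have "if j = l then w = \<zeta> * v \<and> \<zeta> ^ (if j = 0 then 1 else q j) = 1 else \<zeta> = 1"
      using arr unfolding cone_arrows_def mem_Collect_eq prod.case by (elim conjE) assumption
    ultimately have "\<zeta> = (if j = 0 \<and> l = 0 then 1 else if j = l then w / v else 1)"
      by (cases "j = l"; cases "j = 0") simp_all
    moreover have "Cmp K (down (Src K g)) (up (Tgt K g)) i = ((j, v), (l, w), if j = 0 \<and> l = 0 then 1 else if j = l then w / v else 1)"
      using True gi by (simp add: K_simps down_def up_def cone_comp_def)
    ultimately show ?thesis using gi by simp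
  next
    case False
    then show ?thesis using Arr_ext[OF g] by (auto simp: K_simps extensional_def)
  qed
qed

lemma Cmp_up_down:
  shows "Cmp K (up c) (down c) = Idt K (incl (Proj c))"
  by (auto simp: K_simps down_def up_def cone_comp_def Proj_def regular_incl_def fun_eq_iff split: prod.splits)

lemma jump_comp:
  assumes "g \<in> topspace (Arr K)" "h \<in> topspace (Arr K)" "f \<in> topspace (Arr K)" "Tgt K g = Src K h" "Cmp K g h = f"
    "Src K f = Src K g" "Tgt K f = Tgt K h"
  shows "gpath_homotopic K (Src K g) (Tgt K h) [Jump g, Jump h] [Jump f]"
proof -
  have "gmove K [Jump g, Jump h] [Jump f]"
    using gmove.comp[OF assms(1,2,4)] assms(5) by simp
  then show ?thesis
    by (rule gmove_homotopic) (simp_all add: assms(1-3,6,7) assms(4)[symmetric] Tgt_Obj)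
qed

lemma down_up_homotopic:
  assumes g: "g \<in> topspace (Arr K)" and reg: "Src K g \<in> regular" "Tgt K g \<in> regular"
  shows "gpath_homotopic K (Src K g) (Tgt K g) [Jump (down (Src K g)), Jump (up (Tgt K g))] [Jump g]"
proof -
  have ext: "Src K g \<in> topspace (Obj K)" "Tgt K g \<in> topspace (Obj K)" using g Src_Obj Tgt_Obj by auto
  have "Proj (Src K g) = Proj (Tgt K g)"
    using arrow_proj[OF Arr_arrow[OF g]] by (auto simp: Proj_def K_simps fun_eq_iff)
  then show ?thesis
    using jump_comp[OF down_Arr[OF reg(1)] up_Arr[OF reg(2)] g _ Cmp_down_up[OF g reg(1)]] ext
    by (simp add: Src_down Tgt_down Src_up Tgt_up)
qed

lemma Idt_Arr: "c \<in> topspace (Obj K) \<Longrightarrow> Idt K c \<in> topspace (Arr K)"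
proof -
  assume c: "c \<in> topspace (Obj K)"
  have "(c i, c i, 1) \<in> Arrows" if "i \<in> {1..n}" for i
    using Obj_object[OF c that] by (cases "c i") (auto simp: cone_arrows_def)
  then show ?thesis by (intro topspace_ArrI[OF _ _ Obj_inj[OF c]]) (simp_all add: K_simps)
qed

lemma Idt_homotopic:
  assumes "c \<in> topspace (Obj K)"
  shows "gpath_homotopic K c c [Jump (Idt K c)] []"
proof (rule gmove_homotopic[OF gmove.unit[OF assms]])
  have "Src K (Idt K c) = c" "Tgt K (Idt K c) = c"
    using Obj_ext[OF assms] by (auto simp: K_simps fun_eq_iff extensional_def)
  then show "gpath K c [Jump (Idt K c)] c" using assms Idt_Arr by simp
qed (use assms in simp)

lemma up_down_homotopic:
  assumes c: "c \<in> regular"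
  shows "gpath_homotopic K (incl (Proj c)) (incl (Proj c)) [Jump (up c), Jump (down c)] []"
proof -
  have ext: "c \<in> topspace (Obj K)" using c by (rule regular_Obj)
  have inc: "incl (Proj c) \<in> topspace (Obj K)" using c Proj_topspace incl_regular regular_Obj by blast
  then have "Src K (Idt K (incl (Proj c))) = incl (Proj c)" "Tgt K (Idt K (incl (Proj c))) = incl (Proj c)"
    by (auto simp: K_simps regular_incl_def fun_eq_iff)
  then have "gpath_homotopic K (incl (Proj c)) (incl (Proj c)) [Jump (up c), Jump (down c)] [Jump (Idt K (incl (Proj c)))]"
    using jump_comp[OF up_Arr[OF c] down_Arr[OF c] Idt_Arr[OF inc] _ Cmp_up_down] ext
    by (simp add: Src_down Tgt_down Src_up Tgt_up)
  then show ?thesis using Idt_homotopic[OF inc] by (rule gpath_homotopic.trans)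
qed

lemma continuous_map_Obj:
  "continuous_map Z (Obj K) f \<longleftrightarrow> f \<in> topspace Z \<rightarrow> topspace (Obj K) \<and>
     (\<forall>i\<in>{1..n}. continuous_map Z euclidean (\<lambda>z. f z i))" (is "?L \<longleftrightarrow> ?R")
proof -
  have "?L \<longleftrightarrow> continuous_map Z (Obj K) f \<and> f \<in> topspace Z \<rightarrow> topspace (Obj K)"
    by (auto simp: continuous_map_def)
  also have "\<dots> \<longleftrightarrow> ?R"
    unfolding Obj_K continuous_map_in_subtopology continuous_map_componentwise
    by (auto simp: Pi_iff PiE_iff continuous_map_in_subtopology)
  finally show ?thesis .
qed

lemma continuous_map_incl: "continuous_map M (Obj K) incl"
  unfolding continuous_map_Obj
proof (intro conjI ballI)
  show "incl \<in> topspace M \<rightarrow> topspace (Obj K)" using incl_regular regular_Obj by blast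
  fix i assume i: "i \<in> {1..n}"
  have "continuous_map euclidean euclidean (\<lambda>w::complex. (0::nat, w))"
    by (auto intro!: continuous_intros)
  from continuous_map_compose[OF _ this, of M "\<lambda>c. c i"]
  show "continuous_map M euclidean (\<lambda>c. incl c i)"
    using continuous_full[of i] i by (simp add: regular_incl_def o_def)
qed

lemma pathin_Proj:
  assumes "pathin (Obj K) c" "c ` {0..1} \<subseteq> regular"
  shows "pathin M (Proj \<circ> c)"
  unfolding pathin_M
proof (intro conjI ballI)
  show "(Proj \<circ> c) ` {0..1} \<subseteq> topspace M" using assms Proj_topspace by auto
  fix i assume i: "i \<in> {1..n}"
  have "continuous_on {0..1} (\<lambda>t. c t i)" using assms i by (simp add: pathin_Obj)
  then have "continuous_on {0..1} (\<lambda>t. \<pi> (c t i))"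
    by (intro continuous_on_compose2[OF continuous_cone_proj]) auto
  then show "continuous_on {0..1} (\<lambda>t. (Proj \<circ> c) t i)" using i by (simp add: Proj_def)
qed

text \<open>A normal form between regular configurations: change to chart 0, follow an ordinary path
  in the complement, change back. At the base point the two changes are units, so loops become
  images of loops of the complement.\<close>

definition smoothable :: "(nat \<Rightarrow> nat \<times> complex) \<Rightarrow> (nat \<Rightarrow> nat \<times> complex) \<Rightarrow>
    (nat \<Rightarrow> nat \<times> complex, nat \<Rightarrow> cone_arrow) piece list \<Rightarrow> bool" where
  "smoothable u v w \<longleftrightarrow> (\<exists>\<gamma>. pathin M \<gamma> \<and> \<gamma> 0 = Proj u \<and> \<gamma> 1 = Proj v \<and>
     gpath_homotopic K u v w [Jump (down u), Along (incl \<circ> \<gamma>), Jump (up v)])"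

lemma smoothable_homotopic:
  "smoothable u v w \<Longrightarrow> gpath_homotopic K u v w' w \<Longrightarrow> smoothable u v w'"
  unfolding smoothable_def by (elim exE conjE) (intro exI conjI, assumption+, rule gpath_homotopic.trans)

lemma pathin_incl: "pathin M \<gamma> \<Longrightarrow> pathin (Obj K) (incl \<circ> \<gamma>)"
  using continuous_map_incl by (blast intro: pathin_compose)

lemma regular_ext: "c \<in> regular \<Longrightarrow> c \<in> extensional {1..n}"
  using Obj_ext regular_Obj by blast

lemma gpath_down_up:
  assumes "u \<in> regular" "v \<in> regular"
  shows "gpath K u (Jump (down u) # w) v \<longleftrightarrow> gpath K (incl (Proj u)) w v"
    and "gpath K (incl (Proj v)) [Jump (up v)] v"
  using assms by (simp_all add: down_Arr up_Arr regular_Obj Src_down Tgt_down Src_up Tgt_up)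

text \<open>At the junction the change back from chart 0 meets the change to chart 0, and the two
  cancel.\<close>

lemma smoothable_append:
  assumes "smoothable u v w" "smoothable v z w'" and reg: "u \<in> regular" "v \<in> regular" "z \<in> regular"
  shows "smoothable u z (w @ w')"
proof -
  obtain \<gamma> where \<gamma>: "pathin M \<gamma>" "\<gamma> 0 = Proj u" "\<gamma> 1 = Proj v"
     "gpath_homotopic K u v w [Jump (down u), Along (incl \<circ> \<gamma>), Jump (up v)]"
    using assms(1) unfolding smoothable_def by blast
  obtain \<delta> where \<delta>: "pathin M \<delta>" "\<delta> 0 = Proj v" "\<delta> 1 = Proj z"
     "gpath_homotopic K v z w' [Jump (down v), Along (incl \<circ> \<delta>), Jump (up z)]"
    using assms(2) unfolding smoothable_def by blast
  let ?A = "Along (incl \<circ> \<gamma>)" and ?B = "Along (incl \<circ> \<delta>)"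
  have g1: "gpath K u [Jump (down u), ?A] (incl (Proj v))"
    using \<gamma> reg pathin_incl[OF \<gamma>(1)] Proj_topspace incl_regular regular_Obj by (simp add: gpath_down_up down_Arr Src_down Tgt_down regular_Obj)
  have g2: "gpath K (incl (Proj v)) [?B, Jump (up z)] z"
    using \<delta> pathin_incl[OF \<delta>(1)] gpath_down_up(2)[OF reg(3) reg(3)] by (simp del: gpath_Jump_iff)
  have g3: "gpath K u [Jump (down u)] (incl (Proj u))"
    using reg Proj_topspace incl_regular regular_Obj by (simp add: down_Arr Src_down Tgt_down regular_Obj)
  have s1: "gpath_homotopic K u z (w @ w') ([Jump (down u), ?A, Jump (up v)] @ [Jump (down v), ?B, Jump (up z)])"
    by (rule gpath_homotopic_append[OF \<gamma>(4) \<delta>(4)])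
  have s2: "gpath_homotopic K u z ([Jump (down u), ?A] @ [Jump (up v), Jump (down v)] @ [?B, Jump (up z)])
      ([Jump (down u), ?A] @ [] @ [?B, Jump (up z)])"
    by (intro gpath_homotopic_append_left[OF gpath_homotopic_append_right[OF up_down_homotopic[OF reg(2)] g2] g1])
  have s3: "gpath_homotopic K u z ([Jump (down u)] @ [?A, ?B] @ [Jump (up z)]) ([Jump (down u)] @ [Along (path_join (incl \<circ> \<gamma>) (incl \<circ> \<delta>))] @ [Jump (up z)])"
  proof (rule gpath_homotopic_append_left[OF gpath_homotopic_append_right g3])
    show "gpath_homotopic K (incl (Proj u)) (incl (Proj z)) [?A, ?B] [Along (path_join (incl \<circ> \<gamma>) (incl \<circ> \<delta>))]"
      using gpath_homotopic_join[OF pathin_incl[OF \<gamma>(1)] pathin_incl[OF \<delta>(1)]] \<gamma> \<delta> by simp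
    show "gpath K (incl (Proj z)) [Jump (up z)] z" using gpath_down_up(2)[OF reg(3) reg(3)] .
  qed
  have "gpath_homotopic K u z (w @ w') [Jump (down u), Along (path_join (incl \<circ> \<gamma>) (incl \<circ> \<delta>)), Jump (up z)]"
    by (rule gpath_homotopic.trans[OF s1[unfolded append.simps]
      gpath_homotopic.trans[OF s2[unfolded append.simps] s3[unfolded append.simps]]])
  then show ?thesis
    unfolding smoothable_def using \<gamma> \<delta> by (intro exI[of _ "path_join \<gamma> \<delta>"]) (simp add: pathin_path_join comp_path_join)
qed

text \<open>Source and target have the same projection, so a constant path fills the middle of the
  normal form.\<close>

lemma smoothable_jump:
  assumes g: "g \<in> topspace (Arr K)" and reg: "Src K g \<in> regular" "Tgt K g \<in> regular"
  shows "smoothable (Src K g) (Tgt K g) [Jump g]"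
proof -
  let ?u = "Src K g" and ?v = "Tgt K g"
  have eq: "Proj ?u = Proj ?v"
    using arrow_proj[OF Arr_arrow[OF g]] by (auto simp: Proj_def K_simps fun_eq_iff)
  have pu: "Proj ?u \<in> topspace M" using reg Proj_topspace by blast
  have inc: "incl (Proj ?u) \<in> topspace (Obj K)" using pu incl_regular regular_Obj by blast
  have "gpath_homotopic K ?u ?v ([Jump (down ?u)] @ [] @ [Jump (up ?v)]) ([Jump (down ?u)] @ [Along (\<lambda>_. incl (Proj ?u))] @ [Jump (up ?v)])"
  proof (rule gpath_homotopic_append_left[OF gpath_homotopic_append_right])
    show "gpath_homotopic K (incl (Proj ?u)) (incl (Proj ?u)) [] [Along (\<lambda>_. incl (Proj ?u))]"
      by (rule gpath_homotopic.sym[OF gpath_homotopic_const[OF inc]])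
    show "gpath K (incl (Proj ?u)) [Jump (up ?v)] ?v" using gpath_down_up(2)[OF reg(2) reg(2)] by (simp only: eq)
    show "gpath K ?u [Jump (down ?u)] (incl (Proj ?u))"
      using reg inc by (simp add: down_Arr Src_down Tgt_down regular_Obj)
  qed
  then have "gpath_homotopic K ?u ?v [Jump g] [Jump (down ?u), Along (incl \<circ> (\<lambda>_. Proj ?u)), Jump (up ?v)]"
    using gpath_homotopic.trans[OF gpath_homotopic.sym[OF down_up_homotopic[OF g reg]]] by (simp add: o_def)
  then show ?thesis
    unfolding smoothable_def using eq pu by (intro exI[of _ "\<lambda>_. Proj ?u"]) (simp add: pathin_const)
qed

text \<open>The arrows \<open>down (c t)\<close> form a path of arrows from \<open>c\<close> to its
  projection in chart 0; one \<open>slide\<close> along it replaces \<open>c\<close> by that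
  projection.\<close>

lemma smoothable_regular_path:
  assumes c: "pathin (Obj K) c" "c ` {0..1} \<subseteq> regular"
  shows "smoothable (c 0) (c 1) [Along c]"
proof -
  let ?h = "\<lambda>t. down (c t)"
  have c01: "c 0 \<in> regular" "c 1 \<in> regular" using c by auto
  have h: "pathin (Arr K) ?h"
    unfolding pathin_Arr
  proof (intro conjI ballI)
    show "?h ` {0..1} \<subseteq> topspace (Arr K)" using c(2) down_Arr by blast
    fix i assume i: "i \<in> {1..n}"
    have ci: "continuous_on {0..1} (\<lambda>t. c t i)" using c i by (simp add: pathin_Obj)
    then have "continuous_on {0..1} (\<lambda>t. \<pi> (c t i))"
      by (intro continuous_on_compose2[OF continuous_cone_proj]) auto
    then show "continuous_on {0..1} (\<lambda>t. ?h t i)" using i ci by (auto simp: down_def intro!: continuous_intros)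
  qed
  have tgt: "Tgt K \<circ> ?h = incl \<circ> (Proj \<circ> c)" by (auto simp: Tgt_down)
  have src: "(Src K \<circ> ?h) t = c t" if "t \<in> {0..1}" for t
    using that c(2) by (simp add: Src_down image_subset_iff regular_Obj)
  have "path_homotopic (Obj K) c (Src K \<circ> ?h)"
    by (rule path_homotopic_eq[OF c(1)]) (simp only: src)
  then have 1: "gpath_homotopic K (c 0) (c 1) [Along c] [Along (Src K \<circ> ?h)]"
    by (rule gpath_homotopic_Along)
  have psrc: "pathin (Obj K) (Src K \<circ> ?h)"
    using path_homotopic_imp_pathin[OF \<open>path_homotopic (Obj K) c (Src K \<circ> ?h)\<close>] by simp
  have srce: "Src K (down (c 0)) = c 0" "Src K (down (c 1)) = c 1" using c01 by (auto simp: Src_down regular_Obj)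
  have inc: "incl (Proj (c 1)) \<in> topspace (Obj K)" "incl (Proj (c 0)) \<in> topspace (Obj K)"
    using c01 Proj_topspace incl_regular regular_Obj by blast+
  have 2: "gpath_homotopic K (c 0) (incl (Proj (c 1))) [Jump (down (c 0)), Along (incl \<circ> (Proj \<circ> c))] [Along (Src K \<circ> ?h), Jump (down (c 1))]"
    using gmove_homotopic[OF gmove.slide[OF h]] c01 srce inc psrc pathin_incl[OF pathin_Proj[OF c]]
    by (simp add: tgt down_Arr Tgt_down)
  \<comment> \<open>The unit at \<open>c 1\<close> is written as a change to chart 0 and back, so
    that the slide can be undone at the end of the path.\<close>
  have 3: "gpath_homotopic K (c 0) (c 1) ([Along (Src K \<circ> ?h)] @ []) ([Along (Src K \<circ> ?h)] @ [Jump (down (c 1)), Jump (up (c 1))])"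
  proof (rule gpath_homotopic_append_left)
    have "Idt K (c 1) \<in> topspace (Arr K)" "Src K (Idt K (c 1)) = c 1" "Tgt K (Idt K (c 1)) = c 1"
      using c01 regular_Obj regular_ext[OF c01(2)] Idt_Arr by (auto simp: K_simps fun_eq_iff extensional_def)
    then have "gpath_homotopic K (c 1) (c 1) [Jump (down (c 1)), Jump (up (c 1))] [Jump (Idt K (c 1))]"
      using down_up_homotopic[of "Idt K (c 1)"] c01 by simp
    then show "gpath_homotopic K (c 1) (c 1) [] [Jump (down (c 1)), Jump (up (c 1))]"
      by (rule gpath_homotopic.sym[OF gpath_homotopic.trans[OF _ Idt_homotopic[OF regular_Obj[OF c01(2)]]]])
    show "gpath K (c 0) [Along (Src K \<circ> ?h)] (c 1)" using psrc srce regular_Obj[OF c01(2)] by simp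
  qed
  have 4: "gpath_homotopic K (c 0) (c 1) ([Jump (down (c 0)), Along (incl \<circ> (Proj \<circ> c))] @ [Jump (up (c 1))]) ([Along (Src K \<circ> ?h), Jump (down (c 1))] @ [Jump (up (c 1))])"
    by (rule gpath_homotopic_append_right[OF 2]) (rule gpath_down_up(2)[OF c01(2,2)])
  have "gpath_homotopic K (c 0) (c 1) [Along c] [Jump (down (c 0)), Along (incl \<circ> (Proj \<circ> c)), Jump (up (c 1))]"
    by (rule gpath_homotopic.trans[OF 1 gpath_homotopic.trans[OF 3[unfolded append.simps]
      gpath_homotopic.sym[OF 4[unfolded append.simps]]]])
  then show ?thesis
    unfolding smoothable_def using pathin_Proj[OF c] by (intro exI[of _ "Proj \<circ> c"]) simp
qed

section \<open>Chart boxes and the avoidance of chart centres\<close>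

lemma open_Objects: "open Objects"
proof -
  have "Objects = (\<Union>j\<in>{..m}. {j} \<times> UNIV \<inter> \<pi> -` (- (P ` {1..k} \<union> X ` ({1..m} - {j}))))"
    by (auto simp: cone_objects_def)
  moreover have "open (\<pi> -` (- (P ` {1..k} \<union> X ` ({1..m} - {j}))))" for j
    by (intro open_vimage continuous_cone_proj open_Compl finite_imp_closed) auto
  then have "open ({j} \<times> UNIV \<inter> \<pi> -` (- (P ` {1..k} \<union> X ` ({1..m} - {j}))))" for j
    by (intro open_Int open_Times) (simp_all only: open_discrete open_UNIV)
  ultimately show ?thesis by (simp only:) (intro open_UN ballI)
qed

definition chart_box :: "(nat \<Rightarrow> nat \<times> complex) \<Rightarrow> real \<Rightarrow> (nat \<Rightarrow> nat \<times> complex) set" where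
  "chart_box c \<epsilon> = PiE {1..n} (\<lambda>i. {fst (c i)} \<times> ball (snd (c i)) \<epsilon>)"

lemma chart_box_iff: "d \<in> chart_box c \<epsilon> \<longleftrightarrow>
    d \<in> extensional {1..n} \<and> (\<forall>i\<in>{1..n}. fst (d i) = fst (c i) \<and> dist (snd (d i)) (snd (c i)) < \<epsilon>)"
  by (auto simp: chart_box_def PiE_iff mem_Times_iff dist_commute)

lemma open_contains_chart_box:
  assumes "openin (Obj K) S" "c \<in> S"
  obtains \<epsilon> where "\<epsilon> > 0" "chart_box c \<epsilon> \<subseteq> S"
proof -
  obtain V where V: "\<And>i. i \<in> {1..n} \<Longrightarrow> open (V i)" "\<And>i. i \<in> {1..n} \<Longrightarrow> c i \<in> V i" "PiE {1..n} V \<subseteq> S"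
    using open_contains_product_box[OF finite_atLeastAtMost open_Objects continuous_cone_proj conf_objects_iff
      assms(1)[unfolded Obj_K] assms(2)] by blast
  have "\<exists>e>0. ball (snd (c i)) e \<subseteq> Pair (fst (c i)) -` V i" if i: "i \<in> {1..n}" for i
  proof -
    have "open (Pair (fst (c i)) -` V i)"
      by (intro open_vimage V(1)[OF i] continuous_intros)
    then show ?thesis using V(2)[OF i] by (simp add: open_contains_ball)
  qed
  then obtain e where e: "\<And>i. i \<in> {1..n} \<Longrightarrow> e i > 0 \<and> ball (snd (c i)) (e i) \<subseteq> Pair (fst (c i)) -` V i"
    by metis
  then obtain \<epsilon> where \<epsilon>: "\<epsilon> > 0" "\<And>v. v \<in> e ` {1..n} \<Longrightarrow> \<epsilon> \<le> v"
    by (rule_tac finite_positive_bound[of "e ` {1..n}"]) auto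
  have "{fst (c i)} \<times> ball (snd (c i)) \<epsilon> \<subseteq> V i" if "i \<in> {1..n}" for i
    using e[OF that] \<epsilon>(2)[OF imageI[OF that]] by (auto simp: subset_iff)
  then have "chart_box c \<epsilon> \<subseteq> S"
    using V(3) PiE_mono[of "{1..n}" "\<lambda>i. {fst (c i)} \<times> ball (snd (c i)) \<epsilon>" V] by (auto simp: chart_box_def)
  then show thesis using that \<epsilon>(1) by blast
qed

lemma openin_chart_box:
  assumes "chart_box c \<epsilon> \<subseteq> topspace (Obj K)"
  shows "openin (Obj K) (chart_box c \<epsilon>)"
  using assms unfolding chart_box_def Obj_K by (intro openin_product_box) (auto intro!: open_Times simp: open_discrete)

lemma chart_box_path_class:
  assumes "chart_box x \<epsilon> \<subseteq> topspace (Obj K)" "pathin (Obj K) c" "c ` {0..1} \<subseteq> chart_box x \<epsilon>"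
    "pathin (Obj K) d" "d ` {0..1} \<subseteq> chart_box x \<epsilon>" "c 0 = d 0" "c 1 = d 1"
  shows "path_class (Obj K) c = path_class (Obj K) d"
proof -
  let ?f = "\<lambda>y. \<lambda>i\<in>{1..n}. (fst (x i), y i)" and ?g = "\<lambda>c t. \<lambda>i\<in>{1..n}. snd (c t i)"
  have f: "path_homotopic (Obj K) (?f \<circ> ?g c) (?f \<circ> ?g d)"
  proof (rule path_homotopic_convex_box)
    have "continuous_map (product_topology (\<lambda>_. euclidean) {1..n}) euclidean (\<lambda>y. (fst (x i), y i :: complex))" if "i \<in> {1..n}" for i
      using continuous_map_compose[OF continuous_map_product_projection[OF that, of "\<lambda>_. euclidean"], of euclidean "Pair (fst (x i))"]
      by (simp add: o_def continuous_intros)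
    then show "continuous_map (subtopology (product_topology (\<lambda>_. euclidean) {1..n}) (PiE {1..n} (\<lambda>i. ball (snd (x i)) \<epsilon>))) (Obj K) ?f"
      unfolding continuous_map_Obj using assms(1) unfolding chart_box_def
      by (auto simp: PiE_iff simp del: One_nat_def intro!: continuous_map_from_subtopology)
  qed (use assms in \<open>auto simp: pathin_Obj chart_box_iff image_subset_iff dist_commute intro!: continuous_intros\<close>)
  have eq: "path_homotopic (Obj K) e (?f \<circ> ?g e)" if "pathin (Obj K) e" "e ` {0..1} \<subseteq> chart_box x \<epsilon>" for e
    by (rule path_homotopic_eq[OF that(1)])
      (use that(2) in \<open>auto simp: chart_box_iff image_subset_iff fun_eq_iff extensional_def prod_eq_iff\<close>)
  show ?thesis
    using path_homotopic_trans[OF path_homotopic_trans[OF eq[OF assms(2,3)] f] path_homotopic_sym[OF eq[OF assms(4,5)]]]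
    by (rule path_class_eq)
qed
text \<open>Only points at a chart centre move; all others already lie over no cone point.\<close>

definition nudge :: "(nat \<Rightarrow> nat \<times> complex) \<Rightarrow> real \<Rightarrow> nat \<Rightarrow> nat \<times> complex" where
  "nudge c \<tau> = (\<lambda>i\<in>{1..n}. if fst (c i) \<noteq> 0 \<and> snd (c i) = 0 then (fst (c i), of_real \<tau>) else c i)"

lemma nudge_0: "c \<in> extensional {1..n} \<Longrightarrow> nudge c 0 = c"
  by (auto simp: nudge_def fun_eq_iff extensional_def prod_eq_iff)

lemma nudge_chart_box: "\<bar>\<tau>\<bar> < \<epsilon> \<Longrightarrow> nudge c \<tau> \<in> chart_box c \<epsilon>"
  by (auto simp: nudge_def chart_box_iff)

lemma nudge_regular:
  assumes "nudge c \<tau> \<in> topspace (Obj K)" "\<tau> > 0"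
  shows "nudge c \<tau> \<in> regular"
proof -
  have "\<pi> (nudge c \<tau> i) \<notin> X ` {1..m}" if i: "i \<in> {1..n}" for i
    using cone_point_iff[OF Obj_object[OF assms(1) i]] i assms(2) by (auto simp: nudge_def)
  then show ?thesis using assms(1) unfolding regular_def by blast
qed

lemma continuous_nudge: "continuous_on S (\<lambda>t. nudge c (t * \<tau>) i)" if "i \<in> {1..n}"
  using that by (cases "fst (c i) \<noteq> 0 \<and> snd (c i) = 0") (auto simp: nudge_def intro!: continuous_intros)

lemma joinable_regular:
  assumes "openin (Obj K) S" "c \<in> S"
  obtains u where "u \<in> regular" "joinable (Obj K) S c u"
proof -
  obtain \<epsilon> where \<epsilon>: "\<epsilon> > 0" "chart_box c \<epsilon> \<subseteq> S" using open_contains_chart_box assms by blast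
  have S: "S \<subseteq> topspace (Obj K)" using assms(1) by (rule openin_subset)
  have in_S: "nudge c (t * (\<epsilon> / 2)) \<in> S" if "t \<in> {0..1}" for t
  proof -
    have "t * (\<epsilon> / 2) \<le> 1 * (\<epsilon> / 2)" using that \<epsilon>(1) by (intro mult_right_mono) auto
    then have "\<bar>t * (\<epsilon> / 2)\<bar> < \<epsilon>" using that \<epsilon>(1) by simp
    then show ?thesis using nudge_chart_box \<epsilon>(2) by blast
  qed
  have "joinable (Obj K) S c (nudge c (\<epsilon> / 2))"
    unfolding joinable_def
  proof (intro exI[of _ "\<lambda>t. nudge c (t * (\<epsilon> / 2))"] conjI)
    show im: "(\<lambda>t. nudge c (t * (\<epsilon> / 2))) ` {0..1} \<subseteq> S" using in_S by blast
    show "pathin (Obj K) (\<lambda>t. nudge c (t * (\<epsilon> / 2)))"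
      unfolding pathin_Obj using im S continuous_nudge by blast
    show "nudge c (0 * (\<epsilon> / 2)) = c" using nudge_0 Obj_ext assms(2) S by auto
  qed simp
  moreover have "nudge c (\<epsilon> / 2) \<in> regular"
    using in_S[of 1] S \<epsilon>(1) by (intro nudge_regular) auto
  ultimately show thesis using that by blast
qed

text \<open>A disc without its centre is still path connected, so each coordinate can be moved
  separately around it. Distinctness needs no attention, as the whole box consists of admissible
  configurations.\<close>

lemma joinable_chart_box_regular:
  assumes "chart_box x \<epsilon> \<subseteq> topspace (Obj K)" "u \<in> regular" "u \<in> chart_box x \<epsilon>" "v \<in> regular" "v \<in> chart_box x \<epsilon>"
  shows "joinable (Obj K) (chart_box x \<epsilon> \<inter> regular) u v"
proof -
  let ?B = "\<lambda>i. ball (snd (x i)) \<epsilon> - (if fst (x i) = 0 then {} else {0})"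
  have uv: "fst (u i) = fst (x i) \<and> snd (u i) \<in> ?B i" "fst (v i) = fst (x i) \<and> snd (v i) \<in> ?B i" if i: "i \<in> {1..n}" for i
  proof -
    have "\<pi> (u i) \<notin> X ` {1..m}" "\<pi> (v i) \<notin> X ` {1..m}" using assms(2,4) i unfolding regular_def by blast+
    then show "fst (u i) = fst (x i) \<and> snd (u i) \<in> ?B i" "fst (v i) = fst (x i) \<and> snd (v i) \<in> ?B i"
      using cone_point_iff[OF Obj_object[OF regular_Obj[OF assms(2)] i]]
        cone_point_iff[OF Obj_object[OF regular_Obj[OF assms(4)] i]] assms(3,5) i
      by (auto simp: chart_box_iff dist_commute)
  qed
  have "\<exists>g. path g \<and> path_image g \<subseteq> ?B i \<and> pathstart g = snd (u i) \<and> pathfinish g = snd (v i)"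
    if i: "i \<in> {1..n}" for i
  proof -
    have "connected (?B i)"
      by (cases "fst (x i) = 0") (auto intro!: connected_open_delete)
    moreover have "open (?B i)" by (auto intro: open_delete)
    ultimately have "path_connected (?B i)" by (rule connected_open_path_connected[rotated])
    then show ?thesis using uv[OF i] unfolding path_connected_def by blast
  qed
  then obtain g where g: "\<And>i. i \<in> {1..n} \<Longrightarrow> path (g i) \<and> path_image (g i) \<subseteq> ?B i \<and>
      pathstart (g i) = snd (u i) \<and> pathfinish (g i) = snd (v i)"
    by metis
  let ?p = "\<lambda>t. \<lambda>i\<in>{1..n}. (fst (x i), g i t)"
  have pi: "g i t \<in> ?B i" if "t \<in> {0..1}" "i \<in> {1..n}" for t i
    using g[OF that(2)] that(1) unfolding path_image_def by blast
  have pbox: "?p t \<in> chart_box x \<epsilon>" if "t \<in> {0..1}" for t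
    using pi[OF that] by (auto simp: chart_box_iff dist_commute)
  have preg: "?p t \<in> regular" if t: "t \<in> {0..1}" for t
  proof -
    have top: "?p t \<in> topspace (Obj K)" using pbox[OF t] assms(1) by blast
    have "\<pi> (?p t i) \<notin> X ` {1..m}" if i: "i \<in> {1..n}" for i
      using cone_point_iff[OF Obj_object[OF top i]] pi[OF t i] i by (auto split: if_splits)
    then show ?thesis using top unfolding regular_def by blast
  qed
  show ?thesis
    unfolding joinable_def
  proof (intro exI[of _ ?p] conjI)
    show im: "?p ` {0..1} \<subseteq> chart_box x \<epsilon> \<inter> regular" using pbox preg by blast
    show "pathin (Obj K) ?p"
      unfolding pathin_Obj
    proof (intro conjI ballI)
      show "?p ` {0..1} \<subseteq> topspace (Obj K)" using im regular_Obj by blast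
      show "continuous_on {0..1} (\<lambda>t. ?p t i)" if "i \<in> {1..n}" for i
        using g[OF that] that by (auto simp: path_def intro!: continuous_intros)
    qed
    have "?p 0 i = u i" "?p 1 i = v i" for i
    proof -
      show "?p 0 i = u i" "?p 1 i = v i"
        using g[of i] uv[of i] regular_ext[OF assms(2)] regular_ext[OF assms(4)]
        by (cases "i \<in> {1..n}"; auto simp: extensional_def pathstart_def pathfinish_def prod_eq_iff)+
    qed
    then show "?p 0 = u" "?p 1 = v" by blast+
  qed
qed

lemma smoothable_path_class:
  assumes "smoothable (c 0) (c 1) [Along d]" "path_homotopic (Obj K) c d"
  shows "smoothable (c 0) (c 1) [Along c]"
  using assms gpath_homotopic_Along smoothable_homotopic by blast

lemma smoothable_path:
  assumes "pathin (Obj K) c" "c 0 \<in> regular" "c 1 \<in> regular"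
  shows "smoothable (c 0) (c 1) [Along c]"
proof -
  \<comment> \<open>The local-to-global principle speaks of classes, \<open>smoothable\<close> of
    \<open>G\<close>-paths; the property is therefore required of all representatives with regular
    ends.\<close>
  let ?P = "\<lambda>A. \<forall>c. pathin (Obj K) c \<longrightarrow> c 0 \<in> regular \<longrightarrow> c 1 \<in> regular \<longrightarrow> A = path_class (Obj K) c \<longrightarrow>
    smoothable (c 0) (c 1) [Along c]"
  let ?\<D> = "{chart_box x \<epsilon> | x \<epsilon>. chart_box x \<epsilon> \<subseteq> topspace (Obj K)}"
  have "?P (path_class (Obj K) c)"
  proof (rule path_class_local_global[where R = regular and \<D> = ?\<D> and P = ?P])
    fix A B x y z
    assume P: "?P A" "?P B" and "A \<in> path_classes (Obj K) x y" "B \<in> path_classes (Obj K) y z"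
      and reg: "x \<in> regular" "y \<in> regular" "z \<in> regular"
    obtain d where d: "pathin (Obj K) d" "d 0 = x" "d 1 = y" "A = path_class (Obj K) d"
      using \<open>A \<in> path_classes (Obj K) x y\<close> by (rule path_classesE)
    obtain e where e: "pathin (Obj K) e" "e 0 = y" "e 1 = z" "B = path_class (Obj K) e"
      using \<open>B \<in> path_classes (Obj K) y z\<close> by (rule path_classesE)
    have "smoothable x y [Along d]" "smoothable y z [Along e]"
      using P(1)[rule_format, of d] P(2)[rule_format, of e] d e reg by simp_all
    then have "smoothable x z ([Along d] @ [Along e])" using reg by (rule smoothable_append)
    moreover have "gpath_homotopic K x z [Along (path_join d e)] [Along d, Along e]"
      using gpath_homotopic.sym[OF gpath_homotopic_join[OF d(1) e(1)]] d e by simp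
    ultimately have join: "smoothable x z [Along (path_join d e)]"
      using smoothable_homotopic by simp
    show "?P (class_comp (Obj K) A B)"
    proof (intro allI impI)
      fix c assume c: "pathin (Obj K) c" "class_comp (Obj K) A B = path_class (Obj K) c"
      have pj: "pathin (Obj K) (path_join d e)" using d e by (simp add: pathin_path_join)
      have "path_class (Obj K) c = path_class (Obj K) (path_join d e)" using c d e by (simp add: class_comp_class)
      then have "path_homotopic (Obj K) c (path_join d e)" using path_class_eq_iff[OF pj] by simp
      moreover from path_homotopic_ends[OF this] have "c 0 = x" "c 1 = z" using d e by auto
      ultimately show "smoothable (c 0) (c 1) [Along c]" using join smoothable_path_class[of c "path_join d e"] by simp
    qed
  next
    fix D assume "D \<in> ?\<D>"
    then show "openin (Obj K) D" using openin_chart_box by blast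
  next
    fix D c assume "D \<in> ?\<D>" and c: "pathin (Obj K) c" "c ` {0..1} \<subseteq> D" "c 0 \<in> regular" "c 1 \<in> regular"
    then obtain x \<epsilon> where D: "D = chart_box x \<epsilon>" "chart_box x \<epsilon> \<subseteq> topspace (Obj K)" by blast
    have c01: "c 0 \<in> chart_box x \<epsilon>" "c 1 \<in> chart_box x \<epsilon>" using c(2) D by auto
    obtain d where d: "pathin (Obj K) d" "d ` {0..1} \<subseteq> chart_box x \<epsilon> \<inter> regular" "d 0 = c 0" "d 1 = c 1"
      using joinable_chart_box_regular[OF D(2) c(3) c01(1) c(4) c01(2)] unfolding joinable_def by blast
    have "smoothable (d 0) (d 1) [Along d]"
      using d by (intro smoothable_regular_path) auto
    show "?P (path_class (Obj K) c)"
    proof (intro allI impI)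
      fix c' assume c': "pathin (Obj K) c'" "path_class (Obj K) c = path_class (Obj K) c'"
      have "path_class (Obj K) c = path_class (Obj K) d"
        by (rule chart_box_path_class[OF D(2)]) (use c d D in auto)
      then have "path_homotopic (Obj K) c' d" using c' path_class_eq_iff[OF d(1)] by metis
      moreover from path_homotopic_ends[OF this] have "c' 0 = d 0" "c' 1 = d 1" by auto
      ultimately show "smoothable (c' 0) (c' 1) [Along c']"
        using \<open>smoothable (d 0) (d 1) [Along d]\<close> smoothable_path_class[of c' d] by simp
    qed
  next
    fix D E x assume DE: "D \<in> ?\<D>" "E \<in> ?\<D>" "x \<in> D" "x \<in> E"
    show "\<exists>u\<in>regular. joinable (Obj K) (D \<inter> E) x u"
      by (rule joinable_regular[of "D \<inter> E" x]) (use DE openin_chart_box in auto)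
  next
    show "c ` {0..1} \<subseteq> \<Union>?\<D>"
    proof
      fix y assume "y \<in> c ` {0..1}"
      then have y: "y \<in> topspace (Obj K)" using assms(1) unfolding pathin_Obj by blast
      then obtain \<epsilon> where "\<epsilon> > 0" "chart_box y \<epsilon> \<subseteq> topspace (Obj K)"
        by (rule open_contains_chart_box[OF openin_topspace])
      moreover from this y have "y \<in> chart_box y \<epsilon>" using Obj_ext by (simp add: chart_box_iff)
      ultimately show "y \<in> \<Union>?\<D>" by blast
    qed
  qed (fact assms)+
  then show ?thesis using assms by blast
qed

text \<open>At a cone point the arrow is the germ of the multiplication by \<open>\<zeta>\<close>,
  which is defined nearby too: the source moves to \<open>\<tau>\<close> and the target to
  \<open>\<zeta> * \<tau>\<close>, with \<open>\<zeta>\<close> unchanged. Coordinates away from the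
  centres stay put.\<close>

lemma slide_to_regular:
  assumes g: "g \<in> topspace (Arr K)"
  obtains h where "pathin (Arr K) h" "h 0 = g" "Src K (h 1) \<in> regular" "Tgt K (h 1) \<in> regular"
proof -
  let ?s = "\<lambda>i. fst (g i)" and ?\<zeta> = "\<lambda>i. snd (snd (g i))"
  have src: "Src K g \<in> topspace (Obj K)" using g by (rule Src_Obj)
  obtain \<epsilon> where \<epsilon>: "\<epsilon> > 0" "chart_box (Src K g) \<epsilon> \<subseteq> topspace (Obj K)"
    using open_contains_chart_box[OF openin_topspace src] .
  define f where "f \<tau> = (\<lambda>i\<in>{1..n}. if fst (?s i) \<noteq> 0 \<and> snd (?s i) = 0
      then ((fst (?s i), of_real \<tau>), (fst (?s i), ?\<zeta> i * of_real \<tau>), ?\<zeta> i) else g i)" for \<tau> :: real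
  have src_f: "Src K (f \<tau>) = nudge (Src K g) \<tau>" for \<tau>
    by (auto simp: K_simps f_def nudge_def fun_eq_iff)
  \<comment> \<open>An arrow starting at a chart centre ends at a chart centre over the same cone
    point; as cone points are distinct, both charts are the same.\<close>
  have fixed: "g i = (?s i, (fst (?s i), 0), ?\<zeta> i) \<and> ?\<zeta> i ^ q (fst (?s i)) = 1"
    if i: "i \<in> {1..n}" and c: "fst (?s i) \<noteq> 0" "snd (?s i) = 0" for i
  proof -
    obtain j v l w \<zeta> where gi: "g i = ((j, v), (l, w), \<zeta>)" by (metis prod.exhaust)
    have arr: "((j, v), (l, w), \<zeta>) \<in> Arrows" using Arr_arrow[OF g i] gi by simp
    have jv: "j \<noteq> 0" "v = 0" using c gi by auto
    then have "\<pi> (j, v) \<in> X ` {1..m}" using cone_point_iff[OF arrow_objects(1)[OF arr]] by simp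
    then have lw: "l \<noteq> 0 \<and> w = 0"
      using cone_point_iff[OF arrow_objects(2)[OF arr]] arrow_proj[OF arr] by simp
    have "l \<le> m" "j \<le> m" using arr by (auto simp: cone_arrows_def cone_objects_def)
    then have "q l > 1" "q j > 1" using q lw jv by auto
    then have "X l = X j" using arrow_proj[OF arr] lw jv by (simp add: cone_proj_def zero_power)
    then have "l = j" using inj_X[of l j] \<open>l \<le> m\<close> \<open>j \<le> m\<close> lw jv by auto
    moreover have "if j = l then w = \<zeta> * v \<and> \<zeta> ^ (if j = 0 then 1 else q j) = 1 else \<zeta> = 1"
      using arr unfolding cone_arrows_def mem_Collect_eq prod.case by (elim conjE) assumption
    ultimately show ?thesis using gi jv lw by simp
  qed
  have f_Arr: "f \<tau> \<in> topspace (Arr K)" if "\<bar>\<tau>\<bar> < \<epsilon>" for \<tau>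
  proof -
    have top: "nudge (Src K g) \<tau> \<in> topspace (Obj K)" using nudge_chart_box[OF that] \<epsilon>(2) by blast
    show ?thesis
    proof (rule topspace_ArrI[OF _ _ Obj_inj[OF top]])
      show "f \<tau> \<in> extensional {1..n}" by (simp add: f_def)
      fix i assume i: "i \<in> {1..n}"
      have "fst (f \<tau> i) = Src K (f \<tau>) i" using i by (simp add: K_simps)
      then show "\<pi> (fst (f \<tau> i)) = \<pi> (nudge (Src K g) \<tau> i)" by (simp only: src_f)
      show "f \<tau> i \<in> Arrows"
      proof (cases "fst (?s i) \<noteq> 0 \<and> snd (?s i) = 0")
        case True
        let ?j = "fst (?s i)"
        have "(?j, of_real \<tau>) \<in> Objects"
          using Obj_object[OF top i] True i by (simp add: nudge_def K_simps)
        moreover have \<zeta>: "?\<zeta> i ^ q ?j = 1" using fixed[OF i] True by blast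
        then have "\<pi> (?j, ?\<zeta> i * of_real \<tau>) = \<pi> (?j, of_real \<tau>)"
          using True by (simp add: cone_proj_def power_mult_distrib)
        ultimately have "((?j, of_real \<tau>), (?j, ?\<zeta> i * of_real \<tau>), ?\<zeta> i) \<in> Arrows"
          using \<zeta> True by (simp add: cone_arrows_def cone_objects_def)
        then show ?thesis using True i by (simp add: f_def)
      next
        case False
        then show ?thesis using Arr_arrow[OF g i] i unfolding f_def by (auto split: if_splits)
      qed
    qed
  qed
  let ?h = "\<lambda>t. f (t * (\<epsilon> / 2))"
  have h_Arr: "?h t \<in> topspace (Arr K)" if "t \<in> {0..1}" for t
  proof -
    have "t * (\<epsilon> / 2) \<le> 1 * (\<epsilon> / 2)" using that \<epsilon>(1) by (intro mult_right_mono) auto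
    then show ?thesis using that \<epsilon>(1) by (intro f_Arr) simp
  qed
  show thesis
  proof (rule that)
    show "pathin (Arr K) ?h"
      unfolding pathin_Arr
    proof (intro conjI ballI)
      show "?h ` {0..1} \<subseteq> topspace (Arr K)" using h_Arr by blast
      show "continuous_on {0..1} (\<lambda>t. ?h t i)" if "i \<in> {1..n}" for i
        using that by (cases "fst (?s i) \<noteq> 0 \<and> snd (?s i) = 0") (auto simp: f_def intro!: continuous_intros)
    qed
    show "?h 0 = g"
    proof
      fix i
      show "?h 0 i = g i"
      proof (cases "i \<in> {1..n}")
        case True
        show ?thesis
        proof (cases "fst (?s i) \<noteq> 0 \<and> snd (?s i) = 0")
          case c: True
          then have "g i = (?s i, (fst (?s i), 0), ?\<zeta> i)" using fixed[OF True] by blast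
          moreover have "?h 0 i = ((fst (?s i), 0), (fst (?s i), 0), ?\<zeta> i)" using c True by (simp add: f_def)
          ultimately show ?thesis using c by (metis prod.collapse)
        qed (use True in \<open>auto simp: f_def\<close>)
      qed (use Arr_ext[OF g] in \<open>auto simp: f_def extensional_def\<close>)
    qed
    have "nudge (Src K g) (\<epsilon> / 2) \<in> topspace (Obj K)"
      using nudge_chart_box[of "\<epsilon> / 2" \<epsilon>] \<epsilon> by auto
    then show reg: "Src K (?h 1) \<in> regular" using \<epsilon>(1) nudge_regular by (simp add: src_f)
    have h1: "?h 1 \<in> topspace (Arr K)" using h_Arr[of 1] by simp
    have "\<pi> (Tgt K (?h 1) i) \<notin> X ` {1..m}" if i: "i \<in> {1..n}" for i
    proof -
      have "\<pi> (Tgt K (?h 1) i) = \<pi> (Src K (?h 1) i)"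
        using arrow_proj[OF Arr_arrow[OF h1 i]] i by (simp add: K_simps)
      moreover have "\<pi> (Src K (?h 1) i) \<notin> X ` {1..m}" using reg i unfolding regular_def by blast
      ultimately show ?thesis by simp
    qed
    then show "Tgt K (?h 1) \<in> regular" using Tgt_Obj[OF h1] unfolding regular_def by blast
  qed
qed

text \<open>Intermediate points of a \<open>G\<close>-path may be irregular, so the statement is
  about the path prolonged at both ends to regular points. In the induction \<open>p\<close> varies
  and absorbs the path pieces.\<close>

lemma smoothable_gpath:
  assumes "gpath K x w y" "x \<in> topspace (Obj K)"
    "pathin (Obj K) p" "p 0 \<in> regular" "p 1 = x" "pathin (Obj K) p'" "p' 0 = y" "p' 1 \<in> regular"
  shows "smoothable (p 0) (p' 1) ([Along p] @ w @ [Along p'])"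
  using assms
proof (induction arbitrary: p rule: gpath.induct)
  case (Nil x)
  then have "smoothable (p 0) (p' 1) [Along (path_join p p')]"
    using smoothable_path[of "path_join p p'"] by (simp add: pathin_path_join)
  moreover have "gpath_homotopic K (p 0) (p' 1) [Along p, Along p'] [Along (path_join p p')]"
    using Nil by (intro gpath_homotopic_join) auto
  ultimately show ?case using smoothable_homotopic by simp
next
  case (Along c w y)
  have pc: "pathin (Obj K) (path_join p c)" using Along by (simp add: pathin_path_join)
  have "smoothable (path_join p c 0) (p' 1) ([Along (path_join p c)] @ w @ [Along p'])"
    by (rule Along.IH) (use Along.prems Along.hyps pc pathin_ends in auto)
  moreover have "gpath_homotopic K (p 0) (p' 1) ([Along p, Along c] @ (w @ [Along p'])) ([Along (path_join p c)] @ (w @ [Along p']))"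
  proof (rule gpath_homotopic_append_right)
    show "gpath_homotopic K (p 0) (c 1) [Along p, Along c] [Along (path_join p c)]"
      using Along by (intro gpath_homotopic_join) auto
    show "gpath K (c 1) (w @ [Along p']) (p' 1)"
      by (rule gpath_append[OF \<open>gpath K (c 1) w y\<close>]) (use Along.prems regular_Obj in simp)
  qed
  ultimately show ?case using smoothable_homotopic by simp
next
  case (Jump g w y)
  have g: "g \<in> topspace (Arr K)" by fact
  obtain h where h: "pathin (Arr K) h" "h 0 = g" "Src K (h 1) \<in> regular" "Tgt K (h 1) \<in> regular"
    using slide_to_regular[OF g] .
  have hA: "h t \<in> topspace (Arr K)" if "t \<in> {0..1}" for t using pathin_topspace[OF h(1) that] .
  let ?s = "Src K \<circ> h" and ?t = "Tgt K \<circ> h"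
  have cont: "continuous_on {0..1} (\<lambda>t. h t i)" if "i \<in> {1..n}" for i using h(1) that by (simp add: pathin_Arr)
  have s: "pathin (Obj K) ?s"
    unfolding pathin_Obj
  proof (intro conjI ballI)
    show "?s ` {0..1} \<subseteq> topspace (Obj K)" using hA Src_Obj by auto
    show "continuous_on {0..1} (\<lambda>t. ?s t i)" if "i \<in> {1..n}" for i
      using continuous_on_fst[OF cont[OF that]] that by (simp add: K_simps)
  qed
  have t: "pathin (Obj K) ?t"
    unfolding pathin_Obj
  proof (intro conjI ballI)
    show "?t ` {0..1} \<subseteq> topspace (Obj K)" using hA Tgt_Obj by auto
    show "continuous_on {0..1} (\<lambda>t. ?t t i)" if "i \<in> {1..n}" for i
      using continuous_on_fst[OF continuous_on_snd[OF cont[OF that]]] that by (simp add: K_simps)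
  qed
  have h1: "h 1 \<in> topspace (Arr K)" using hA by simp
  let ?u = "Src K (h 1)" and ?v = "Tgt K (h 1)"
  have p1: "p 1 = Src K g" by fact
  have gp: "gpath K (Tgt K g) (w @ [Along p']) (p' 1)"
    by (rule gpath_append[OF \<open>gpath K (Tgt K g) w y\<close>]) (use Jump.prems regular_Obj in simp)
  \<comment> \<open>After the arrow has been slid to a regular one, the rest of the path is
    prolonged by the way back from the slid target to \<open>Tgt K g\<close>.\<close>
  have "smoothable (path_rev ?t 0) (p' 1) ([Along (path_rev ?t)] @ w @ [Along p'])"
    by (rule Jump.IH) (use Jump.prems h t Tgt_Obj[OF g] pathin_rev[OF t] in simp_all)
  then have 1: "smoothable ?v (p' 1) ([Along (path_rev ?t)] @ w @ [Along p'])" by simp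
  have 2: "smoothable ?u ?v [Jump (h 1)]" using smoothable_jump[OF h1 h(3,4)] .
  have "smoothable (p 0) ?u [Along (path_join p ?s)]"
    using smoothable_path[of "path_join p ?s"] Jump.prems s h p1 by (simp add: pathin_path_join)
  moreover have "gpath_homotopic K (p 0) ?u [Along p, Along ?s] [Along (path_join p ?s)]"
    using gpath_homotopic_join[of K p ?s] Jump.prems s h p1 by simp
  ultimately have 3: "smoothable (p 0) ?u [Along p, Along ?s]" using smoothable_homotopic by blast
  have "smoothable (p 0) (p' 1) ([Along p, Along ?s] @ [Jump (h 1)] @ ([Along (path_rev ?t)] @ w @ [Along p']))"
    using smoothable_append[OF 3 smoothable_append[OF 2 1 h(3,4)]] Jump.prems h by simp
  moreover have "gpath_homotopic K (p 0) (p' 1) ([Along p] @ [Jump g] @ w @ [Along p'])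
      ([Along p, Along ?s] @ [Jump (h 1)] @ ([Along (path_rev ?t)] @ w @ [Along p']))"
  proof (rule gpath_homotopic.trans)
    have pg: "gpath K (p 0) ([Along p] @ [Jump g]) (Tgt K g)"
      using Jump.prems g p1 Tgt_Obj[OF g] by simp
    have "gpath_homotopic K (Tgt K g) (p' 1) ([] @ (w @ [Along p'])) ([Along ?t, Along (path_rev ?t)] @ (w @ [Along p']))"
      by (rule gpath_homotopic_append_right[OF gpath_homotopic.sym])
        (use gpath_homotopic_rev[OF t] h gp in simp_all)
    from gpath_homotopic_append_left[OF this pg]
    show "gpath_homotopic K (p 0) (p' 1) ([Along p] @ [Jump g] @ w @ [Along p'])
       ([Along p] @ [Jump g, Along ?t] @ [Along (path_rev ?t)] @ w @ [Along p'])" by simp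
    have "gpath_homotopic K (Src K g) ?v [Jump (h 0), Along ?t] [Along ?s, Jump (h 1)]"
      by (rule gmove_homotopic[OF gmove.slide[OF h(1)]]) (use h s t g h1 Tgt_Obj[OF h1] in simp_all)
    then have "gpath_homotopic K (Src K g) ?v [Jump g, Along ?t] [Along ?s, Jump (h 1)]" by (simp only: h(2))
    moreover have "gpath K ?v ([Along (path_rev ?t)] @ w @ [Along p']) (p' 1)"
      using pathin_rev[OF t] gp h by simp
    ultimately have s2: "gpath_homotopic K (Src K g) (p' 1) ([Jump g, Along ?t] @ ([Along (path_rev ?t)] @ w @ [Along p']))
        ([Along ?s, Jump (h 1)] @ ([Along (path_rev ?t)] @ w @ [Along p']))"
      by (rule gpath_homotopic_append_right)
    have pp: "gpath K (p 0) [Along p] (Src K g)" using Jump.prems p1 Src_Obj[OF g] by simp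
    from gpath_homotopic_append_left[OF s2 pp] show "gpath_homotopic K (p 0) (p' 1) ([Along p] @ [Jump g, Along ?t] @ [Along (path_rev ?t)] @ w @ [Along p'])
       ([Along p, Along ?s] @ [Jump (h 1)] @ ([Along (path_rev ?t)] @ w @ [Along p']))"
      by simp
  qed
  ultimately show ?case using smoothable_homotopic by simp
qed

section \<open>The homomorphism from the complement and its image\<close>

abbreviation b where "b \<equiv> incl base"

lemma b_regular: "b \<in> regular"
  using base_topspace by (rule incl_regular)

lemma b_Obj: "b \<in> topspace (Obj K)"
  using b_regular by (rule regular_Obj)

lemma down_b: "down b = Idt K b" and up_b: "up b = Idt K b"
  by (auto simp: down_def up_def K_simps regular_incl_def fun_eq_iff)

lemma gloop_regular:
  assumes w: "gpath K b w b"
  obtains \<gamma> where "pathin M \<gamma>" "\<gamma> 0 = base" "\<gamma> 1 = base" "gpath_homotopic K b b w [Along (incl \<circ> \<gamma>)]"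
proof -
  let ?c = "Along (\<lambda>_. b)"
  have const: "pathin (Obj K) (\<lambda>_. b)" using b_Obj by (simp add: pathin_const)
  have "smoothable b b ([?c] @ w @ [?c])"
    using smoothable_gpath[OF w b_Obj const _ _ const] b_regular by simp
  then obtain \<gamma> where \<gamma>: "pathin M \<gamma>" "\<gamma> 0 = base" "\<gamma> 1 = base"
    "gpath_homotopic K b b ([?c] @ w @ [?c]) [Jump (Idt K b), Along (incl \<circ> \<gamma>), Jump (Idt K b)]"
    unfolding smoothable_def down_b up_b Proj_incl[OF base_topspace] by blast
  have c: "gpath_homotopic K b b [?c] []" using gpath_homotopic_const[OF b_Obj] .
  have "gpath_homotopic K b b ([?c] @ w @ [?c]) ([] @ w @ [])"
    by (rule gpath_homotopic_append[OF c gpath_homotopic_append[OF gpath_homotopic.refl[OF w] c]])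
  then have 1: "gpath_homotopic K b b w ([?c] @ w @ [?c])" by (simp add: gpath_homotopic.sym)
  have i: "gpath_homotopic K b b [Jump (Idt K b)] []" using Idt_homotopic[OF b_Obj] .
  have l: "gpath K b [Along (incl \<circ> \<gamma>)] b" using \<gamma> pathin_incl[OF \<gamma>(1)] b_Obj by simp
  have "gpath_homotopic K b b ([Jump (Idt K b)] @ [Along (incl \<circ> \<gamma>)] @ [Jump (Idt K b)]) ([] @ [Along (incl \<circ> \<gamma>)] @ [])"
    by (rule gpath_homotopic_append[OF i gpath_homotopic_append[OF gpath_homotopic.refl[OF l] i]])
  then have 2: "gpath_homotopic K b b [Jump (Idt K b), Along (incl \<circ> \<gamma>), Jump (Idt K b)] [Along (incl \<circ> \<gamma>)]" by simp
  show thesis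
    using that[OF \<gamma>(1-3) gpath_homotopic.trans[OF 1 gpath_homotopic.trans[OF \<gamma>(4) 2]]] .
qed

abbreviation OG where "OG \<equiv> orb_pure_braid_group n k m q a"
abbreviation \<O> where "\<O> \<equiv> orb_hom n k m q a"

lemma OG_eq: "OG = orb_fundamental_group K b"
  by (simp add: orb_pure_braid_group_def)

lemma gpath_loop:
  assumes "pathin M \<gamma>" "\<gamma> 0 = base" "\<gamma> 1 = base"
  shows "gpath K b [Along (incl \<circ> \<gamma>)] b"
  using assms pathin_incl[OF assms(1)] b_Obj by simp

lemma orb_hom_class:
  assumes "pathin M \<gamma>" "\<gamma> 0 = base" "\<gamma> 1 = base"
  shows "\<O> (path_class M \<gamma>) = gclass K b [Along (incl \<circ> \<gamma>)]"
proof -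
  have "gclass K b [Along (incl \<circ> \<delta>)] = gclass K b [Along (incl \<circ> \<gamma>)]" if "\<delta> \<in> path_class M \<gamma>" for \<delta>
  proof -
    have "path_homotopic (Obj K) (incl \<circ> \<gamma>) (incl \<circ> \<delta>)"
      using that continuous_map_incl by (intro path_homotopic_compose) (auto simp: path_class_def)
    from gpath_homotopic_Along[OF this] show ?thesis using assms by (intro gclass_eq[symmetric]) simp
  qed
  then show ?thesis
    using path_class_self[OF assms(1)] unfolding orb_hom_def gclass_def[symmetric] by blast
qed

lemma orb_hom_hom: "\<O> \<in> hom G OG"
proof (rule homI)
  fix A assume "A \<in> carrier G"
  then obtain \<gamma> where \<gamma>: "pathin M \<gamma>" "\<gamma> 0 = base" "\<gamma> 1 = base" "A = path_class M \<gamma>"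
    unfolding carrier_fundamental_group by (rule path_classesE)
  then show "\<O> A \<in> carrier OG"
    using gpath_loop unfolding OG_eq carrier_orb_fundamental_group by (auto simp: orb_hom_class)
next
  fix A B assume AB: "A \<in> carrier G" "B \<in> carrier G"
  obtain \<gamma> where \<gamma>: "pathin M \<gamma>" "\<gamma> 0 = base" "\<gamma> 1 = base" "A = path_class M \<gamma>"
    using AB(1) unfolding carrier_fundamental_group by (rule path_classesE)
  obtain \<delta> where \<delta>: "pathin M \<delta>" "\<delta> 0 = base" "\<delta> 1 = base" "B = path_class M \<delta>"
    using AB(2) unfolding carrier_fundamental_group by (rule path_classesE)
  have "A \<otimes>\<^bsub>G\<^esub> B = class_comp M A B"
    by (rule mult_fundamental_group[OF AB[unfolded carrier_fundamental_group]])
  also have "\<dots> = path_class M (path_join \<gamma> \<delta>)"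
    unfolding \<gamma>(4) \<delta>(4) by (rule class_comp_class) (simp_all add: \<gamma>(1,3) \<delta>(1,2))
  finally have AB_eq: "A \<otimes>\<^bsub>G\<^esub> B = path_class M (path_join \<gamma> \<delta>)" .
  have \<gamma>\<delta>: "pathin M (path_join \<gamma> \<delta>)" "path_join \<gamma> \<delta> 0 = base" "path_join \<gamma> \<delta> 1 = base"
    using \<gamma>(2,3) \<delta>(2,3) by (auto intro: pathin_path_join[OF \<gamma>(1) \<delta>(1)])
  have "\<O> (A \<otimes>\<^bsub>G\<^esub> B) = gclass K b [Along (path_join (incl \<circ> \<gamma>) (incl \<circ> \<delta>))]"
    unfolding AB_eq orb_hom_class[OF \<gamma>\<delta>] comp_path_join ..
  also have "\<dots> = gclass K b ([Along (incl \<circ> \<gamma>)] @ [Along (incl \<circ> \<delta>)])"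
  proof -
    have "gpath_homotopic K b b [Along (incl \<circ> \<gamma>), Along (incl \<circ> \<delta>)] [Along (path_join (incl \<circ> \<gamma>) (incl \<circ> \<delta>))]"
      using gpath_homotopic_join[OF pathin_incl[OF \<gamma>(1)] pathin_incl[OF \<delta>(1)]] \<gamma>(2,3) \<delta>(2,3) by simp
    from gclass_eq[OF this] show ?thesis by simp
  qed
  also have "\<dots> = \<O> A \<otimes>\<^bsub>OG\<^esub> \<O> B"
    unfolding OG_eq \<gamma>(4) \<delta>(4) orb_hom_class[OF \<gamma>(1-3)] orb_hom_class[OF \<delta>(1-3)]
    by (rule mult_orb_fundamental_group[symmetric]; rule gpath_loop; fact)
  finally show "\<O> (A \<otimes>\<^bsub>G\<^esub> B) = \<O> A \<otimes>\<^bsub>OG\<^esub> \<O> B" .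
qed

lemma orb_hom_surj: "\<O> ` carrier G = carrier OG"
proof
  show "\<O> ` carrier G \<subseteq> carrier OG" using orb_hom_hom by (auto simp: hom_def)
  show "carrier OG \<subseteq> \<O> ` carrier G"
  proof
    fix A assume "A \<in> carrier OG"
    then obtain w where w: "gpath K b w b" "A = gclass K b w"
      unfolding OG_eq carrier_orb_fundamental_group by blast
    obtain \<gamma> where \<gamma>: "pathin M \<gamma>" "\<gamma> 0 = base" "\<gamma> 1 = base" "gpath_homotopic K b b w [Along (incl \<circ> \<gamma>)]"
      using gloop_regular[OF w(1)] .
    have "A = \<O> (path_class M \<gamma>)"
      using w(2) gclass_eq[OF \<gamma>(4)] by (simp add: orb_hom_class[OF \<gamma>(1-3)])
    moreover have "path_class M \<gamma> \<in> carrier G" using \<gamma> by (auto simp: carrier_fundamental_group)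
    ultimately show "A \<in> \<O> ` carrier G" by blast
  qed
qed

lemma orb_hom_one: "\<O> \<one>\<^bsub>G\<^esub> = \<one>\<^bsub>OG\<^esub>"
proof -
  have "\<O> \<one>\<^bsub>G\<^esub> = gclass K b [Along (incl \<circ> (\<lambda>_. base))]"
    unfolding one_fundamental_group[OF base_topspace] class_one_def
    using base_topspace by (intro orb_hom_class) (auto simp: pathin_const)
  also have "\<dots> = gclass K b []"
    using gpath_homotopic_const[OF b_Obj] by (intro gclass_eq) (simp add: o_def)
  finally show ?thesis by (simp add: OG_eq one_orb_fundamental_group)
qed

text \<open>The group axioms come from the complement: the image of a group under a homomorphism is
  a group, and here the image is everything.\<close>

lemma group_OG: "group OG"
proof -
  have "group (OG\<lparr>carrier := \<O> ` carrier G, one := \<O> \<one>\<^bsub>G\<^esub>\<rparr>)"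
    using group.hom_imp_img_group[OF group_G orb_hom_hom] .
  then show ?thesis by (simp add: orb_hom_surj orb_hom_one)
qed

text \<open>The three families correspond to the second index lying among the moving points, the
  punctures or the cone points.\<close>

lemma generators_eq:
  "(\<Union>i\<in>{1..n}. \<Union>j\<in>{1..m}. X_braid n k m q a i j) \<union>
   (\<Union>i\<in>{1..n}. \<Union>j\<in>{1..k}. P_braid n k m q a i j) \<union>
   (\<Union>j\<in>{1..n}. \<Union>i\<in>{1..<j}. B_braid n k m q a i j)
   = \<O> ` (\<Union>i\<in>{1..n}. \<Union>j\<in>{i<..N}. pure_braid n (k + m) a i j)" (is "?L = ?R")
proof
  show "?L \<subseteq> ?R"
  proof
    fix A assume "A \<in> ?L"
    then consider (X) i j where "i \<in> {1..n}" "j \<in> {1..m}" "A \<in> X_braid n k m q a i j"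
      | (P) i j where "i \<in> {1..n}" "j \<in> {1..k}" "A \<in> P_braid n k m q a i j"
      | (B) i j where "j \<in> {1..n}" "i \<in> {1..<j}" "A \<in> B_braid n k m q a i j" by blast
    then have "\<exists>i\<in>{1..n}. \<exists>j\<in>{i<..N}. A \<in> \<O> ` pure_braid n (k + m) a i j"
    proof cases
      case X then show ?thesis by (intro bexI[of _ i] bexI[of _ "n + k + j"]) (auto simp: X_braid_def)
    next
      case P then show ?thesis by (intro bexI[of _ i] bexI[of _ "n + j"]) (auto simp: P_braid_def)
    next
      case B then show ?thesis by (intro bexI[of _ i] bexI[of _ j]) (auto simp: B_braid_def)
    qed
    then show "A \<in> ?R" by blast
  qed
  show "?R \<subseteq> ?L"
  proof
    fix A assume "A \<in> ?R"
    then obtain i j where ij: "i \<in> {1..n}" "j \<in> {i<..N}" "A \<in> \<O> ` pure_braid n (k + m) a i j" by blast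
    consider "j \<le> n" | "n < j" "j \<le> n + k" | "n + k < j" by linarith
    then show "A \<in> ?L"
    proof cases
      case 1
      then have "A \<in> (\<Union>j\<in>{1..n}. \<Union>i\<in>{1..<j}. B_braid n k m q a i j)"
        using ij by (intro UN_I[of j] UN_I[of i]) (auto simp: B_braid_def)
      then show ?thesis by blast
    next
      case 2
      then have "A \<in> (\<Union>i\<in>{1..n}. \<Union>j\<in>{1..k}. P_braid n k m q a i j)"
        using ij by (intro UN_I[of i] UN_I[of "j - n"]) (auto simp: P_braid_def)
      then show ?thesis by blast
    next
      case 3
      then have "A \<in> (\<Union>i\<in>{1..n}. \<Union>j\<in>{1..m}. X_braid n k m q a i j)"
        using ij by (intro UN_I[of i] UN_I[of "j - n - k"]) (auto simp: X_braid_def)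
      then show ?thesis by blast
    qed
  qed
qed

lemma generate_orb:
  assumes "n \<ge> 1"
  shows "generate OG (\<O> ` (\<Union>i\<in>{1..n}. \<Union>j\<in>{i<..N}. pure_braid n (k + m) a i j)) = carrier OG"
proof -
  let ?S = "\<Union>i\<in>{1..n}. \<Union>j\<in>{i<..N}. pure_braid n (k + m) a i j"
  interpret group_hom G OG \<O>
    using group_G group_OG orb_hom_hom by (simp add: group_hom_def group_hom_axioms_def)
  have "?S \<subseteq> carrier G" by (auto simp: pure_braid_def)
  then have "generate OG (\<O> ` ?S) = \<O> ` generate G ?S" by (simp add: generate_img)
  also have "\<dots> = carrier OG" using generate_pure_braids assms orb_hom_surj by simp
  finally show ?thesis .
qed

end

theorem lemma4p1:
  fixes n k m :: nat and q :: "nat \<Rightarrow> nat" and a :: "nat \<Rightarrow> real"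
  assumes "n \<ge> 1"
    and "\<And>j. j \<in> {1..m} \<Longrightarrow> q j > 1"
    and "strict_mono_on {1..n + k + m} a"
  shows "generate (orb_pure_braid_group n k m q a)
           ((\<Union>i\<in>{1..n}. \<Union>j\<in>{1..m}. X_braid n k m q a i j) \<union>
            (\<Union>i\<in>{1..n}. \<Union>j\<in>{1..k}. P_braid n k m q a i j) \<union>
            (\<Union>j\<in>{1..n}. \<Union>i\<in>{1..<j}. B_braid n k m q a i j))
         = carrier (orb_pure_braid_group n k m q a)"
proof -
  interpret cone_orbifold n k m q a
    using assms(2,3) by unfold_locales
  show ?thesis
    unfolding generators_eq using assms(1) by (rule generate_orb)
qed

end
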